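(* Let $\alpha>0$ be a constant independent of $n$, let $m=\alpha n$, and let $H$ be an $m\times n$ matrix with i.i.d. standard normal components. Let $H^TH=Q\Lambda Q^T$ be the eigendecomposition, with $Q$ an $n\times n$ matrix such that $Q^TQ=I$ and $\Lambda$ the diagonal matrix of eigenvalues of $H^TH$ sorted so that $\Lambda_{1,1}\ge\Lambda_{2,2}\ge\dots\ge\Lambda_{n,n}$. Let $$\hat{\mathbf{x}}^{(eig)}=\mathrm{sign}(Q_{:,1}),\qquad r^{(eig)}=\|H\hat{\mathbf{x}}^{(eig)}\|_2^2 .$$ Then $$\lim_{n\to\infty}\frac{E\,r^{(eig)}}{n^2}\ \ge\ \lim_{n\to\infty}\frac{\Lambda_{1,1}\big(\sum_{i=1}^{n}|Q_{i,1}|\big)^2}{n^2}=(\sqrt{\alpha}+1)^2\,\frac{2}{\pi}.$$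
   Context: $Q_{:,1}$ is the first column of $Q$ (a unit eigenvector for the largest eigenvalue of $H^TH$), with components $Q_{i,1}$; $\mathrm{sign}$ is applied componentwise, so $\hat{\mathbf{x}}^{(eig)}\in\{-1,1\}^n$. $\|\cdot\|_2$ is the Euclidean norm and $E$ denotes expectation. The random quantities in the middle expression are treated as concentrating for large $n$. The vector $\hat{\mathbf{x}}^{(eig)}$ is the output of the "dominating eigenvector" algorithm for approximately maximizing $\|H\mathbf{x}\|_2^2$ over $\mathbf{x}\in\{-1,1\}^n$ (the positive Hopfield form, rescaled). *)

theory Defs
  imports "HOL-Probability.Probability" "Jordan_Normal_Form.Matrix"
begin

text \<open>The value at 0 is set to 1, so that the sign vector always lies in $\{-1,1\}^n$.\<close>

definition sign_pm :: "real \<Rightarrow> real" where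
  "sign_pm t = (if t \<ge> 0 then 1 else - 1)"

definition sign_vec :: "real Matrix.vec \<Rightarrow> real Matrix.vec" where
  "sign_vec v = map_vec sign_pm v"

definition l2_norm_vec :: "real Matrix.vec \<Rightarrow> real" where
  "l2_norm_vec v = L2_set (vec_index v) {..<dim_vec v}"

definition l1_norm_vec :: "real Matrix.vec \<Rightarrow> real" where
  "l1_norm_vec v = (\<Sum>i<dim_vec v. \<bar>vec_index v i\<bar>)"

definition sorted_eigendecomposition ::
    "nat \<Rightarrow> real Matrix.mat \<Rightarrow> real Matrix.mat \<Rightarrow> real Matrix.mat \<Rightarrow> bool" where
  "sorted_eigendecomposition n A Q L \<longleftrightarrow>
     Q \<in> carrier_mat n n \<and> L \<in> carrier_mat n n \<and>
     transpose_mat Q * Q = 1\<^sub>m n \<and>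
     diagonal_mat L \<and>
     (\<forall>i j. i \<le> j \<longrightarrow> j < n \<longrightarrow> L $$ (j, j) \<le> L $$ (i, i)) \<and>
     A = Q * L * transpose_mat Q"

text \<open>A random matrix is a function from the sample space all of whose values are
  matrices of the given format and all of whose entries are random variables.\<close>

definition random_matrix :: "'a measure \<Rightarrow> nat \<Rightarrow> nat \<Rightarrow> ('a \<Rightarrow> real Matrix.mat) \<Rightarrow> bool" where
  "random_matrix M m n X \<longleftrightarrow>
     (\<forall>\<omega>\<in>space M. X \<omega> \<in> carrier_mat m n) \<and>
     (\<forall>i<m. \<forall>j<n. (\<lambda>\<omega>. X \<omega> $$ (i, j)) \<in> borel_measurable M)"

definition iid_std_normal_matrix ::
    "'a measure \<Rightarrow> nat \<Rightarrow> nat \<Rightarrow> ('a \<Rightarrow> real Matrix.mat) \<Rightarrow> bool" where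
  "iid_std_normal_matrix M m n H \<longleftrightarrow>
     random_matrix M m n H \<and>
     prob_space.indep_vars M (\<lambda>_. borel) (\<lambda>(i, j) \<omega>. H \<omega> $$ (i, j)) ({..<m} \<times> {..<n}) \<and>
     (\<forall>i<m. \<forall>j<n. distributed M lborel (\<lambda>\<omega>. H \<omega> $$ (i, j)) std_normal_density)"

definition x_eig :: "real Matrix.mat \<Rightarrow> real Matrix.vec" where
  "x_eig Q = sign_vec (col Q 0)"

definition r_eig :: "real Matrix.mat \<Rightarrow> real Matrix.mat \<Rightarrow> real" where
  "r_eig H Q = (l2_norm_vec (H *\<^sub>v x_eig Q))\<^sup>2"

text \<open>Convergence in probability to a constant. The variables may live on different
  probability spaces, since no joint law across different dimensions is specified.\<close>

definition tendsto_in_probability ::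
    "(nat \<Rightarrow> 'a measure) \<Rightarrow> (nat \<Rightarrow> 'a \<Rightarrow> real) \<Rightarrow> real \<Rightarrow> bool" where
  "tendsto_in_probability M X c \<longleftrightarrow>
     (\<forall>\<epsilon>>0. (\<lambda>n. measure (M n) {\<omega> \<in> space (M n). \<bar>X n \<omega> - c\<bar> > \<epsilon>}) \<longlonglongrightarrow> 0)"

end

theory Submission
  imports Defs "Jordan_Normal_Form.Determinant"
begin

text \<open>
Write \<lambda>_1 \<ge> \<dots> \<ge> \<lambda>_n for the eigenvalues of the Gram matrix of H, q_1, \<dots>, q_n for an
orthonormal basis of eigenvectors, and s for the sign vector of q_1.  Then r is the sum of the
\<lambda>_k (q_k . s)^2, and its first term is \<lambda>_1 times the squared l1 norm of q_1.  Two facts about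
Gaussian matrices decide the limits.

The first is that the eigenvectors carry no information.  The law of H does not change when H is
multiplied from the right by an orthogonal matrix, so H may be replaced by H O^T with O Haar
distributed and independent of H (\<open>nn_integral_average\<close>).  This keeps the eigenvalues and turns
q_k into O q_k; given H, these are distributed as the columns of O.  Hence the mean of (q_k . s)^2
given the eigenvalues is the second moment c of the l1 norm of a column for k = 1, and one common
number for all k > 1.  As the n numbers add up to |s|^2 = n, this common number is (n - c)/(n - 1),
and so E r is an explicit function of c and of E \<lambda>_1 (\<open>nn_integral_r\<close>).  A column of a Haar
matrix is a normalised Gaussian vector, so its squared l1 norm divided by n is close to
(E|g|)^2 = 2/\<pi>, where g is a standard normal variable (\<open>haar_column_concentration\<close>).

The second is that \<lambda>_1 / n tends to \<kappa>^2 with \<kappa> = sqrt \<alpha> + 1.  Alternating Householder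
reflections from the left and from the right bring H to bidiagonal form without disturbing the
Gaussian law of the part not yet treated.  So the entries on and above the diagonal have chi laws
whose degrees of freedom decrease slowly from m and from n (\<open>bidiag_sq_law\<close>).  None of them exceeds
sqrt m and sqrt n by much, respectively, which bounds the norm of H by about sqrt m + sqrt n
(\<open>bil_top_upper\<close>); the constant vector on a leading corner shows that this value is nearly attained
(\<open>bil_top_lower\<close>).  An upper bound for E \<lambda>_1 and a lower bound for E (sqrt \<lambda>_1) together make
E (sqrt (\<lambda>_1 / n) - \<kappa>)^2 small, so \<lambda>_1 / n converges in mean (\<open>top_deviation\<close>).

The product of the two quantities therefore converges in probability to \<kappa>^2 2/\<pi>, while
E r / n^2 converges to \<kappa>^2 2/\<pi> + (1 - 2/\<pi>) \<alpha>, where the second summand comes from the trace of the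
Gram matrix, whose mean is m n.  Both halves use that \<lambda>_1 is almost surely simple, because otherwise
q_1 would not be determined by H up to sign.  This too is read off from the bidiagonal form: if all
its entries are nonzero, then no singular vector for a nonzero singular value has first coordinate
zero, whereas a two-dimensional eigenspace would contain such a vector (\<open>nondeg_singular_vector\<close>).
\<close>

section \<open>Gaussian arrays\<close>

text \<open>An m by n matrix is represented by its family of entries, indexed by pairs.  Random matrices
then live on product spaces whose index set may depend on the dimension.\<close>

abbreviation arrays :: "'i set \<Rightarrow> ('i \<Rightarrow> real) measure" where
  "arrays I \<equiv> PiM I (\<lambda>_. borel)"

definition gauss :: "'i set \<Rightarrow> ('i \<Rightarrow> real) measure" where
  "gauss I = PiM I (\<lambda>_. std_normal_distribution)"

lemma sets_gauss [measurable_cong]: "sets (gauss I) = sets (arrays I)"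
  unfolding gauss_def by (rule sets_PiM_cong) auto

lemma space_gauss: "space (gauss I) = extensional I"
  unfolding gauss_def by (simp add: space_PiM PiE_def)

lemma prob_space_std_normal: "prob_space std_normal_distribution"
  using real_dist_normal_dist by (simp add: real_distribution_def)

lemma product_prob_space_std_normal:
  "product_prob_space (\<lambda>_::'i. std_normal_distribution)"
  by (simp add: product_prob_space_def product_sigma_finite_def product_prob_space_axioms_def
      prob_space_std_normal prob_space_imp_sigma_finite)

lemma prob_space_gauss: "prob_space (gauss I)"
  unfolding gauss_def
  by (intro prob_space_PiM prob_space_std_normal)

lemma nn_integral_gauss_insert:
  assumes "finite I" "i \<notin> I" "f \<in> borel_measurable (arrays (insert i I))"
  shows "(\<integral>\<^sup>+x. f x \<partial>gauss (insert i I)) =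
    (\<integral>\<^sup>+x. \<integral>\<^sup>+t. f (x(i := t)) \<partial>std_normal_distribution \<partial>gauss I)"
proof -
  interpret product_prob_space "\<lambda>_. std_normal_distribution" by (rule product_prob_space_std_normal)
  have "f \<in> borel_measurable (gauss (insert i I))"
    using assms(3) by (subst measurable_cong_sets[OF sets_gauss refl])
  then show ?thesis
    using assms product_nn_integral_insert[of I i f] unfolding gauss_def by simp
qed

lemma nn_integral_gauss_merge:
  assumes "finite I" "finite J" "I \<inter> J = {}" "f \<in> borel_measurable (arrays (I \<union> J))"
  shows "(\<integral>\<^sup>+x. f x \<partial>gauss (I \<union> J)) =
    (\<integral>\<^sup>+x. \<integral>\<^sup>+y. f (merge I J (x, y)) \<partial>gauss J \<partial>gauss I)"
proof -
  interpret product_prob_space "\<lambda>_. std_normal_distribution" by (rule product_prob_space_std_normal)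
  have "f \<in> borel_measurable (gauss (I \<union> J))"
    using assms(4) by (subst measurable_cong_sets[OF sets_gauss refl])
  then show ?thesis
    using assms product_nn_integral_fold[of I J f] unfolding gauss_def by simp
qed

lemma nn_integral_gauss_reindex:
  assumes "inj_on h I" "h ` I \<subseteq> K" "f \<in> borel_measurable (arrays I)"
  shows "(\<integral>\<^sup>+x. f (\<lambda>i\<in>I. x (h i)) \<partial>gauss K) = (\<integral>\<^sup>+x. f x \<partial>gauss I)"
proof -
  have *: "distr (gauss K) (gauss I) (\<lambda>x. \<lambda>i\<in>I. x (h i)) = gauss I"
    unfolding gauss_def using assms
    by (intro distr_PiM_reindex prob_space_std_normal) auto
  have m: "(\<lambda>x. \<lambda>i\<in>I. x (h i)) \<in> measurable (gauss K) (gauss I)"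
    using assms(2) unfolding gauss_def by (auto intro!: measurable_restrict measurable_component_singleton)
  have "f \<in> borel_measurable (gauss I)"
    using assms(3) by (subst measurable_cong_sets[OF sets_gauss refl])
  then have "(\<integral>\<^sup>+x. f x \<partial>distr (gauss K) (gauss I) (\<lambda>x. \<lambda>i\<in>I. x (h i))) =
     (\<integral>\<^sup>+x. f (\<lambda>i\<in>I. x (h i)) \<partial>gauss K)"
    by (subst nn_integral_distr[OF m]) auto
  then show ?thesis unfolding * by simp
qed

text \<open>A reflection of the plane is a composition of affine substitutions in one variable at a time (and
an exchange of the axes if \<open>c = 0\<close>), to each of which Fubini's theorem applies.\<close>

lemma nn_integral_lborel_reflect:
  fixes F :: "real \<times> real \<Rightarrow> ennreal"
  assumes [measurable]: "F \<in> borel_measurable (borel \<Otimes>\<^sub>M borel)" and cs: "c\<^sup>2 + s\<^sup>2 = 1"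
  shows "(\<integral>\<^sup>+x. \<integral>\<^sup>+y. F (c * x + s * y, s * x - c * y) \<partial>lborel \<partial>lborel) =
         (\<integral>\<^sup>+x. \<integral>\<^sup>+y. F (x, y) \<partial>lborel \<partial>lborel)"
proof (cases "c = 0")
  case True
  then have s: "s \<noteq> 0" "\<bar>s\<bar> = 1" using cs by (auto simp: power2_eq_1_iff)
  have "(\<integral>\<^sup>+x. \<integral>\<^sup>+y. F (c * x + s * y, s * x - c * y) \<partial>lborel \<partial>lborel) =
     (\<integral>\<^sup>+x. \<integral>\<^sup>+y. F (0 + s * y, s * x) \<partial>lborel \<partial>lborel)" using True by simp
  also have "\<dots> = (\<integral>\<^sup>+x. \<integral>\<^sup>+y. F (y, s * x) \<partial>lborel \<partial>lborel)"
    using nn_integral_real_affine[OF _ s(1), of "\<lambda>y. F (y, s * x)" 0 for x] s(2)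
    by (simp add: measurable_Pair2')
  also have "\<dots> = (\<integral>\<^sup>+y. \<integral>\<^sup>+x. F (y, 0 + s * x) \<partial>lborel \<partial>lborel)"
    by (subst lborel_pair.Fubini') auto
  also have "\<dots> = (\<integral>\<^sup>+y. \<integral>\<^sup>+x. F (y, x) \<partial>lborel \<partial>lborel)"
    using nn_integral_real_affine[OF _ s(1), of "\<lambda>x. F (y, x)" 0 for y] s(2) by simp
  finally show ?thesis .
next
  case False
  have "s * s - 1 = - (c * c)" using cs by (simp add: power2_eq_square)
  then have e: "(s / c) * (c * x + s * y) - y / c = s * x - c * y" for x y
  proof -
    have "(s / c) * (c * x + s * y) - y / c = s * x + (s * s - 1) * y / c"
      using False by (simp add: field_simps)
    then show ?thesis using False \<open>s * s - 1 = - (c * c)\<close> by simp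
  qed
  have 1: "ennreal \<bar>c\<bar> * (\<integral>\<^sup>+x. F (c * x + s * y, s * x - c * y) \<partial>lborel) =
     (\<integral>\<^sup>+u. F (u, (s / c) * u - y / c) \<partial>lborel)" for y
    using nn_integral_real_affine[OF _ False, of "\<lambda>u. F (u, (s / c) * u - y / c)" "s * y"]
    by (simp add: e add.commute del: times_divide_eq_left)
  have 2: "(\<integral>\<^sup>+y. F (u, (s / c) * u - y / c) \<partial>lborel) = ennreal \<bar>c\<bar> * (\<integral>\<^sup>+v. F (u, v) \<partial>lborel)" for u
  proof -
    have "(\<integral>\<^sup>+v. F (u, v) \<partial>lborel) = ennreal \<bar>- 1 / c\<bar> * (\<integral>\<^sup>+y. F (u, (s / c) * u + (- 1 / c) * y) \<partial>lborel)"
      using False by (intro nn_integral_real_affine) auto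
    also have "(\<lambda>y. (s / c) * u + (- 1 / c) * y) = (\<lambda>y. (s / c) * u - y / c)" by auto
    finally have "ennreal \<bar>c\<bar> * (\<integral>\<^sup>+v. F (u, v) \<partial>lborel) =
      (ennreal \<bar>c\<bar> * ennreal \<bar>- 1 / c\<bar>) * (\<integral>\<^sup>+y. F (u, (s / c) * u - y / c) \<partial>lborel)"
      by (simp add: mult.assoc)
    moreover have "ennreal \<bar>c\<bar> * ennreal \<bar>- 1 / c\<bar> = 1"
      using False by (simp add: ennreal_mult[symmetric] abs_mult[symmetric] del: ennreal_1)
    ultimately show ?thesis by simp
  qed
  have "ennreal \<bar>c\<bar> * (\<integral>\<^sup>+x. \<integral>\<^sup>+y. F (c * x + s * y, s * x - c * y) \<partial>lborel \<partial>lborel)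
    = ennreal \<bar>c\<bar> * (\<integral>\<^sup>+y. \<integral>\<^sup>+x. F (c * x + s * y, s * x - c * y) \<partial>lborel \<partial>lborel)"
    by (subst lborel_pair.Fubini') auto
  also have "\<dots> = (\<integral>\<^sup>+y. \<integral>\<^sup>+u. F (u, (s / c) * u - y / c) \<partial>lborel \<partial>lborel)"
    by (subst nn_integral_cmult[symmetric]) (auto simp: 1)
  also have "\<dots> = (\<integral>\<^sup>+u. \<integral>\<^sup>+y. F (u, (s / c) * u - y / c) \<partial>lborel \<partial>lborel)"
    by (subst lborel_pair.Fubini') auto
  also have "\<dots> = ennreal \<bar>c\<bar> * (\<integral>\<^sup>+u. \<integral>\<^sup>+v. F (u, v) \<partial>lborel \<partial>lborel)"
    unfolding 2 by (rule nn_integral_cmult) measurable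
  finally show ?thesis using False by (simp add: ennreal_mult_cancel_left)
qed

lemma nn_integral_std_normal_reflect:
  fixes f :: "real \<times> real \<Rightarrow> ennreal"
  assumes [measurable]: "f \<in> borel_measurable (borel \<Otimes>\<^sub>M borel)" and cs: "c\<^sup>2 + s\<^sup>2 = 1"
  shows "(\<integral>\<^sup>+x. \<integral>\<^sup>+y. f (c * x + s * y, s * x - c * y) \<partial>std_normal_distribution \<partial>std_normal_distribution) =
         (\<integral>\<^sup>+x. \<integral>\<^sup>+y. f (x, y) \<partial>std_normal_distribution \<partial>std_normal_distribution)"
proof -
  define F where "F = (\<lambda>(x, y). ennreal (exp (- (x\<^sup>2 + y\<^sup>2) / 2) / (2 * pi)) * f (x, y))"
  have [measurable]: "F \<in> borel_measurable (borel \<Otimes>\<^sub>M borel)" unfolding F_def by measurable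
  have d: "ennreal (std_normal_density x) * (ennreal (std_normal_density y) * z) =
     ennreal (exp (- (x\<^sup>2 + y\<^sup>2) / 2) / (2 * pi)) * z" for x y z
    by (simp add: std_normal_density_def mult.assoc[symmetric] ennreal_mult[symmetric] exp_add[symmetric]
       add_divide_distrib diff_divide_distrib real_sqrt_mult[symmetric])
  have I: "(\<integral>\<^sup>+x. \<integral>\<^sup>+y. h (x, y) \<partial>std_normal_distribution \<partial>std_normal_distribution) =
     (\<integral>\<^sup>+x. \<integral>\<^sup>+y. ennreal (exp (- (x\<^sup>2 + y\<^sup>2) / 2) / (2 * pi)) * h (x, y) \<partial>lborel \<partial>lborel)"
    if [measurable]: "h \<in> borel_measurable (borel \<Otimes>\<^sub>M borel)" for h :: "real \<times> real \<Rightarrow> ennreal"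
  proof -
    have "(\<integral>\<^sup>+x. \<integral>\<^sup>+y. h (x, y) \<partial>std_normal_distribution \<partial>std_normal_distribution) =
      (\<integral>\<^sup>+x. ennreal (std_normal_density x) * (\<integral>\<^sup>+y. ennreal (std_normal_density y) * h (x, y) \<partial>lborel) \<partial>lborel)"
      by (simp add: nn_integral_density)
    also have "\<dots> = (\<integral>\<^sup>+x. \<integral>\<^sup>+y. ennreal (exp (- (x\<^sup>2 + y\<^sup>2) / 2) / (2 * pi)) * h (x, y) \<partial>lborel \<partial>lborel)"
      by (subst nn_integral_cmult[symmetric]) (auto simp: d)
    finally show ?thesis .
  qed
  have n: "(c * x + s * y)\<^sup>2 + (s * x - c * y)\<^sup>2 = x\<^sup>2 + y\<^sup>2" for x y
  proof -
    have "(c * x + s * y)\<^sup>2 + (s * x - c * y)\<^sup>2 = (c\<^sup>2 + s\<^sup>2) * (x\<^sup>2 + y\<^sup>2)"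
      by (simp add: power2_eq_square algebra_simps)
    then show ?thesis using cs by simp
  qed
  have n': "- (c * x + s * y)\<^sup>2 - (s * x - c * y)\<^sup>2 = - x\<^sup>2 - y\<^sup>2" for x y
    using n[of x y] by simp
  have "(\<integral>\<^sup>+x. \<integral>\<^sup>+y. f (c * x + s * y, s * x - c * y) \<partial>std_normal_distribution \<partial>std_normal_distribution) =
    (\<integral>\<^sup>+x. \<integral>\<^sup>+y. F (c * x + s * y, s * x - c * y) \<partial>lborel \<partial>lborel)"
    using I[of "\<lambda>(x, y). f (c * x + s * y, s * x - c * y)"] by (simp add: F_def n')
  also have "\<dots> = (\<integral>\<^sup>+x. \<integral>\<^sup>+y. F (x, y) \<partial>lborel \<partial>lborel)"
    by (rule nn_integral_lborel_reflect) (use cs in auto)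
  also have "\<dots> = (\<integral>\<^sup>+x. \<integral>\<^sup>+y. f (x, y) \<partial>std_normal_distribution \<partial>std_normal_distribution)"
    using I[of f] by (simp add: F_def)
  finally show ?thesis .
qed

section \<open>Orthogonal invariance\<close>

definition lin :: "'i set \<Rightarrow> ('i \<Rightarrow> 'i \<Rightarrow> real) \<Rightarrow> ('i \<Rightarrow> real) \<Rightarrow> 'i \<Rightarrow> real" where
  "lin I T x = (\<lambda>p\<in>I. \<Sum>q\<in>I. T p q * x q)"

definition orth :: "'i set \<Rightarrow> ('i \<Rightarrow> 'i \<Rightarrow> real) \<Rightarrow> bool" where
  "orth I T \<longleftrightarrow> (\<forall>p\<in>I. \<forall>q\<in>I. (\<Sum>r\<in>I. T r p * T r q) = (if p = q then 1 else 0))"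

definition gauss_preserving :: "'i set \<Rightarrow> (('i \<Rightarrow> real) \<Rightarrow> 'i \<Rightarrow> real) \<Rightarrow> bool" where
  "gauss_preserving I R \<longleftrightarrow> R \<in> measurable (arrays I) (arrays I) \<and>
     (\<forall>f \<in> borel_measurable (arrays I).
       (\<integral>\<^sup>+x. f (R x) \<partial>gauss I) = (\<integral>\<^sup>+x. f x \<partial>gauss I))"

lemma measurable_lin [measurable]:
  "lin I T \<in> measurable (arrays I) (arrays I)"
  unfolding lin_def by measurable

lemma gauss_preserving_comp:
  assumes "gauss_preserving I R" "gauss_preserving I R'"
  shows "gauss_preserving I (\<lambda>x. R (R' x))"
proof -
  have [measurable]: "R \<in> measurable (arrays I) (arrays I)"
    "R' \<in> measurable (arrays I) (arrays I)"
    using assms by (auto simp: gauss_preserving_def)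
  show ?thesis unfolding gauss_preserving_def
  proof (intro conjI ballI)
    fix f :: "('a \<Rightarrow> real) \<Rightarrow> ennreal" assume [measurable]: "f \<in> borel_measurable (arrays I)"
    have "(\<lambda>x. f (R x)) \<in> borel_measurable (arrays I)" by measurable
    from bspec[OF conjunct2[OF assms(2)[unfolded gauss_preserving_def]] this]
    have "(\<integral>\<^sup>+x. f (R (R' x)) \<partial>gauss I) = (\<integral>\<^sup>+x. f (R x) \<partial>gauss I)" .
    also have "\<dots> = (\<integral>\<^sup>+x. f x \<partial>gauss I)"
      using assms(1) unfolding gauss_preserving_def by auto
    finally show "(\<integral>\<^sup>+x. f (R (R' x)) \<partial>gauss I) = (\<integral>\<^sup>+x. f x \<partial>gauss I)" .
  qed measurable
qed

lemma gauss_preserving_cong: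
  assumes "\<And>x. x \<in> extensional I \<Longrightarrow> R x = R' x"
  shows "gauss_preserving I R \<longleftrightarrow> gauss_preserving I R'"
proof -
  have "R \<in> measurable (arrays I) (arrays I) \<longleftrightarrow>
    R' \<in> measurable (arrays I) (arrays I)"
    by (rule measurable_cong) (auto simp: space_PiM PiE_def assms)
  moreover have "(\<integral>\<^sup>+x. f (R x) \<partial>gauss I) = (\<integral>\<^sup>+x. f (R' x) \<partial>gauss I)" for f :: "('a \<Rightarrow> real) \<Rightarrow> ennreal"
    by (rule nn_integral_cong) (auto simp: space_gauss assms)
  ultimately show ?thesis by (simp add: gauss_preserving_def)
qed

definition plane_reflect :: "'i \<Rightarrow> 'i \<Rightarrow> real \<Rightarrow> real \<Rightarrow> ('i \<Rightarrow> real) \<Rightarrow> 'i \<Rightarrow> real" where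
  "plane_reflect p q c s x = x(p := c * x p + s * x q, q := s * x p - c * x q)"

lemma gauss_preserving_plane_reflect:
  assumes "finite I" "p \<in> I" "q \<in> I" "p \<noteq> q" and cs: "c\<^sup>2 + s\<^sup>2 = 1"
  shows "gauss_preserving I (plane_reflect p q c s)"
  unfolding gauss_preserving_def
proof (intro conjI ballI)
  have "plane_reflect p q c s x = (\<lambda>i\<in>I. if i = q then s * x p - c * x q else if i = p then c * x p + s * x q else x i)"
    if "x \<in> extensional I" for x
    using that assms by (auto simp: plane_reflect_def fun_eq_iff restrict_def extensional_def)
  moreover have "(\<lambda>x. \<lambda>i\<in>I. if i = q then s * x p - c * x q else if i = p then c * x p + s * x q else x i)
      \<in> measurable (arrays I) (arrays I)"
    using assms by (intro measurable_restrict) auto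
  ultimately show m[measurable]: "plane_reflect p q c s \<in> measurable (arrays I) (arrays I)"
    by (subst measurable_cong) (auto simp: space_PiM PiE_def)
  fix f :: "('a \<Rightarrow> real) \<Rightarrow> ennreal" assume f[measurable]: "f \<in> borel_measurable (arrays I)"
  define K where "K = I - {p, q}"
  have I: "I = insert p (insert q K)" "p \<notin> insert q K" "q \<notin> K" "finite K"
    using assms by (auto simp: K_def)
  have g: "(\<integral>\<^sup>+x. h x \<partial>gauss I) = (\<integral>\<^sup>+x. \<integral>\<^sup>+a. \<integral>\<^sup>+b. h (x(q := a, p := b)) \<partial>std_normal_distribution \<partial>std_normal_distribution \<partial>gauss K)"
    if [measurable]: "h \<in> borel_measurable (arrays I)" for h :: "('a \<Rightarrow> real) \<Rightarrow> ennreal"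
  proof -
    have "(\<integral>\<^sup>+x. h x \<partial>gauss I) = (\<integral>\<^sup>+x. \<integral>\<^sup>+b. h (x(p := b)) \<partial>std_normal_distribution \<partial>gauss (insert q K))"
      unfolding I(1) using I that by (intro nn_integral_gauss_insert) auto
    also have "\<dots> = (\<integral>\<^sup>+x. \<integral>\<^sup>+a. \<integral>\<^sup>+b. h (x(q := a, p := b)) \<partial>std_normal_distribution \<partial>std_normal_distribution \<partial>gauss K)"
      using I that[unfolded I(1)]
      by (intro nn_integral_gauss_insert sigma_finite_measure.borel_measurable_nn_integral
        prob_space_imp_sigma_finite prob_space_std_normal) (auto intro!: measurable_compose[OF _ that[unfolded I(1)]] measurable_fun_upd)
    finally show ?thesis .
  qed
  have m2: "(\<lambda>(b, a). f (x(q := a, p := b))) \<in> borel_measurable (borel \<Otimes>\<^sub>M borel)" if "x \<in> extensional K" for x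
  proof -
    have "(\<lambda>(b, a). x(q := a, p := b)) \<in> measurable (borel \<Otimes>\<^sub>M borel) (arrays I)"
      unfolding I(1)
      by (rule measurable_PiM_single') (use that I in \<open>auto simp: PiE_def extensional_def split_beta' fun_upd_def\<close>)
    from measurable_compose[OF this f] show ?thesis by (simp add: split_beta')
  qed
  have e: "(\<integral>\<^sup>+a. \<integral>\<^sup>+b. f (plane_reflect p q c s (x(q := a, p := b))) \<partial>std_normal_distribution \<partial>std_normal_distribution)
     = (\<integral>\<^sup>+a. \<integral>\<^sup>+b. f (x(q := a, p := b)) \<partial>std_normal_distribution \<partial>std_normal_distribution)"
    if x: "x \<in> extensional K" for x
  proof -
    define h where "h = (\<lambda>(a, b). f (x(q := a, p := b)))"
    have [measurable]: "h \<in> borel_measurable (borel \<Otimes>\<^sub>M borel)"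
      using measurable_compose[OF measurable_pair_swap' m2[OF x]] unfolding h_def
      by (simp add: split_beta' prod.swap_def)
    have 1: "f (plane_reflect p q c s (x(q := a, p := b))) = h ((- c) * a + s * b, s * a - (- c) * b)" for a b
      using assms by (auto simp: h_def plane_reflect_def intro!: arg_cong[where f=f])
    have "(\<integral>\<^sup>+a. \<integral>\<^sup>+b. h ((- c) * a + s * b, s * a - (- c) * b) \<partial>std_normal_distribution \<partial>std_normal_distribution)
       = (\<integral>\<^sup>+a. \<integral>\<^sup>+b. h (a, b) \<partial>std_normal_distribution \<partial>std_normal_distribution)"
      by (rule nn_integral_std_normal_reflect) (use cs in simp_all)
    then show ?thesis unfolding 1 by (simp add: h_def)
  qed
  show "(\<integral>\<^sup>+x. f (plane_reflect p q c s x) \<partial>gauss I) = (\<integral>\<^sup>+x. f x \<partial>gauss I)"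
    by (subst (1 2) g) (auto intro!: nn_integral_cong e simp: space_gauss)
qed

lemma gauss_preserving_sign:
  assumes "finite I" "p \<in> I"
  shows "gauss_preserving I (\<lambda>x. x(p := - x p))"
  unfolding gauss_preserving_def
proof (intro conjI ballI)
  have "(\<lambda>x. x p) \<in> borel_measurable (arrays I)"
    using assms(2) by (rule measurable_component_singleton)
  then have mp: "(\<lambda>x. - x p) \<in> borel_measurable (arrays I)"
    by (rule borel_measurable_uminus)
  have "x(p := - x p) = (\<lambda>i\<in>I. if i = p then - x p else x i)"
    if "x \<in> extensional I" for x :: "'a \<Rightarrow> real"
    using that assms by (auto simp: fun_eq_iff restrict_def extensional_def)
  moreover have "(\<lambda>x :: 'a \<Rightarrow> real. \<lambda>i\<in>I. if i = p then - x p else x i)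
      \<in> measurable (arrays I) (arrays I)"
  proof (rule measurable_restrict)
    fix i assume "i \<in> I"
    then show "(\<lambda>x. if i = p then - x p else x i) \<in> borel_measurable (arrays I)"
      using mp measurable_component_singleton[of i I "\<lambda>_. borel :: real measure"]
      by (cases "i = p") simp_all
  qed
  ultimately show m[measurable]: "(\<lambda>x :: 'a \<Rightarrow> real. x(p := - x p)) \<in> measurable (arrays I) (arrays I)"
    by (subst measurable_cong) (auto simp: space_PiM PiE_def)
  fix f :: "('a \<Rightarrow> real) \<Rightarrow> ennreal" assume f[measurable]: "f \<in> borel_measurable (arrays I)"
  define K where "K = I - {p}"
  have I: "I = insert p K" "p \<notin> K" "finite K"
    using assms by (auto simp: K_def)
  have mx: "(\<lambda>a. f (x(p := a))) \<in> borel_measurable borel" if "x \<in> extensional K" for x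
  proof -
    have "(\<lambda>a. x(p := a)) \<in> measurable borel (arrays I)"
      unfolding I(1)
      by (rule measurable_PiM_single') (use that I in \<open>auto simp: PiE_def extensional_def fun_upd_def\<close>)
    from measurable_compose[OF this f] show ?thesis by simp
  qed
  have s: "(\<integral>\<^sup>+a. h (- a) \<partial>std_normal_distribution) = (\<integral>\<^sup>+a. h a \<partial>std_normal_distribution)"
    if [measurable]: "h \<in> borel_measurable borel" for h :: "real \<Rightarrow> ennreal"
    using nn_integral_std_normal_reflect[of "\<lambda>(a, b). h a" "-1" 0] prob_space.emeasure_space_1[OF prob_space_std_normal]
    by simp
  have "(\<integral>\<^sup>+x. f (x(p := - x p)) \<partial>gauss I) = (\<integral>\<^sup>+x. \<integral>\<^sup>+a. f (x(p := - a)) \<partial>std_normal_distribution \<partial>gauss K)"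
    unfolding I(1) by (subst nn_integral_gauss_insert) (use I m measurable_compose[OF m f] in auto)
  also have "\<dots> = (\<integral>\<^sup>+x. \<integral>\<^sup>+a. f (x(p := a)) \<partial>std_normal_distribution \<partial>gauss K)"
    by (intro nn_integral_cong s[of "\<lambda>a. f (_(p := a))"] mx) (simp add: space_gauss)
  also have "\<dots> = (\<integral>\<^sup>+x. f x \<partial>gauss I)"
    unfolding I(1) by (subst nn_integral_gauss_insert) (use I f in auto)
  finally show "(\<integral>\<^sup>+x. f (x(p := - x p)) \<partial>gauss I) = (\<integral>\<^sup>+x. f x \<partial>gauss I)" .
qed

text \<open>A step of Givens elimination.  The set \<open>F\<close> collects the columns that are already unit vectors.
Plane reflections in the coordinates \<open>k\<close> and \<open>j\<close> for \<open>j\<close> in \<open>J\<close> remove the entries of column \<open>k\<close> one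
after the other; each of them preserves the Gaussian law and is its own inverse, so it can be moved
to the other side.  What remains of column \<open>k\<close> is a sign.\<close>

lemma gauss_preserving_eliminate_column:
  assumes I: "finite I" and k: "k \<in> I" "k \<notin> F"
    and hyp: "\<And>T. orth I T \<Longrightarrow> (\<And>f r. f \<in> insert k F \<Longrightarrow> r \<in> I \<Longrightarrow> T r f = (if r = f then 1 else 0)) \<Longrightarrow>
        gauss_preserving I (lin I T)"
    and J: "finite J"
  shows "k \<notin> J \<Longrightarrow> J \<subseteq> I \<Longrightarrow> J \<inter> F = {} \<Longrightarrow> orth I T \<Longrightarrow>
    (\<And>f r. f \<in> F \<Longrightarrow> r \<in> I \<Longrightarrow> T r f = (if r = f then 1 else 0)) \<Longrightarrow>
    (\<And>r. r \<in> I \<Longrightarrow> r \<notin> insert k J \<Longrightarrow> T r k = 0) \<Longrightarrow> gauss_preserving I (lin I T)"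
  using J
proof (induction J arbitrary: T rule: finite_induct)
  case empty
  have "(\<Sum>r\<in>I. T r k * T r k) = (\<Sum>r\<in>{k}. T r k * T r k)"
    using I k empty by (intro sum.mono_neutral_right) auto
  then have "T k k * T k k = 1" using empty k by (auto simp: orth_def)
  then have Tkk: "T k k = 1 \<or> T k k = -1" by (metis mult_cancel_left1 square_eq_1_iff)
  show ?case
  proof (cases "T k k = 1")
    case True
    show ?thesis
    proof (rule hyp[OF empty.prems(4)])
      show "T r f = (if r = f then 1 else 0)" if "f \<in> insert k F" "r \<in> I" for f r
        using that empty.prems(5)[of f r] empty.prems(6)[of r] True by (cases "f = k") auto
    qed
  next
    case False
    with Tkk have m1: "T k k = -1" by simp
    define T' where "T' = (\<lambda>r q. if r = k then - T r q else T r q)"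
    have "(\<Sum>r\<in>I. T' r p * T' r q) = (\<Sum>r\<in>I. T r p * T r q)" for p q
      by (intro sum.cong) (auto simp: T'_def)
    then have o: "orth I T'" using empty.prems(4) unfolding orth_def by simp
    have good: "gauss_preserving I (lin I T')"
    proof (rule hyp[OF o])
      show "T' r f = (if r = f then 1 else 0)" if "f \<in> insert k F" "r \<in> I" for f r
        using that empty.prems(5)[of f r] empty.prems(6)[of r] m1 k by (cases "f = k") (auto simp: T'_def)
    qed
    have "lin I T = (\<lambda>x. (\<lambda>x. x(k := - x k)) (lin I T' x))"
      using k by (auto simp: lin_def T'_def fun_eq_iff sum_negf)
    then show ?thesis
      using gauss_preserving_comp[OF gauss_preserving_sign[OF I k(1)] good] by (simp only:)
  qed
next
  case (insert j J)
  show ?case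
  proof (cases "T j k = 0")
    case True
    show ?thesis
      by (rule insert.IH) (use insert.prems True in \<open>auto\<close>)
  next
    case False
    define \<rho> where "\<rho> = sqrt ((T k k)\<^sup>2 + (T j k)\<^sup>2)"
    have \<rho>: "\<rho> > 0" "\<rho>\<^sup>2 = (T k k)\<^sup>2 + (T j k)\<^sup>2" using False by (auto simp: \<rho>_def sum_power2_gt_zero_iff)
    define c s where "c = T k k / \<rho>" and "s = T j k / \<rho>"
    have "c\<^sup>2 + s\<^sup>2 = ((T k k)\<^sup>2 + (T j k)\<^sup>2) / \<rho>\<^sup>2"
      by (simp add: c_def s_def power_divide add_divide_distrib)
    then have cs: "c\<^sup>2 + s\<^sup>2 = 1" unfolding \<rho>(2)[symmetric] using \<rho>(1) by simp
    have kj: "k \<noteq> j" "j \<in> I" "j \<notin> F" using insert.prems by auto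
    define T' where "T' = (\<lambda>r q. if r = k then c * T k q + s * T j q else if r = j then s * T k q - c * T j q else T r q)"
    have lin': "lin I T = (\<lambda>x. plane_reflect k j c s (lin I T' x))"
    proof
      fix x
      have "c * (c * a + s * b) + s * (s * a - c * b) = a"
        "s * (c * a + s * b) - c * (s * a - c * b) = b" for a b
      proof -
        have "c * (c * a + s * b) + s * (s * a - c * b) = (c\<^sup>2 + s\<^sup>2) * a"
          "s * (c * a + s * b) - c * (s * a - c * b) = (c\<^sup>2 + s\<^sup>2) * b"
          by (simp_all add: algebra_simps power2_eq_square)
        then show "c * (c * a + s * b) + s * (s * a - c * b) = a"
          "s * (c * a + s * b) - c * (s * a - c * b) = b" using cs by simp_all
      qed
      note e = this
      have a: "(\<Sum>q\<in>I. T' k q * x q) = c * (\<Sum>q\<in>I. T k q * x q) + s * (\<Sum>q\<in>I. T j q * x q)"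
        by (simp add: T'_def sum.distrib sum_distrib_left algebra_simps)
      have b: "(\<Sum>q\<in>I. T' j q * x q) = s * (\<Sum>q\<in>I. T k q * x q) - c * (\<Sum>q\<in>I. T j q * x q)"
        using kj by (simp add: T'_def sum_subtractf sum_distrib_left algebra_simps)
      have o: "(\<Sum>q\<in>I. T' r q * x q) = (\<Sum>q\<in>I. T r q * x q)" if "r \<noteq> k" "r \<noteq> j" for r
        using that by (simp add: T'_def)
      show "lin I T x = plane_reflect k j c s (lin I T' x)"
        using k kj by (auto simp: fun_eq_iff plane_reflect_def lin_def a b o e)
    qed
    have "orth I T'" unfolding orth_def
    proof (intro ballI)
      fix p q assume pq: "p \<in> I" "q \<in> I"
      have split: "(\<Sum>r\<in>I. g r) = g k + g j + (\<Sum>r\<in>I - {k, j}. g r)" for g :: "'a \<Rightarrow> real"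
        using I k kj by (subst sum.subset_diff[of "{k, j}"]) auto
      have "T' k p * T' k q + T' j p * T' j q = (c\<^sup>2 + s\<^sup>2) * (T k p * T k q + T j p * T j q)"
        using kj by (simp add: T'_def algebra_simps power2_eq_square)
      moreover have "(\<Sum>r\<in>I - {k, j}. T' r p * T' r q) = (\<Sum>r\<in>I - {k, j}. T r p * T r q)"
        by (intro sum.cong) (auto simp: T'_def)
      ultimately have "(\<Sum>r\<in>I. T' r p * T' r q) = (\<Sum>r\<in>I. T r p * T r q)"
        using cs by (subst (1 2) split) simp
      then show "(\<Sum>r\<in>I. T' r p * T' r q) = (if p = q then 1 else 0)"
        using insert.prems(4) pq by (simp add: orth_def)
    qed
    then have "gauss_preserving I (lin I T')"
    proof (rule insert.IH[rotated 3])
      show "T' r f = (if r = f then 1 else 0)" if "f \<in> F" "r \<in> I" for f r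
        using that insert.prems(5)[OF that(1)] k kj by (auto simp: T'_def)
      show "T' r k = 0" if "r \<in> I" "r \<notin> insert k J" for r
        using that insert.prems(6)[of r] kj by (auto simp: T'_def c_def s_def)
    qed (use insert.prems in auto)
    from gauss_preserving_comp[OF gauss_preserving_plane_reflect[OF I k(1) kj(2,1) cs] this]
    show ?thesis unfolding lin' .
  qed
qed

text \<open>Induction on the number of columns that are not yet unit vectors; elimination of a column never
destroys the ones already treated.\<close>

theorem gauss_preserving_orth:
  assumes I: "finite I" and "orth I T"
  shows "gauss_preserving I (lin I T)"
proof -
  have "gauss_preserving I (lin I T)"
    if "card (I - F) = n" "F \<subseteq> I" "orth I T" "\<And>f r. f \<in> F \<Longrightarrow> r \<in> I \<Longrightarrow> T r f = (if r = f then 1 else 0)" for n F T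
    using that
  proof (induction n arbitrary: F T)
    case 0
    then have "I = F" using I by auto
    have "lin I T x = x" if "x \<in> extensional I" for x
    proof -
      have "(\<Sum>q\<in>I. T p q * x q) = (\<Sum>q\<in>I. if q = p then x q else 0)" if "p \<in> I" for p
        using that 0(4) \<open>I = F\<close> by (intro sum.cong) auto
      then show ?thesis using that I by (auto simp: lin_def fun_eq_iff extensional_def)
    qed
    then show ?case by (subst gauss_preserving_cong) (auto simp: gauss_preserving_def)
  next
    case (Suc n)
    then have "I - F \<noteq> {}" by (metis card.empty nat.distinct(1))
    then obtain k where k: "k \<in> I" "k \<notin> F" by auto
    show ?case
    proof (rule gauss_preserving_eliminate_column[OF I k, of "I - F - {k}"])
      fix T assume "orth I T" "\<And>f r. f \<in> insert k F \<Longrightarrow> r \<in> I \<Longrightarrow> T r f = (if r = f then 1 else 0)"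
      then show "gauss_preserving I (lin I T)"
        using Suc.prems(1,2) k I
        by (intro Suc.IH[of "insert k F"]) (auto simp: card_Diff_insert)
    next
      show "T r k = 0" if "r \<in> I" "r \<notin> insert k (I - F - {k})" for r
      proof -
        have r: "r \<in> F" "r \<noteq> k" using that by auto
        have "(\<Sum>q\<in>I. T q r * T q k) = 0" using Suc.prems(3) r k that by (auto simp: orth_def)
        moreover have "(\<Sum>q\<in>I. T q r * T q k) = (\<Sum>q\<in>I. if q = r then T q k else 0)"
          using Suc.prems(4)[OF r(1)] by (intro sum.cong) auto
        ultimately show ?thesis using I that by simp
      qed
    qed (use I Suc.prems in auto)
  qed
  from this[OF refl empty_subsetI assms(2)] show ?thesis by simp
qed

lemma nn_integral_gauss_orth:
  assumes "finite I" "orth I T" "f \<in> borel_measurable (arrays I)"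
  shows "(\<integral>\<^sup>+x. f (lin I T x) \<partial>gauss I) = (\<integral>\<^sup>+x. f x \<partial>gauss I)"
  using gauss_preserving_orth[OF assms(1,2)] assms(3) by (auto simp: gauss_preserving_def)

text \<open>Fubini in a single coordinate, whose law has no atoms.\<close>

lemma AE_gauss_coord:
  assumes I: "finite I" "p \<in> I" and P[measurable]: "Measurable.pred (arrays I) P"
    and c: "\<And>x a b. x \<in> extensional I \<Longrightarrow> \<not> P (x(p := a)) \<Longrightarrow> \<not> P (x(p := b)) \<Longrightarrow> a = b"
  shows "AE x in gauss I. P x"
proof -
  define K where "K = I - {p}"
  have K: "I = insert p K" "p \<notin> K" "finite K" using I by (auto simp: K_def)
  have [measurable]: "Measurable.pred (gauss I) P" by measurable
  have m: "(\<lambda>x. indicator {x \<in> space (gauss I). \<not> P x} x :: ennreal) \<in> borel_measurable (arrays I)"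
    by (subst measurable_cong_sets[OF sets_gauss[symmetric] refl]) measurable
  have "emeasure (gauss I) {x \<in> space (gauss I). \<not> P x} = (\<integral>\<^sup>+x. indicator {x \<in> space (gauss I). \<not> P x} x \<partial>gauss I)"
    by simp
  also have "\<dots> = (\<integral>\<^sup>+x. \<integral>\<^sup>+t. indicator {x \<in> space (gauss I). \<not> P x} (x(p := t)) \<partial>std_normal_distribution \<partial>gauss K)"
    using nn_integral_gauss_insert[OF K(3) K(2), folded K(1), OF m] .
  also have "\<dots> = (\<integral>\<^sup>+x. 0 \<partial>gauss K)"
  proof (rule nn_integral_cong)
    fix x :: "'a \<Rightarrow> real" assume "x \<in> space (gauss K)"
    then have x: "x \<in> extensional K" "x \<in> extensional I" by (auto simp: space_gauss K extensional_def)
    then have xs: "x(p := t) \<in> extensional I" for t using I(2) by (auto simp: extensional_def)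
    show "(\<integral>\<^sup>+t. indicator {x \<in> space (gauss I). \<not> P x} (x(p := t)) \<partial>std_normal_distribution) = 0"
    proof (cases "\<exists>a. \<not> P (x(p := a))")
      case True
      then obtain a where a: "\<not> P (x(p := a))" by auto
      have "(\<integral>\<^sup>+t. indicator {x \<in> space (gauss I). \<not> P x} (x(p := t)) \<partial>std_normal_distribution) \<le>
        (\<integral>\<^sup>+t. indicator {a} t \<partial>std_normal_distribution)"
        using c[OF x(2) a] by (intro nn_integral_mono) (auto split: split_indicator)
      also have "\<dots> = emeasure std_normal_distribution {a}" by simp
      also have "\<dots> = 0" by (subst emeasure_density) (auto intro!: nn_integral_0_iff_AE[THEN iffD2] simp: indicator_eq_0_iff intro: AE_mp[OF AE_lborel_singleton])
      finally show ?thesis by simp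
    next
      case False
      then show ?thesis by simp
    qed
  qed
  finally have "emeasure (gauss I) {x \<in> space (gauss I). \<not> P x} = 0" by simp
  then show ?thesis by (subst AE_iff_measurable[OF _ refl]) auto
qed

section \<open>Bidiagonalisation of a Gaussian matrix\<close>

abbreviation idx :: "nat \<Rightarrow> nat \<Rightarrow> (nat \<times> nat) set" where
  "idx m n \<equiv> {..<m} \<times> {..<n}"

text \<open>Outside the index set, all elements of the product space take the same value \<open>undefined\<close>.\<close>

lemma measurable_coord [measurable]:
  "(\<lambda>x. x p) \<in> borel_measurable (arrays I)"
proof (cases "p \<in> I")
  case False
  have "(\<lambda>x. x p) \<in> borel_measurable (arrays I) \<longleftrightarrow>
     (\<lambda>x. undefined :: real) \<in> borel_measurable (arrays I)"
    using False by (intro measurable_cong) (auto simp: space_PiM PiE_def extensional_def)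
  then show ?thesis by simp
qed (rule measurable_component_singleton)

lemma orth_inner:
  assumes "finite I" "orth I T"
  shows "(\<Sum>p\<in>I. (\<Sum>q\<in>I. T p q * u q) * (\<Sum>q\<in>I. T p q * v q)) = (\<Sum>q\<in>I. u q * v q)"
proof -
  have "(\<Sum>p\<in>I. (\<Sum>q\<in>I. T p q * u q) * (\<Sum>q\<in>I. T p q * v q)) =
     (\<Sum>p\<in>I. \<Sum>q\<in>I. \<Sum>r\<in>I. (T p q * T p r) * (u q * v r))"
    by (simp add: sum_product algebra_simps)
  also have "\<dots> = (\<Sum>q\<in>I. \<Sum>p\<in>I. \<Sum>r\<in>I. (T p q * T p r) * (u q * v r))" by (rule sum.swap)
  also have "\<dots> = (\<Sum>q\<in>I. \<Sum>r\<in>I. \<Sum>p\<in>I. (T p q * T p r) * (u q * v r))"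
    by (intro sum.cong refl sum.swap)
  also have "\<dots> = (\<Sum>q\<in>I. \<Sum>r\<in>I. (\<Sum>p\<in>I. T p q * T p r) * (u q * v r))"
    by (simp add: sum_distrib_right)
  also have "\<dots> = (\<Sum>q\<in>I. \<Sum>r\<in>I. if q = r then u q * v r else 0)"
    using assms by (intro sum.cong refl) (auto simp: orth_def)
  finally show ?thesis using assms by simp
qed

lemma orth_left:
  assumes "finite A" "finite B" "orth A U"
  shows "orth (A \<times> B) (\<lambda>p q. U (fst p) (fst q) * of_bool (snd p = snd q))"
  unfolding orth_def
proof (intro ballI)
  fix p q assume pq: "p \<in> A \<times> B" "q \<in> A \<times> B"
  have "(\<Sum>r\<in>A \<times> B. U (fst r) (fst p) * of_bool (snd r = snd p) * (U (fst r) (fst q) * of_bool (snd r = snd q)))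
    = (\<Sum>a\<in>A. \<Sum>b\<in>B. if b = snd p then U a (fst p) * U a (fst q) * of_bool (snd p = snd q) else 0)"
    by (subst sum.cartesian_product) (auto intro!: sum.cong)
  also have "\<dots> = (\<Sum>a\<in>A. U a (fst p) * U a (fst q)) * of_bool (snd p = snd q)"
    using pq assms by (simp add: sum_distrib_right mem_Times_iff)
  also have "\<dots> = (if p = q then 1 else 0)"
    using assms(3) pq by (auto simp: orth_def prod_eq_iff)
  finally show "(\<Sum>r\<in>A \<times> B. U (fst r) (fst p) * of_bool (snd r = snd p) * (U (fst r) (fst q) * of_bool (snd r = snd q))) = (if p = q then 1 else 0)" .
qed

lemma lin_left:
  assumes "finite A" "finite B" "i \<in> A" "j \<in> B"
  shows "lin (A \<times> B) (\<lambda>p q. U (fst p) (fst q) * of_bool (snd p = snd q)) x (i, j) = (\<Sum>k\<in>A. U i k * x (k, j))"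
proof -
  have "lin (A \<times> B) (\<lambda>p q. U (fst p) (fst q) * of_bool (snd p = snd q)) x (i, j)
    = (\<Sum>k\<in>A. \<Sum>l\<in>B. if l = j then U i k * x (k, l) else 0)"
    using assms by (subst sum.cartesian_product) (auto intro!: sum.cong simp: lin_def)
  then show ?thesis using assms by simp
qed

text \<open>The Householder reflection that maps \<open>v\<close> to a nonnegative multiple of the first unit vector.  If
\<open>v\<close> already has this form, then the division by zero makes the matrix the identity.\<close>

definition householder :: "nat \<Rightarrow> (nat \<Rightarrow> real) \<Rightarrow> nat \<Rightarrow> nat \<Rightarrow> real" where
  "householder m v i j = (let w = (\<lambda>i. v i - (if i = 0 then sqrt (\<Sum>k<m. (v k)\<^sup>2) else 0))
     in of_bool (i = j) - 2 * w i * w j / (\<Sum>k<m. (w k)\<^sup>2))"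

lemma householder_sym: "householder m v i j = householder m v j i"
  by (cases "i = j") (auto simp: householder_def Let_def mult.commute mult.left_commute)

lemma householder_cong:
  assumes "\<And>k. k < m \<Longrightarrow> v k = v' k" "i < m" "j < m"
  shows "householder m v i j = householder m v' i j"
proof -
  define w where "w = (\<lambda>v i. v i - (if i = 0 then sqrt (\<Sum>k<m. (v k)\<^sup>2) else (0::real)))"
  have "(\<Sum>k<m. (v k)\<^sup>2) = (\<Sum>k<m. (v' k)\<^sup>2)" using assms by (intro sum.cong) auto
  then have w: "w v k = w v' k" if "k < m" for k using assms(1)[OF that] by (simp add: w_def)
  have "(\<Sum>k<m. (w v k)\<^sup>2) = (\<Sum>k<m. (w v' k)\<^sup>2)" using w by (intro sum.cong) auto
  then have "of_bool (i = j) - 2 * w v i * w v j / (\<Sum>k<m. (w v k)\<^sup>2) =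
     of_bool (i = j) - 2 * w v' i * w v' j / (\<Sum>k<m. (w v' k)\<^sup>2)"
    using w assms by simp
  then show ?thesis unfolding householder_def w_def Let_def .
qed

lemma orth_householder: "orth {..<m} (householder m v)"
  unfolding orth_def
proof (intro ballI)
  fix i j assume ij: "i \<in> {..<m}" "j \<in> {..<m}"
  define w where "w = (\<lambda>i. v i - (if i = 0 then sqrt (\<Sum>k<m. (v k)\<^sup>2) else 0))"
  define s where "s = (\<Sum>k<m. (w k)\<^sup>2)"
  have h: "householder m v a b = of_bool (a = b) - 2 * w a * w b / s" for a b
    by (simp add: householder_def w_def s_def Let_def)
  have "(\<Sum>r<m. householder m v r i * householder m v r j) =
     (\<Sum>r<m. (if r = i then of_bool (i = j) else 0) - (if r = i then 2 * w i * w j / s else 0)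
        - (if r = j then 2 * w i * w j / s else 0) + 4 * w i * w j / s\<^sup>2 * (w r)\<^sup>2)"
    by (intro sum.cong refl) (auto simp: h power2_eq_square divide_inverse algebra_simps)
  also have "\<dots> = of_bool (i = j) - 4 * w i * w j / s + 4 * w i * w j / s\<^sup>2 * s"
    using ij by (simp only: sum.distrib sum_subtractf sum_distrib_left[symmetric] s_def[symmetric]) simp
  also have "\<dots> = of_bool (i = j)" by (cases "s = 0") (auto simp: power2_eq_square)
  finally show "(\<Sum>r<m. householder m v r i * householder m v r j) = (if i = j then 1 else 0)" by simp
qed

lemma householder_apply:
  assumes "i < m"
  shows "(\<Sum>j<m. householder m v i j * v j) = (if i = 0 then sqrt (\<Sum>k<m. (v k)\<^sup>2) else 0)"
proof -
  define \<nu> where "\<nu> = sqrt (\<Sum>k<m. (v k)\<^sup>2)"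
  define w where "w = (\<lambda>i. v i - (if i = 0 then \<nu> else 0))"
  define s where "s = (\<Sum>k<m. (w k)\<^sup>2)"
  have n2: "\<nu>\<^sup>2 = (\<Sum>k<m. (v k)\<^sup>2)" by (simp add: \<nu>_def sum_nonneg)
  have h: "householder m v a b = of_bool (a = b) - 2 * w a * w b / s" for a b
    unfolding householder_def w_def s_def \<nu>_def Let_def by (rule refl)
  have m: "0 < m" using assms by simp
  have "(\<Sum>k<m. w k * v k) = (\<Sum>k<m. (v k)\<^sup>2 - (if k = 0 then \<nu> * v 0 else 0))"
    by (intro sum.cong) (auto simp: w_def power2_eq_square algebra_simps)
  then have wv: "(\<Sum>k<m. w k * v k) = \<nu>\<^sup>2 - \<nu> * v 0" using m by (simp add: n2 sum_subtractf)
  have "s = (\<Sum>k<m. (v k)\<^sup>2 - (if k = 0 then 2 * \<nu> * v 0 - \<nu>\<^sup>2 else 0))"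
    unfolding s_def by (intro sum.cong) (auto simp: w_def power2_eq_square algebra_simps)
  then have s: "s = 2 * (\<nu>\<^sup>2 - \<nu> * v 0)" using m by (simp add: n2 sum_subtractf)
  have "(\<Sum>j<m. householder m v i j * v j) = (\<Sum>j<m. (if j = i then v j else 0) - 2 * w i / s * (w j * v j))"
    by (intro sum.cong) (auto simp: h algebra_simps)
  also have "\<dots> = v i - 2 * w i / s * (\<nu>\<^sup>2 - \<nu> * v 0)"
    using assms by (simp only: sum_subtractf sum_distrib_left[symmetric] wv) simp
  also have "\<dots> = v i - w i"
  proof (cases "s = 0")
    case True
    then have "w i = 0" using assms by (simp add: s_def sum_nonneg_eq_0_iff)
    then show ?thesis by simp
  next
    case False
    have e: "\<nu>\<^sup>2 - \<nu> * v 0 = s / 2" using s by simp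
    show ?thesis unfolding e using False by simp
  qed
  finally show ?thesis by (simp add: w_def \<nu>_def)
qed

definition colnorm2 :: "nat \<Rightarrow> (nat \<times> nat \<Rightarrow> real) \<Rightarrow> real" where
  "colnorm2 m x = (\<Sum>i<m. (x (i, 0))\<^sup>2)"

text \<open>Half a step of bidiagonalisation: reflect the first column into the first axis, delete it, and
transpose the rest.  Owing to the transposition, the next application treats the first row.  The
recursion below reads off the squared entries of the bidiagonal form, diagonal ones at even and
off-diagonal ones at odd positions.\<close>

definition peel :: "nat \<Rightarrow> nat \<Rightarrow> (nat \<times> nat \<Rightarrow> real) \<Rightarrow> nat \<times> nat \<Rightarrow> real" where
  "peel m n x = (\<lambda>p\<in>idx (n - 1) m. \<Sum>k<m. householder m (\<lambda>k. x (k, 0)) (snd p) k * x (k, Suc (fst p)))"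

primrec bidiag_sq :: "nat \<Rightarrow> nat \<Rightarrow> nat \<Rightarrow> (nat \<times> nat \<Rightarrow> real) \<Rightarrow> real" where
  "bidiag_sq 0 m n x = (if n = 0 then 0 else colnorm2 m x)"
| "bidiag_sq (Suc k) m n x = bidiag_sq k (n - 1) m (peel m n x)"

lemma colnorm2_nonneg: "0 \<le> colnorm2 m x"
  by (simp add: colnorm2_def sum_nonneg)

lemma bidiag_sq_nonneg: "0 \<le> bidiag_sq k m n x"
  by (induction k arbitrary: m n x) (auto simp: colnorm2_nonneg)

lemma bidiag_sq_trivial: "m = 0 \<or> n = 0 \<Longrightarrow> bidiag_sq k m n x = 0"
  by (induction k arbitrary: m n x) (auto simp: colnorm2_def)

lemma measurable_peel [measurable]:
  "peel m n \<in> measurable (arrays (idx m n)) (arrays (idx (n - 1) m))"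
  unfolding peel_def householder_def Let_def by measurable

lemma measurable_bidiag_sq [measurable]: "bidiag_sq k m n \<in> borel_measurable (arrays (idx m n))"
proof (induction k arbitrary: m n)
  case 0
  then show ?case unfolding bidiag_sq.simps colnorm2_def by measurable
next
  case (Suc k)
  show ?case unfolding bidiag_sq.simps using measurable_compose[OF measurable_peel Suc] .
qed

text \<open>The reflection depends on the first column only, and given this column it acts on the remaining
entries as a fixed orthogonal map, which leaves their Gaussian law unchanged.\<close>

lemma nn_integral_peel:
  assumes n: "n > 0" and f[measurable]: "f \<in> borel_measurable (arrays (idx (n - 1) m))"
  shows "(\<integral>\<^sup>+x. f (peel m n x) \<partial>gauss (idx m n)) = (\<integral>\<^sup>+x. f x \<partial>gauss (idx (n - 1) m))"
proof -
  define I J where "I = {..<m} \<times> {0::nat}" and "J = {..<m} \<times> {1..<n}"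
  have IJ: "idx m n = I \<union> J" "I \<inter> J = {}" "finite I" "finite J" using n by (auto simp: I_def J_def)
  define h :: "nat \<times> nat \<Rightarrow> nat \<times> nat" where "h = (\<lambda>p. (snd p, Suc (fst p)))"
  define re where "re = (\<lambda>y :: nat \<times> nat \<Rightarrow> real. \<lambda>p\<in>idx (n - 1) m. y (h p))"
  define T where "T = (\<lambda>x :: nat \<times> nat \<Rightarrow> real. \<lambda>p q :: nat \<times> nat. householder m (\<lambda>k. x (k, 0)) (fst p) (fst q) * of_bool (snd p = snd q))"
  have hJ: "h ` idx (n - 1) m \<subseteq> J" by (auto simp: h_def J_def)
  have inj: "inj_on h (idx (n - 1) m)" by (auto simp: h_def inj_on_def)
  have o: "orth J (T x)" for x unfolding J_def T_def by (rule orth_left) (auto simp: orth_householder)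
  have st: "peel m n (merge I J (x, y)) = re (lin J (T x) y)" for x y
  proof
    fix p
    show "peel m n (merge I J (x, y)) p = re (lin J (T x) y) p"
    proof (cases "p \<in> idx (n - 1) m")
      case True
      then obtain j i where p: "p = (j, i)" "j < n - 1" "i < m" by auto
      have "re (lin J (T x) y) p = (\<Sum>k<m. householder m (\<lambda>k. x (k, 0)) i k * y (k, Suc j))"
        using p True by (simp add: re_def h_def T_def J_def lin_left)
      also have "\<dots> = (\<Sum>k<m. householder m (\<lambda>k. merge I J (x, y) (k, 0)) i k * merge I J (x, y) (k, Suc j))"
      proof -
        have "merge I J (x, y) (k, 0) = x (k, 0)" "merge I J (x, y) (k, Suc j) = y (k, Suc j)" if "k < m" for k
          using that p by (auto simp: merge_def I_def J_def)
        then show ?thesis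
          by (intro sum.cong refl arg_cong2[where f="(*)"] householder_cong) (use p in auto)
      qed
      also have "\<dots> = peel m n (merge I J (x, y)) p" using True p by (simp add: peel_def)
      finally show ?thesis by simp
    qed (simp add: peel_def re_def)
  qed
  have [measurable]: "re \<in> measurable (arrays J) (arrays (idx (n - 1) m))"
    unfolding re_def by measurable
  have "(\<integral>\<^sup>+x. f (peel m n x) \<partial>gauss (idx m n)) =
     (\<integral>\<^sup>+x. \<integral>\<^sup>+y. f (peel m n (merge I J (x, y))) \<partial>gauss J \<partial>gauss I)"
    unfolding IJ(1) using IJ measurable_compose[OF measurable_peel f]
    by (intro nn_integral_gauss_merge) (auto simp: IJ(1))
  also have "\<dots> = (\<integral>\<^sup>+x. \<integral>\<^sup>+y. f (re (lin J (T x) y)) \<partial>gauss J \<partial>gauss I)"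
    by (simp add: st)
  also have "\<dots> = (\<integral>\<^sup>+x. \<integral>\<^sup>+y. f (re y) \<partial>gauss J \<partial>gauss I)"
    by (intro nn_integral_cong nn_integral_gauss_orth[of J _ "\<lambda>y. f (re y)"] IJ o) measurable
  also have "\<dots> = (\<integral>\<^sup>+y. f (re y) \<partial>gauss J)"
    using prob_space.emeasure_space_1[OF prob_space_gauss[of I]] by simp
  also have "\<dots> = (\<integral>\<^sup>+x. f x \<partial>gauss (idx (n - 1) m))"
    unfolding re_def by (rule nn_integral_gauss_reindex[OF inj hJ f])
  finally show ?thesis .
qed

lemma AE_gauss_peel:
  assumes n: "n > 0" and P[measurable]: "Measurable.pred (arrays (idx (n - 1) m)) P"
    and ae: "AE x in gauss (idx (n - 1) m). P x"
  shows "AE x in gauss (idx m n). P (peel m n x)"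
proof -
  have [measurable]: "Measurable.pred (gauss (idx (n - 1) m)) P" by measurable
  have [measurable]: "Measurable.pred (arrays (idx m n)) (\<lambda>x. P (peel m n x))" by measurable
  have [measurable]: "Measurable.pred (gauss (idx m n)) (\<lambda>x. P (peel m n x))" by measurable
  have "(\<integral>\<^sup>+x. (if P (peel m n x) then 0 else 1) \<partial>gauss (idx m n)) =
     (\<integral>\<^sup>+x. (if P x then 0 else 1) \<partial>gauss (idx (n - 1) m))"
    by (rule nn_integral_peel[OF n, of "\<lambda>x. if P x then 0 else 1"]) measurable
  also have "\<dots> = 0"
  proof (subst nn_integral_0_iff_AE)
    show "(\<lambda>x. if P x then 0 else 1 :: ennreal) \<in> borel_measurable (gauss (idx (n - 1) m))" by measurable
    show "AE x in gauss (idx (n - 1) m). (if P x then 0 else 1) = (0::ennreal)"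
      using ae by eventually_elim simp
  qed
  finally have "AE x in gauss (idx m n). (if P (peel m n x) then 0 else 1) = (0::ennreal)"
    by (subst (asm) nn_integral_0_iff_AE) auto
  then show ?thesis by (rule AE_mp) (auto split: if_splits)
qed

text \<open>Since peeling preserves the Gaussian law, each entry is the norm of a Gaussian vector.  The dimension
\<open>r\<close> of this vector starts at \<open>m\<close> or \<open>n\<close> and loses at most 1 per step; it is 0 once the matrix is used
up.\<close>

lemma bidiag_sq_law:
  "\<exists>r. r \<le> (if even k then m else n) \<and>
     (k < m \<longrightarrow> k < n \<longrightarrow> (if even k then m else n) - k \<le> r) \<and>
     (\<forall>\<phi>\<in>borel_measurable borel. (\<integral>\<^sup>+x. \<phi> (bidiag_sq k m n x) \<partial>gauss (idx m n)) =
        (\<integral>\<^sup>+x. (\<phi> (\<Sum>i<r. (x i)\<^sup>2) :: ennreal) \<partial>gauss {..<r}))"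
proof (cases "m = 0 \<or> n = 0")
  case True
  then show ?thesis
    using bidiag_sq_trivial[OF True, of k]
    by (intro exI[of _ 0]) (auto simp: prob_space.emeasure_space_1[OF prob_space_gauss])
next
  case False
  then have "n > 0" "m > 0" by auto
  then show ?thesis
  proof (induction k arbitrary: m n)
    case 0
    show ?case
    proof (intro exI[of _ m] conjI ballI impI)
      fix \<phi> :: "real \<Rightarrow> ennreal" assume [measurable]: "\<phi> \<in> borel_measurable borel"
      have "(\<integral>\<^sup>+x. (\<lambda>x. \<phi> (\<Sum>i<m. (x i)\<^sup>2)) (\<lambda>i\<in>{..<m}. x ((\<lambda>i. (i, 0)) i)) \<partial>gauss (idx m n)) =
        
        (\<integral>\<^sup>+x. \<phi> (\<Sum>i<m. (x i)\<^sup>2) \<partial>gauss {..<m})"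
        using 0 by (intro nn_integral_gauss_reindex) (auto simp: inj_on_def)
      moreover have "(\<Sum>i<m. ((\<lambda>i\<in>{..<m}. x (i, 0)) i)\<^sup>2) = (\<Sum>i<m. (x (i, 0))\<^sup>2)" for x :: "nat \<times> nat \<Rightarrow> real"
        by (intro sum.cong) auto
      ultimately show "(\<integral>\<^sup>+x. \<phi> (bidiag_sq 0 m n x) \<partial>gauss (idx m n)) = (\<integral>\<^sup>+x. \<phi> (\<Sum>i<m. (x i)\<^sup>2) \<partial>gauss {..<m})"
        using 0 by (simp add: colnorm2_def del: restrict_apply)
    qed auto
  next
    case (Suc k)
    show ?case
    proof (cases "n = 1")
      case True
      have "bidiag_sq (Suc k) m n x = 0" for x using True by (simp add: bidiag_sq_trivial)
      then show ?thesis
        using True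
        by (intro exI[of _ 0]) (auto simp: prob_space.emeasure_space_1[OF prob_space_gauss])
    next
      case False
      obtain r where r: "r \<le> (if even k then n - 1 else m)"
        "k < n - 1 \<Longrightarrow> k < m \<Longrightarrow> (if even k then n - 1 else m) - k \<le> r"
        "\<And>\<phi>. \<phi>\<in>borel_measurable borel \<Longrightarrow> (\<integral>\<^sup>+x. \<phi> (bidiag_sq k (n - 1) m x) \<partial>gauss (idx (n - 1) m)) =
        (\<integral>\<^sup>+x. (\<phi> (\<Sum>i<r. (x i)\<^sup>2) :: ennreal) \<partial>gauss {..<r})"
        using Suc.IH[of m "n - 1"] Suc.prems False by auto
      show ?thesis
      proof (intro exI[of _ r] conjI ballI impI)
        fix \<phi> :: "real \<Rightarrow> ennreal" assume [measurable]: "\<phi> \<in> borel_measurable borel"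
        show "(\<integral>\<^sup>+x. \<phi> (bidiag_sq (Suc k) m n x) \<partial>gauss (idx m n)) = (\<integral>\<^sup>+x. \<phi> (\<Sum>i<r. (x i)\<^sup>2) \<partial>gauss {..<r})"
          using nn_integral_peel[of n "\<lambda>x. \<phi> (bidiag_sq k (n - 1) m x)" m] r(3)[of \<phi>] Suc.prems by simp
      next
        assume k: "Suc k < m" "Suc k < n"
        then have "(if even k then n - 1 else m) - k \<le> r" by (intro r(2)) auto
        then show "(if even (Suc k) then m else n) - Suc k \<le> r" by (auto split: if_splits)
      qed (use r(1) in auto)
    qed
  qed
qed

definition bil :: "nat \<Rightarrow> nat \<Rightarrow> (nat \<times> nat \<Rightarrow> real) \<Rightarrow> (nat \<Rightarrow> real) \<Rightarrow> (nat \<Rightarrow> real) \<Rightarrow> real" where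
  "bil m n x u y = (\<Sum>j<n. (\<Sum>i<m. u i * x (i, j)) * y j)"

text \<open>The reflection is orthogonal, so inner products of \<open>u\<close> with the columns can be computed after
reflecting both.\<close>

lemma column_peel:
  fixes x :: "nat \<times> nat \<Rightarrow> real"
  assumes m: "m > 0"
  defines "U \<equiv> \<lambda>u i. \<Sum>k<m. householder m (\<lambda>k. x (k, 0)) i k * u k"
  shows "(\<Sum>i<m. u i * x (i, 0)) = sqrt (colnorm2 m x) * U u 0"
    and "Suc j < n \<Longrightarrow> (\<Sum>i<m. u i * x (i, Suc j)) = (\<Sum>i<m. peel m n x (j, i) * U u i)"
proof -
  have o: "(\<Sum>i<m. U u i * U v i) = (\<Sum>i<m. u i * v i)" for v
    unfolding U_def by (rule orth_inner) (auto simp: orth_householder)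
  have "(\<Sum>i<m. u i * x (i, 0)) = (\<Sum>i<m. U u i * U (\<lambda>i. x (i, 0)) i)" by (rule o[symmetric])
  also have "\<dots> = (\<Sum>i<m. if i = 0 then sqrt (colnorm2 m x) * U u 0 else 0)"
  proof (intro sum.cong refl)
    fix i assume "i \<in> {..<m}"
    then have "U (\<lambda>i. x (i, 0)) i = (if i = 0 then sqrt (colnorm2 m x) else 0)"
      by (simp add: U_def householder_apply colnorm2_def)
    then show "U u i * U (\<lambda>i. x (i, 0)) i = (if i = 0 then sqrt (colnorm2 m x) * U u 0 else 0)" by simp
  qed
  finally show "(\<Sum>i<m. u i * x (i, 0)) = sqrt (colnorm2 m x) * U u 0" using m by simp
  assume j: "Suc j < n"
  have "(\<Sum>i<m. u i * x (i, Suc j)) = (\<Sum>i<m. U u i * U (\<lambda>i. x (i, Suc j)) i)" by (rule o[symmetric])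
  also have "\<dots> = (\<Sum>i<m. peel m n x (j, i) * U u i)"
  proof (intro sum.cong refl)
    fix i assume "i \<in> {..<m}"
    then have "U (\<lambda>i. x (i, Suc j)) i = peel m n x (j, i)"
      using j by (simp add: U_def peel_def)
    then show "U u i * U (\<lambda>i. x (i, Suc j)) i = peel m n x (j, i) * U u i" by simp
  qed
  finally show "(\<Sum>i<m. u i * x (i, Suc j)) = (\<Sum>i<m. peel m n x (j, i) * U u i)" .
qed

lemma bil_peel:
  fixes x :: "nat \<times> nat \<Rightarrow> real"
  assumes m: "m > 0" and n: "n > 0"
  defines "U \<equiv> \<lambda>u i. \<Sum>k<m. householder m (\<lambda>k. x (k, 0)) i k * u k"
  shows "bil m n x u y = sqrt (colnorm2 m x) * U u 0 * y 0 + bil (n - 1) m (peel m n x) (\<lambda>j. y (Suc j)) (U u)"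
proof -
  obtain n' where n': "n = Suc n'" using n by (cases n) auto
  have "bil m n x u y = (\<Sum>i<m. u i * x (i, 0)) * y 0 + (\<Sum>j<n'. (\<Sum>i<m. u i * x (i, Suc j)) * y (Suc j))"
    unfolding bil_def n' by (simp add: sum.lessThan_Suc_shift del: sum.lessThan_Suc)
  also have "(\<Sum>j<n'. (\<Sum>i<m. u i * x (i, Suc j)) * y (Suc j)) =
     (\<Sum>j<n'. (\<Sum>i<m. peel m n x (j, i) * U u i) * y (Suc j))"
    unfolding U_def by (intro sum.cong refl arg_cong2[where f="(*)"] column_peel) (use m n' in auto)
  also have "\<dots> = bil (n - 1) m (peel m n x) (\<lambda>j. y (Suc j)) (U u)"
    unfolding bil_def n' by (simp add: sum_distrib_right sum_distrib_left mult_ac) (rule sum.swap)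
  finally show ?thesis using column_peel(1)[OF m, of u x] by (simp add: U_def)
qed

lemma L2_set_Suc_shift: "(L2_set f {..<Suc n})\<^sup>2 = (f 0)\<^sup>2 + (L2_set (\<lambda>i. f (Suc i)) {..<n})\<^sup>2"
  by (simp add: L2_set_def sum_nonneg sum.lessThan_Suc_shift del: sum.lessThan_Suc)

lemma cauchy_schwarz_2:
  fixes a b c d :: real
  assumes "a\<^sup>2 + c\<^sup>2 = P\<^sup>2" "b\<^sup>2 + d\<^sup>2 = Q\<^sup>2" "P \<ge> 0" "Q \<ge> 0"
  shows "\<bar>a\<bar> * \<bar>b\<bar> + \<bar>c\<bar> * \<bar>d\<bar> \<le> P * Q"
proof (rule power2_le_imp_le)
  have "(P * Q)\<^sup>2 - (\<bar>a\<bar> * \<bar>b\<bar> + \<bar>c\<bar> * \<bar>d\<bar>)\<^sup>2 = (\<bar>a\<bar> * \<bar>d\<bar> - \<bar>b\<bar> * \<bar>c\<bar>)\<^sup>2"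
    unfolding power_mult_distrib assms(1,2)[symmetric] by (simp add: power2_eq_square algebra_simps)
  then show "(\<bar>a\<bar> * \<bar>b\<bar> + \<bar>c\<bar> * \<bar>d\<bar>)\<^sup>2 \<le> (P * Q)\<^sup>2"
    by (metis diff_ge_0_iff_ge zero_le_power2)
qed (use assms in auto)

lemma L2_set_householder: "L2_set (\<lambda>i. \<Sum>k<m. householder m v i k * u k) {..<m} = L2_set u {..<m}"
proof -
  have "(\<Sum>i<m. (\<Sum>k<m. householder m v i k * u k) * (\<Sum>k<m. householder m v i k * u k)) = (\<Sum>k<m. u k * u k)"
    by (rule orth_inner) (auto simp: orth_householder)
  then show ?thesis by (simp add: L2_set_def power2_eq_square)
qed

text \<open>The two summands are the contributions of the diagonal and of the off-diagonal of the bidiagonal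
form.  The off-diagonal does not see the first coordinate of \<open>y\<close>; keeping this in the statement is
what makes the induction work, since transposition exchanges the two diagonals.\<close>

lemma bil_upper_split:
  assumes "A \<ge> 0" "B \<ge> 0" "\<And>k. k < m + n \<Longrightarrow> bidiag_sq k m n x \<le> (if even k then A\<^sup>2 else B\<^sup>2)"
  shows "\<exists>p r. bil m n x u y = p + r \<and> \<bar>p\<bar> \<le> A * L2_set u {..<m} * L2_set y {..<n} \<and>
      \<bar>r\<bar> \<le> B * L2_set u {..<m} * L2_set (\<lambda>j. y (Suc j)) {..<n - 1}"
  using assms
proof (induction "m + n" arbitrary: m n x u y A B rule: less_induct)
  case less
  show ?case
  proof (cases "m = 0 \<or> n = 0")
    case True
    then have "bil m n x u y = 0" by (auto simp: bil_def)
    then show ?thesis using less.prems by (intro exI[of _ 0]) (auto simp: L2_set_nonneg)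
  next
    case False
    then obtain n' m' where n': "n = Suc n'" and m': "m = Suc m'" by (metis not0_implies_Suc)
    define U where "U = (\<lambda>i. \<Sum>k<m. householder m (\<lambda>k. x (k, 0)) i k * u k)"
    have NU: "L2_set U {..<m} = L2_set u {..<m}" unfolding U_def by (rule L2_set_householder)
    have "\<exists>p r. bil (n - 1) m (peel m n x) (\<lambda>j. y (Suc j)) U = p + r \<and>
        \<bar>p\<bar> \<le> B * L2_set (\<lambda>j. y (Suc j)) {..<n - 1} * L2_set U {..<m} \<and>
        \<bar>r\<bar> \<le> A * L2_set (\<lambda>j. y (Suc j)) {..<n - 1} * L2_set (\<lambda>j. U (Suc j)) {..<m - 1}"
    proof (rule less.hyps)
      show "bidiag_sq k (n - 1) m (peel m n x) \<le> (if even k then B\<^sup>2 else A\<^sup>2)" if "k < n - 1 + m" for k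
        using less.prems(3)[of "Suc k"] that n' by (auto split: if_splits)
    qed (use less.prems n' in auto)
    then obtain p r where pr: "bil (n - 1) m (peel m n x) (\<lambda>j. y (Suc j)) U = p + r"
        "\<bar>p\<bar> \<le> B * L2_set (\<lambda>j. y (Suc j)) {..<n - 1} * L2_set U {..<m}"
        "\<bar>r\<bar> \<le> A * L2_set (\<lambda>j. y (Suc j)) {..<n - 1} * L2_set (\<lambda>j. U (Suc j)) {..<m - 1}" by blast
    define a where "a = sqrt (colnorm2 m x)"
    have a: "0 \<le> a" "a \<le> A"
      using less.prems(1) less.prems(3)[of 0] n' by (auto simp: a_def colnorm2_nonneg real_le_lsqrt)
    have b: "bil m n x u y = (a * U 0 * y 0 + r) + p"
      using bil_peel[of m n x u y] n' m' pr(1) by (simp add: a_def U_def)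
    have "\<bar>a * U 0 * y 0 + r\<bar> \<le> a * (\<bar>U 0\<bar> * \<bar>y 0\<bar>) + \<bar>r\<bar>"
      using a abs_triangle_ineq[of "a * U 0 * y 0" r] by (simp add: abs_mult mult.assoc)
    also have "\<dots> \<le> A * (\<bar>U 0\<bar> * \<bar>y 0\<bar>) + A * L2_set (\<lambda>j. y (Suc j)) {..<n - 1} * L2_set (\<lambda>j. U (Suc j)) {..<m - 1}"
      using a pr(3) by (intro add_mono mult_right_mono) auto
    also have "\<dots> = A * (\<bar>U 0\<bar> * \<bar>y 0\<bar> + \<bar>L2_set (\<lambda>j. U (Suc j)) {..<m'}\<bar> * \<bar>L2_set (\<lambda>j. y (Suc j)) {..<n'}\<bar>)"
      using n' m' by (simp add: algebra_simps)
    also have "\<dots> \<le> A * (L2_set U {..<m} * L2_set y {..<n})"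
      unfolding n' m' using less.prems(1)
      by (intro mult_left_mono cauchy_schwarz_2) (simp_all add: L2_set_Suc_shift)
    finally have "\<bar>a * U 0 * y 0 + r\<bar> \<le> A * L2_set u {..<m} * L2_set y {..<n}" by (simp add: NU mult.assoc)
    moreover have "\<bar>p\<bar> \<le> B * L2_set u {..<m} * L2_set (\<lambda>j. y (Suc j)) {..<n - 1}"
      using pr(2) by (simp add: NU mult_ac)
    ultimately show ?thesis using b by blast
  qed
qed

lemma bil_upper:
  assumes "A \<ge> 0" "B \<ge> 0" "\<And>k. k < m + n \<Longrightarrow> bidiag_sq k m n x \<le> (if even k then A\<^sup>2 else B\<^sup>2)"
  shows "bil m n x u y \<le> (A + B) * L2_set u {..<m} * L2_set y {..<n}"
proof -
  obtain p r where pr: "bil m n x u y = p + r" "\<bar>p\<bar> \<le> A * L2_set u {..<m} * L2_set y {..<n}"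
      "\<bar>r\<bar> \<le> B * L2_set u {..<m} * L2_set (\<lambda>j. y (Suc j)) {..<n - 1}"
    using bil_upper_split[OF assms, of u y] by blast
  have "L2_set (\<lambda>j. y (Suc j)) {..<n - 1} \<le> L2_set y {..<n}"
  proof (cases n)
    case (Suc n')
    have "(L2_set (\<lambda>j. y (Suc j)) {..<n'})\<^sup>2 \<le> (L2_set y {..<Suc n'})\<^sup>2"
      unfolding L2_set_Suc_shift by simp
    from power2_le_imp_le[OF this L2_set_nonneg] show ?thesis using Suc by simp
  qed (simp add: L2_set_nonneg)
  then have "\<bar>r\<bar> \<le> B * L2_set u {..<m} * L2_set y {..<n}"
    using assms pr(3) by (intro order_trans[OF pr(3)] mult_left_mono) auto
  then show ?thesis using pr by (simp add: algebra_simps)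
qed

text \<open>In the coordinates that make the matrix bidiagonal, \<open>u\<close> and \<open>y\<close> are the vectors of ones on the
leading corner that contains the first \<open>k\<close> bidiagonal entries, whence their norms.\<close>

lemma bil_lower:
  assumes "k < m" "k < n"
  shows "\<exists>u y. y 0 = 1 \<and> (L2_set u {..<m})\<^sup>2 = real ((k + 1) div 2) \<and> (L2_set y {..<n})\<^sup>2 = real (k div 2 + 1) \<and>
     bil m n x u y = (\<Sum>i<k. sqrt (bidiag_sq i m n x))"
  using assms
proof (induction k arbitrary: m n x)
  case 0
  then show ?case
    by (intro exI[of _ "\<lambda>_. 0"] exI[of _ "\<lambda>j. of_bool (j = 0)"])
       (auto simp: L2_set_def bil_def if_distrib[of "\<lambda>x. x\<^sup>2"] of_bool_def cong: if_cong)
next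
  case (Suc k)
  then obtain n' m' where n': "n = Suc n'" and m': "m = Suc m'" by (metis Nat.lessE)
  obtain y' U where ih: "U 0 = 1" "(L2_set y' {..<n - 1})\<^sup>2 = real ((k + 1) div 2)"
     "(L2_set U {..<m})\<^sup>2 = real (k div 2 + 1)"
     "bil (n - 1) m (peel m n x) y' U = (\<Sum>i<k. sqrt (bidiag_sq i (n - 1) m (peel m n x)))"
    using Suc.IH[of "n - 1" m "peel m n x"] Suc.prems n' by auto
  define h where "h = householder m (\<lambda>k. x (k, 0))"
  define u where "u = (\<lambda>i. \<Sum>k<m. h i k * U k)"
  define y where "y = (\<lambda>j. case j of 0 \<Rightarrow> 1 | Suc j \<Rightarrow> y' j)"
  have Uu: "(\<Sum>k<m. h i k * u k) = U i" if "i < m" for i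
  proof -
    have "(\<Sum>k<m. h i k * u k) = (\<Sum>k<m. \<Sum>l<m. h i k * h k l * U l)"
      by (simp add: u_def sum_distrib_left mult.assoc)
    also have "\<dots> = (\<Sum>l<m. (\<Sum>k<m. h k i * h k l) * U l)"
      by (subst sum.swap) (simp add: sum_distrib_right h_def householder_sym[of m _ i])
    also have "\<dots> = (\<Sum>l<m. if l = i then U l else 0)"
      using orth_householder[of m "\<lambda>k. x (k, 0)"] that by (intro sum.cong) (auto simp: orth_def h_def)
    finally show ?thesis using that by simp
  qed
  have nu: "L2_set u {..<m} = L2_set U {..<m}" unfolding u_def h_def by (rule L2_set_householder)
  have "bil m n x u y = sqrt (colnorm2 m x) * (\<Sum>k<m. h 0 k * u k) * y 0 + bil (n - 1) m (peel m n x) (\<lambda>j. y (Suc j)) (\<lambda>i. \<Sum>k<m. h i k * u k)"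
    unfolding h_def by (rule bil_peel) (use n' m' in auto)
  also have "bil (n - 1) m (peel m n x) (\<lambda>j. y (Suc j)) (\<lambda>i. \<Sum>k<m. h i k * u k) = bil (n - 1) m (peel m n x) y' U"
    by (simp add: bil_def Uu y_def)
  also have "(\<Sum>k<m. h 0 k * u k) = 1" using Uu[of 0] m' ih(1) by simp
  finally have "bil m n x u y = (\<Sum>i<Suc k. sqrt (bidiag_sq i m n x))"
    unfolding ih(4) by (simp add: y_def sum.lessThan_Suc_shift n' del: sum.lessThan_Suc)
  moreover have "(L2_set y {..<n})\<^sup>2 = real (Suc k div 2 + 1)"
    using ih(2) by (simp add: n' L2_set_Suc_shift y_def)
  moreover have "(L2_set u {..<m})\<^sup>2 = real ((Suc k + 1) div 2)"
    using ih(3) nu by simp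
  moreover have "y 0 = 1" by (simp add: y_def)
  ultimately show ?case by blast
qed

text \<open>The number \<open>N\<close> only bounds the depth of the recursion; \<open>N = m + n\<close> covers the whole bidiagonal
form.\<close>

primrec nondeg :: "nat \<Rightarrow> nat \<Rightarrow> nat \<Rightarrow> (nat \<times> nat \<Rightarrow> real) \<Rightarrow> bool" where
  "nondeg 0 m n x \<longleftrightarrow> True"
| "nondeg (Suc N) m n x \<longleftrightarrow> (m > 0 \<longrightarrow> n > 0 \<longrightarrow> colnorm2 m x \<noteq> 0 \<and> nondeg N (n - 1) m (peel m n x))"

lemma measurable_nondeg [measurable]: "Measurable.pred (arrays (idx m n)) (nondeg N m n)"
proof (induction N arbitrary: m n)
  case (Suc N)
  have [measurable]: "Measurable.pred (arrays (idx m n)) (\<lambda>x. nondeg N (n - 1) m (peel m n x))"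
    using measurable_compose[OF measurable_peel Suc] .
  have [measurable]: "colnorm2 m \<in> borel_measurable (arrays (idx m n))"
    unfolding colnorm2_def by measurable
  show ?case unfolding nondeg.simps by measurable
next
  case 0
  have "nondeg 0 m n = (\<lambda>_. True)" by auto
  then show ?case by simp
qed

lemma AE_nondeg: "AE x in gauss (idx m n). nondeg N m n x"
proof (induction N arbitrary: m n)
  case (Suc N)
  show ?case
  proof (cases "m > 0 \<and> n > 0")
    case True
    have "AE x in gauss (idx m n). x (0, 0) \<noteq> 0"
      using True by (intro AE_gauss_coord[of _ "(0, 0)"]) auto
    moreover have "AE x in gauss (idx m n). nondeg N (n - 1) m (peel m n x)"
      using True by (intro AE_gauss_peel[where P="nondeg N (n - 1) m"] Suc) auto
    ultimately show ?thesis
    proof eventually_elim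
      case (elim x)
      have "0 < (x (0, 0))\<^sup>2" using elim by simp
      also have "\<dots> \<le> colnorm2 m x" unfolding colnorm2_def
        using True by (intro member_le_sum[where f="\<lambda>i. (x (i, 0))\<^sup>2"]) auto
      finally show ?case using elim by simp
    qed
  qed auto
qed simp

text \<open>The analogue of the fact that an eigenvector of a Jacobi matrix is determined by its first
coordinate: if this vanishes, then the first bidiagonal entry forces the first reflected
coordinate of \<open>u\<close> to vanish, and the pair with exchanged roles satisfies the same equations for the
smaller matrix.  This exchange is why the equations carry
two separate factors \<open>\<sigma>\<close> and \<open>\<tau>\<close>, which swap their places.\<close>

lemma nondeg_singular_vector:
  assumes "nondeg N m n x" "m + n \<le> N"
    and "\<And>i. i < m \<Longrightarrow> (\<Sum>j<n. x (i, j) * w j) = \<sigma> * u i"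
    and "\<And>j. j < n \<Longrightarrow> (\<Sum>i<m. u i * x (i, j)) = \<tau> * w j"
    and "\<sigma> \<noteq> 0" "\<tau> \<noteq> 0" "w 0 = 0" "j < n"
  shows "w j = 0"
  using assms
proof (induction N arbitrary: m n x w u \<sigma> \<tau> j)
  case 0
  then show ?case by simp
next
  case (Suc N)
  show ?case
  proof (cases "m = 0")
    case True
    then show ?thesis using Suc.prems(4)[of j] Suc.prems by simp
  next
    case False
    then have m: "m > 0" and n: "n > 0" using Suc.prems by auto
    then obtain n' where n': "n = Suc n'" by (cases n) auto
    define h where "h = householder m (\<lambda>k. x (k, 0))"
    define U where "U = (\<lambda>i. \<Sum>k<m. h i k * u k)"
    have c: "sqrt (colnorm2 m x) * U 0 = \<tau> * w 0"
      using column_peel(1)[OF m, of u x] Suc.prems(4)[of 0] n by (simp add: U_def h_def)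
    then have U0: "U 0 = 0" using Suc.prems(1,7) m n by (simp add: colnorm2_nonneg)
    have e2: "(\<Sum>i<m. peel m n x (j, i) * U i) = \<tau> * w (Suc j)" if "Suc j < n" for j
      using column_peel(2)[OF m that, of u x] Suc.prems(4)[OF that] by (simp add: U_def h_def)
    have e1: "(\<Sum>j<n - 1. w (Suc j) * peel m n x (j, i)) = \<sigma> * U i" if i: "i < m" for i
    proof -
      have "\<sigma> * U i = (\<Sum>k<m. h i k * (\<sigma> * u k))" by (simp add: U_def sum_distrib_left mult_ac)
      also have "\<dots> = (\<Sum>k<m. h i k * (\<Sum>j<n. x (k, j) * w j))" using Suc.prems(3) by simp
      also have "\<dots> = (\<Sum>j<n. w j * (\<Sum>k<m. h i k * x (k, j)))"
        by (simp add: sum_distrib_left mult_ac) (rule sum.swap)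
      also have "\<dots> = (\<Sum>j<n'. w (Suc j) * (\<Sum>k<m. h i k * x (k, Suc j)))"
        unfolding n' using Suc.prems(7) by (simp add: sum.lessThan_Suc_shift del: sum.lessThan_Suc)
      also have "\<dots> = (\<Sum>j<n - 1. w (Suc j) * peel m n x (j, i))"
        using n' i by (intro sum.cong) (auto simp: peel_def h_def)
      finally show ?thesis by simp
    qed
    have U: "U i = 0" if "i < m" for i
    proof (rule Suc.IH[of "n - 1" m "peel m n x" U \<tau> "\<lambda>j. w (Suc j)" \<sigma> i])
      show "nondeg N (n - 1) m (peel m n x)" using Suc.prems(1) m n by simp
      show "(\<Sum>j<m. peel m n x (i, j) * U j) = \<tau> * w (Suc i)" if "i < n - 1" for i
        using that e2[of i] by simp
      show "(\<Sum>j<n - 1. w (Suc j) * peel m n x (j, i)) = \<sigma> * U i" if "i < m" for i by (rule e1[OF that])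
    qed (use Suc.prems n' that U0 in auto)
    show ?thesis
    proof (cases j)
      case (Suc j')
      then show ?thesis using e2[of j'] Suc.prems U by simp
    qed (use Suc.prems in simp)
  qed
qed

section \<open>Moments of sums of functions of Gaussian variables\<close>

lemma std_normal_moments:
  "(LINT x|std_normal_distribution. x ^ 2) = 1"
  "(LINT x|std_normal_distribution. x ^ 4) = 3"
  "(LINT x|std_normal_distribution. x ^ 6) = 15"
  "(LINT x|std_normal_distribution. x ^ 8) = 105"
  using std_normal_distribution_even_moments[of 1] std_normal_distribution_even_moments[of 2]
    std_normal_distribution_even_moments[of 3] std_normal_distribution_even_moments[of 4]
  by (simp_all add: fact_numeral)

lemma nn_integral_shifted_square:
  fixes f :: "real \<Rightarrow> real"
  assumes "integrable std_normal_distribution f" "integrable std_normal_distribution (\<lambda>t. (f t)\<^sup>2)"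
    and "(LINT t|std_normal_distribution. f t) = 0" "(LINT t|std_normal_distribution. (f t)\<^sup>2) = v"
  shows "(\<integral>\<^sup>+t. ennreal ((a + f t)\<^sup>2) \<partial>std_normal_distribution) = ennreal (a\<^sup>2 + v)"
proof -
  interpret prob_space std_normal_distribution by (rule prob_space_std_normal)
  have e: "(a + f t)\<^sup>2 = a\<^sup>2 + 2 * a * f t + (f t)\<^sup>2" for t by (simp add: power2_eq_square algebra_simps)
  have "integrable std_normal_distribution (\<lambda>t. a\<^sup>2 + 2 * a * f t + (f t)\<^sup>2)" using assms by auto
  moreover have "(LINT t|std_normal_distribution. a\<^sup>2 + 2 * a * f t + (f t)\<^sup>2) = a\<^sup>2 + v"
    using assms prob_space by simp
  ultimately show ?thesis
    unfolding e[symmetric] by (subst nn_integral_eq_integral) auto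
qed

lemma nn_integral_gauss_Suc:
  fixes f :: "real \<Rightarrow> real" and \<phi> :: "real \<Rightarrow> ennreal"
  assumes [measurable]: "f \<in> borel_measurable borel" "\<phi> \<in> borel_measurable borel"
  shows "(\<integral>\<^sup>+x. \<phi> (\<Sum>i<Suc r. f (x i)) \<partial>gauss {..<Suc r}) =
    (\<integral>\<^sup>+x. \<integral>\<^sup>+t. \<phi> ((\<Sum>i<r. f (x i)) + f t) \<partial>std_normal_distribution \<partial>gauss {..<r})"
proof -
  have "(\<integral>\<^sup>+x. \<phi> (\<Sum>i<Suc r. f (x i)) \<partial>gauss {..<Suc r}) =
    (\<integral>\<^sup>+x. \<integral>\<^sup>+t. \<phi> (\<Sum>i<Suc r. f ((x(r := t)) i)) \<partial>std_normal_distribution \<partial>gauss {..<r})"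
    unfolding lessThan_Suc by (rule nn_integral_gauss_insert) auto
  moreover have "(\<Sum>i<Suc r. f ((x(r := t)) i)) = (\<Sum>i<r. f (x i)) + f t" for x t by simp
  ultimately show ?thesis by (simp only:)
qed

lemma emeasure_space_gauss [simp]: "emeasure (gauss I) (space (gauss I)) = 1"
  by (rule prob_space.emeasure_space_1[OF prob_space_gauss])

lemma nn_integral_sum_square:
  fixes f :: "real \<Rightarrow> real"
  assumes f: "integrable std_normal_distribution f" "integrable std_normal_distribution (\<lambda>t. (f t)\<^sup>2)"
    and "(LINT t|std_normal_distribution. f t) = 0" and v: "(LINT t|std_normal_distribution. (f t)\<^sup>2) = v"
  shows "(\<integral>\<^sup>+x. ennreal ((\<Sum>i<r. f (x i))\<^sup>2) \<partial>gauss {..<r}) = ennreal (real r * v)"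
proof (induction r)
  case 0
  then show ?case by simp
next
  case (Suc r)
  have [measurable]: "f \<in> borel_measurable borel" using f(1) by (auto dest: borel_measurable_integrable)
  have v0: "v \<ge> 0" unfolding v[symmetric] by simp
  have "(\<integral>\<^sup>+x. ennreal ((\<Sum>i<Suc r. f (x i))\<^sup>2) \<partial>gauss {..<Suc r}) =
     (\<integral>\<^sup>+x. \<integral>\<^sup>+t. ennreal (((\<Sum>i<r. f (x i)) + f t)\<^sup>2) \<partial>std_normal_distribution \<partial>gauss {..<r})"
    by (rule nn_integral_gauss_Suc[where \<phi>="\<lambda>s. ennreal (s\<^sup>2)"]) auto
  also have "\<dots> = (\<integral>\<^sup>+x. ennreal ((\<Sum>i<r. f (x i))\<^sup>2) + ennreal v \<partial>gauss {..<r})"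
    using v0 by (simp add: nn_integral_shifted_square[OF assms])
  also have "\<dots> = ennreal (real r * v) + ennreal v"
    by (subst nn_integral_add) (auto simp: Suc)
  also have "\<dots> = ennreal (real (Suc r) * v)"
    using v0 by (subst ennreal_plus[symmetric]) (auto simp: algebra_simps)
  finally show ?case .
qed

lemma std_normal_square_moments:
  defines "\<xi> \<equiv> \<lambda>t::real. t\<^sup>2 - 1"
  shows "integrable std_normal_distribution (\<lambda>t. (\<xi> t) ^ k)"
    and "(LINT t|std_normal_distribution. \<xi> t) = 0"
    and "(LINT t|std_normal_distribution. (\<xi> t) ^ 2) = 2"
    and "(LINT t|std_normal_distribution. (\<xi> t) ^ 3) = 8"
    and "(LINT t|std_normal_distribution. (\<xi> t) ^ 4) = 60"
proof -
  interpret prob_space std_normal_distribution by (rule prob_space_std_normal)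
  note [simp] = integrable_std_normal_distribution_moment
  have "(\<xi> t) ^ k = (\<Sum>i\<le>k. real (k choose i) * t ^ (2 * i) * (- 1) ^ (k - i))" for t
    unfolding \<xi>_def using binomial_ring[of "t\<^sup>2" "-1" k] by (simp add: power_mult)
  then show "integrable std_normal_distribution (\<lambda>t. (\<xi> t) ^ k)" by simp
  have p: "prob UNIV = 1" using prob_space by simp
  show "(LINT t|std_normal_distribution. \<xi> t) = 0"
    unfolding \<xi>_def using std_normal_moments p by simp
  have "(\<xi> t) ^ 2 = t ^ 4 - 2 * t ^ 2 + 1" for t
    unfolding \<xi>_def by (simp add: power2_eq_square power4_eq_xxxx algebra_simps)
  then show "(LINT t|std_normal_distribution. (\<xi> t) ^ 2) = 2"
    using std_normal_moments p by simp
  have "(\<xi> t) ^ 3 = t ^ 6 - 3 * t ^ 4 + 3 * t ^ 2 - 1" for t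
    unfolding \<xi>_def by (simp add: eval_nat_numeral algebra_simps)
  then show "(LINT t|std_normal_distribution. (\<xi> t) ^ 3) = 8"
    using std_normal_moments p by simp
  have "(\<xi> t) ^ 4 = t ^ 8 - 4 * t ^ 6 + 6 * t ^ 4 - 4 * t ^ 2 + 1" for t
    unfolding \<xi>_def by (simp add: eval_nat_numeral algebra_simps)
  then show "(LINT t|std_normal_distribution. (\<xi> t) ^ 4) = 60"
    using std_normal_moments p by simp
qed

lemma chi2_second_moment:
  "(\<integral>\<^sup>+x. ennreal (((\<Sum>i<r. (x i)\<^sup>2) - real r)\<^sup>2) \<partial>gauss {..<r}) = ennreal (2 * real r)"
proof -
  have "(\<integral>\<^sup>+x. ennreal ((\<Sum>i<r. (x i)\<^sup>2 - 1)\<^sup>2) \<partial>gauss {..<r}) = ennreal (real r * 2)"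
    by (rule nn_integral_sum_square[where f="\<lambda>t. t\<^sup>2 - 1"])
       (use std_normal_square_moments(1)[of 1] std_normal_square_moments in auto)
  then show ?thesis by (simp add: sum_subtractf mult.commute)
qed

text \<open>Fourth moments are required because a union bound over about \<open>n\<close> entries costs a factor \<open>n\<close>, which
second moments cannot pay for.  When a summand is added to a partial sum \<open>a\<close>, its
third moment contributes a term linear in \<open>a\<close>, which is absorbed by those of degree 2 and 0.\<close>

lemma chi2_fourth_moment:
  "(\<integral>\<^sup>+x. ennreal (((\<Sum>i<r. (x i)\<^sup>2) - real r) ^ 4) \<partial>gauss {..<r}) \<le> ennreal (140 * (real r)\<^sup>2)"
proof -
  interpret prob_space std_normal_distribution by (rule prob_space_std_normal)
  define \<xi> where "\<xi> = (\<lambda>t::real. t\<^sup>2 - 1)"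
  have \<xi>m: "integrable std_normal_distribution (\<lambda>t. (\<xi> t) ^ k)"
    "(LINT t|std_normal_distribution. \<xi> t) = 0" "(LINT t|std_normal_distribution. (\<xi> t) ^ 2) = 2"
    "(LINT t|std_normal_distribution. (\<xi> t) ^ 3) = 8" "(LINT t|std_normal_distribution. (\<xi> t) ^ 4) = 60" for k
    unfolding \<xi>_def by (rule std_normal_square_moments)+
  have [measurable]: "\<xi> \<in> borel_measurable borel" unfolding \<xi>_def by measurable
  have pt: "(\<integral>\<^sup>+t. ennreal ((a + \<xi> t) ^ 4) \<partial>std_normal_distribution) \<le> ennreal (a ^ 4) + (16 * ennreal (a\<^sup>2) + 124)" for a
  proof -
    have e: "(a + \<xi> t) ^ 4 = a ^ 4 + 4 * a ^ 3 * \<xi> t + 6 * a\<^sup>2 * (\<xi> t) ^ 2 + 4 * a * (\<xi> t) ^ 3 + (\<xi> t) ^ 4" for t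
      by (simp add: eval_nat_numeral algebra_simps)
    have i: "integrable std_normal_distribution (\<lambda>t. a ^ 4 + 4 * a ^ 3 * \<xi> t + 6 * a\<^sup>2 * (\<xi> t) ^ 2 + 4 * a * (\<xi> t) ^ 3 + (\<xi> t) ^ 4)"
      using \<xi>m(1)[of 1] \<xi>m(1)[of 2] \<xi>m(1)[of 3] \<xi>m(1)[of 4] by simp
    have v: "(LINT t|std_normal_distribution. a ^ 4 + 4 * a ^ 3 * \<xi> t + 6 * a\<^sup>2 * (\<xi> t) ^ 2 + 4 * a * (\<xi> t) ^ 3 + (\<xi> t) ^ 4)
       = a ^ 4 + 12 * a\<^sup>2 + 32 * a + 60"
      using \<xi>m(1)[of 1] \<xi>m(1)[of 2] \<xi>m(1)[of 3] \<xi>m(1)[of 4] \<xi>m(2-5) prob_space by simp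
    have "(\<integral>\<^sup>+t. ennreal ((a + \<xi> t) ^ 4) \<partial>std_normal_distribution) = ennreal (a ^ 4 + 12 * a\<^sup>2 + 32 * a + 60)"
      unfolding v[symmetric] by (subst nn_integral_eq_integral[OF i, symmetric]) (auto simp: e[symmetric])
    also have "\<dots> \<le> ennreal (a ^ 4 + (16 * a\<^sup>2 + 124))"
    proof (rule ennreal_leI)
      have "0 \<le> 4 * (a - 4)\<^sup>2" by simp
      also have "\<dots> = 4 * a\<^sup>2 - 32 * a + 64" by (simp add: power2_eq_square algebra_simps)
      finally show "a ^ 4 + 12 * a\<^sup>2 + 32 * a + 60 \<le> a ^ 4 + (16 * a\<^sup>2 + 124)" by simp
    qed
    also have "\<dots> = ennreal (a ^ 4) + (16 * ennreal (a\<^sup>2) + 124)"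
      by (simp add: ennreal_plus ennreal_mult)
    finally show ?thesis .
  qed
  have s2: "(\<integral>\<^sup>+x. ennreal ((\<Sum>i<r. \<xi> (x i))\<^sup>2) \<partial>gauss {..<r}) = ennreal (2 * real r)" for r
    using chi2_second_moment[of r] by (simp add: \<xi>_def sum_subtractf)
  have "(\<integral>\<^sup>+x. ennreal ((\<Sum>i<r. \<xi> (x i)) ^ 4) \<partial>gauss {..<r}) \<le> ennreal (140 * (real r)\<^sup>2)"
  proof (induction r)
    case (Suc r)
    have "(\<integral>\<^sup>+x. ennreal ((\<Sum>i<Suc r. \<xi> (x i)) ^ 4) \<partial>gauss {..<Suc r}) =
       (\<integral>\<^sup>+x. \<integral>\<^sup>+t. ennreal (((\<Sum>i<r. \<xi> (x i)) + \<xi> t) ^ 4) \<partial>std_normal_distribution \<partial>gauss {..<r})"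
      by (rule nn_integral_gauss_Suc[where \<phi>="\<lambda>s. ennreal (s ^ 4)"]) auto
    also have "\<dots> \<le> (\<integral>\<^sup>+x. ennreal ((\<Sum>i<r. \<xi> (x i)) ^ 4) + (16 * ennreal ((\<Sum>i<r. \<xi> (x i))\<^sup>2) + 124) \<partial>gauss {..<r})"
      by (intro nn_integral_mono pt)
    also have "\<dots> = (\<integral>\<^sup>+x. ennreal ((\<Sum>i<r. \<xi> (x i)) ^ 4) \<partial>gauss {..<r}) + (16 * ennreal (2 * real r) + 124)"
      by (subst nn_integral_add, measurable, measurable, subst nn_integral_add, measurable)
         (simp add: nn_integral_cmult s2)
    also have "\<dots> \<le> ennreal (140 * (real r)\<^sup>2) + (16 * ennreal (2 * real r) + 124)"
      by (intro add_mono Suc order_refl)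
    also have "\<dots> = ennreal (140 * (real r)\<^sup>2 + (16 * (2 * real r) + 124))"
      by (simp add: ennreal_plus ennreal_mult)
    also have "\<dots> \<le> ennreal (140 * (real (Suc r))\<^sup>2)"
      by (intro ennreal_leI) (simp add: power2_eq_square algebra_simps)
    finally show ?case .
  qed simp
  then show ?thesis by (simp add: \<xi>_def sum_subtractf)
qed

text \<open>For \<open>X\<close> the sum of the squares, \<open>(sqrt X - sqrt r)\<^sup>2\<close> is at most \<open>(X - r)\<^sup>2 / r\<close>, whose mean is 2.\<close>

lemma chi_lower:
  "ennreal (sqrt (real r)) \<le> (\<integral>\<^sup>+x. ennreal (sqrt (\<Sum>i<r. (x i)\<^sup>2)) \<partial>gauss {..<r}) + 3"
proof (cases "r = 0")
  case False
  define X where "X = (\<lambda>x :: nat \<Rightarrow> real. \<Sum>i<r. (x i)\<^sup>2)"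
  have [measurable]: "X \<in> borel_measurable (arrays {..<r})" unfolding X_def by measurable
  have X0: "X x \<ge> 0" for x by (simp add: X_def sum_nonneg)
  have p: "sqrt (real r) \<le> sqrt (X x) + (1 + (1 / real r) * (X x - real r)\<^sup>2)" for x
  proof -
    define d where "d = sqrt (real r) - sqrt (X x)"
    have "(X x - real r)\<^sup>2 = d\<^sup>2 * (sqrt (real r) + sqrt (X x))\<^sup>2"
      using X0[of x] by (simp add: d_def power_mult_distrib[symmetric] algebra_simps flip: power2_eq_square)
        (simp add: power2_commute)
    also have "\<dots> \<ge> d\<^sup>2 * (sqrt (real r))\<^sup>2"
      using X0[of x] by (intro mult_left_mono power_mono) auto
    finally have "d\<^sup>2 \<le> (1 / real r) * (X x - real r)\<^sup>2" using False by (simp add: field_simps)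
    moreover have "d \<le> 1 + d\<^sup>2"
    proof (cases "d \<le> 1")
      case False
      then have "d * 1 \<le> d * d" by (intro mult_left_mono) auto
      then show ?thesis by (simp add: power2_eq_square)
    qed (simp add: add_increasing2)
    ultimately show ?thesis unfolding d_def by linarith
  qed
  have "ennreal (sqrt (real r)) = (\<integral>\<^sup>+x. ennreal (sqrt (real r)) \<partial>gauss {..<r})" by (simp add:)
  also have "\<dots> \<le> (\<integral>\<^sup>+x. ennreal (sqrt (X x)) + (1 + ennreal (1 / real r) * ennreal ((X x - real r)\<^sup>2)) \<partial>gauss {..<r})"
  proof (rule nn_integral_mono)
    fix x
    have "ennreal (sqrt (real r)) \<le> ennreal (sqrt (X x) + (1 + (1 / real r) * (X x - real r)\<^sup>2))"
      by (rule ennreal_leI[OF p])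
    also have "\<dots> = ennreal (sqrt (X x)) + (1 + ennreal (1 / real r) * ennreal ((X x - real r)\<^sup>2))"
      using X0[of x] by (simp add: ennreal_plus ennreal_mult'[symmetric] del: times_divide_eq_left)
    finally show "ennreal (sqrt (real r)) \<le> ennreal (sqrt (X x)) + (1 + ennreal (1 / real r) * ennreal ((X x - real r)\<^sup>2))" .
  qed
  also have "\<dots> = (\<integral>\<^sup>+x. ennreal (sqrt (X x)) \<partial>gauss {..<r}) + (1 + ennreal (1 / real r) * (\<integral>\<^sup>+x. ennreal ((X x - real r)\<^sup>2) \<partial>gauss {..<r}))"
    by (simp add: nn_integral_add nn_integral_cmult)
  also have "(\<integral>\<^sup>+x. ennreal ((X x - real r)\<^sup>2) \<partial>gauss {..<r}) = ennreal (2 * real r)"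
    unfolding X_def by (rule chi2_second_moment)
  also have "ennreal (1 / real r) * ennreal (2 * real r) = 2" using False by (simp add: ennreal_mult'[symmetric])
  finally have "ennreal (sqrt (real r)) \<le> (\<integral>\<^sup>+x. ennreal (sqrt (X x)) \<partial>gauss {..<r}) + 3" by simp
  then show ?thesis by (simp add: X_def)
qed simp

section \<open>The largest singular value\<close>

text \<open>A single random variable that dominates the upward deviations of all bidiagonal entries at once.\<close>

definition excess :: "nat \<Rightarrow> nat \<Rightarrow> (nat \<times> nat \<Rightarrow> real) \<Rightarrow> real" where
  "excess m n x = (\<Sum>k<m + n. (max 0 (bidiag_sq k m n x - real (if even k then m else n))) ^ 4)"

lemma excess_nonneg: "0 \<le> excess m n x"
  by (simp add: excess_def sum_nonneg)

lemma measurable_excess [measurable]: "excess m n \<in> borel_measurable (arrays (idx m n))"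
  unfolding excess_def by measurable

lemma nn_integral_excess:
  "(\<integral>\<^sup>+x. ennreal (excess m n x) \<partial>gauss (idx m n)) \<le> ennreal (140 * (real (m + n)) ^ 3)"
proof -
  have *: "(\<integral>\<^sup>+x. ennreal ((max 0 (bidiag_sq k m n x - real (if even k then m else n))) ^ 4) \<partial>gauss (idx m n))
     \<le> ennreal (140 * (real (m + n))\<^sup>2)" for k
  proof -
    define N where "N = (if even k then m else n)"
    obtain r where r: "r \<le> N" "\<forall>\<phi>\<in>borel_measurable borel. (\<integral>\<^sup>+x. \<phi> (bidiag_sq k m n x) \<partial>gauss (idx m n)) =
        (\<integral>\<^sup>+x. (\<phi> (\<Sum>i<r. (x i)\<^sup>2) :: ennreal) \<partial>gauss {..<r})"
      using bidiag_sq_law[of k m n] unfolding N_def by auto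
    have "(\<lambda>t. ennreal ((max 0 (t - real N)) ^ 4)) \<in> borel_measurable borel" by measurable
    from bspec[OF r(2) this] have "(\<integral>\<^sup>+x. ennreal ((max 0 (bidiag_sq k m n x - real N)) ^ 4) \<partial>gauss (idx m n))
      = (\<integral>\<^sup>+x. ennreal ((max 0 ((\<Sum>i<r. (x i)\<^sup>2) - real N)) ^ 4) \<partial>gauss {..<r})"
      .
    also have "\<dots> \<le> (\<integral>\<^sup>+x. ennreal (((\<Sum>i<r. (x i)\<^sup>2) - real r) ^ 4) \<partial>gauss {..<r})"
    proof (intro nn_integral_mono ennreal_leI)
      fix x :: "nat \<Rightarrow> real"
      define s where "s = (\<Sum>i<r. (x i)\<^sup>2)"
      have "(max 0 (s - real N)) ^ 4 \<le> \<bar>s - real r\<bar> ^ 4" using r(1) by (intro power_mono) auto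
      then show "(max 0 ((\<Sum>i<r. (x i)\<^sup>2) - real N)) ^ 4 \<le> ((\<Sum>i<r. (x i)\<^sup>2) - real r) ^ 4"
        by (simp add: s_def power_even_abs)
    qed
    also have "\<dots> \<le> ennreal (140 * (real r)\<^sup>2)" by (rule chi2_fourth_moment)
    also have "\<dots> \<le> ennreal (140 * (real (m + n))\<^sup>2)"
      using r(1) by (intro ennreal_leI mult_left_mono power_mono) (auto simp: N_def split: if_splits)
    finally show ?thesis by (simp add: N_def)
  qed
  have "(\<integral>\<^sup>+x. ennreal (excess m n x) \<partial>gauss (idx m n)) =
     (\<Sum>k<m + n. \<integral>\<^sup>+x. ennreal ((max 0 (bidiag_sq k m n x - real (if even k then m else n))) ^ 4) \<partial>gauss (idx m n))"
    unfolding excess_def by (subst nn_integral_sum[symmetric]) (auto intro!: nn_integral_cong sum_ennreal[symmetric])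
  also have "\<dots> \<le> (\<Sum>k<m + n. ennreal (140 * (real (m + n))\<^sup>2))" by (intro sum_mono *)
  also have "\<dots> = ennreal (140 * (real (m + n)) ^ 3)"
  proof -
    define N where "N = real (m + n)"
    have "(\<Sum>k<m + n. ennreal (140 * N\<^sup>2)) = ennreal N * ennreal (140 * N\<^sup>2)"
      by (simp only: sum_constant card_lessThan ennreal_of_nat_eq_real_of_nat N_def)
    also have "\<dots> = ennreal (N * (140 * N\<^sup>2))" by (rule ennreal_mult'[symmetric]) (simp add: N_def)
    also have "N * (140 * N\<^sup>2) = 140 * N ^ 3" by (simp add: power2_eq_square power3_eq_cube)
    finally show ?thesis by (simp only: N_def)
  qed
  finally show ?thesis .
qed

text \<open>Any \<open>u \<ge> 0\<close> satisfies \<open>u \<le> t + u ^ 4 / t ^ 3\<close>.\<close>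

lemma bidiag_sq_le_excess:
  assumes "k < m + n" "t > 0"
  shows "bidiag_sq k m n x \<le> real (if even k then m else n) + (t + excess m n x / t ^ 3)"
proof -
  define u where "u = max 0 (bidiag_sq k m n x - real (if even k then m else n))"
  have "u ^ 4 \<le> excess m n x" unfolding u_def excess_def
    using assms by (intro member_le_sum[where f="\<lambda>k. (max 0 (bidiag_sq k m n x - real (if even k then m else n))) ^ 4"]) auto
  then have "u ^ 4 / t ^ 3 \<le> excess m n x / t ^ 3" using assms by (intro divide_right_mono) auto
  moreover have "u \<le> t + u ^ 4 / t ^ 3"
  proof (cases "u \<le> t")
    case True
    moreover have "0 \<le> u ^ 4 / t ^ 3" using assms by auto
    ultimately show ?thesis by linarith
  next
    case False
    then have "u * t ^ 3 \<le> u * u ^ 3" using assms by (intro mult_left_mono power_mono) auto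
    then have "u \<le> u ^ 4 / t ^ 3" using assms by (simp add: field_simps eval_nat_numeral)
    then show ?thesis using assms by linarith
  qed
  ultimately show ?thesis unfolding u_def by linarith
qed

definition top_upper :: "real \<Rightarrow> nat \<Rightarrow> nat \<Rightarrow> (nat \<times> nat \<Rightarrow> real) \<Rightarrow> real" where
  "top_upper t m n x = (sqrt (real m) + sqrt (real n))\<^sup>2 +
     (2 + sqrt (real n / real m) + sqrt (real m / real n)) * (t + excess m n x / t ^ 3)"

lemma measurable_top_upper [measurable]: "top_upper t m n \<in> borel_measurable (arrays (idx m n))"
  unfolding top_upper_def by measurable

text \<open>With \<open>e = t + excess / t ^ 3\<close>, the diagonals are bounded by \<open>A = sqrt (m + e)\<close> and
\<open>B = sqrt (n + e)\<close>.  The mixed term of \<open>(A + B)\<^sup>2\<close> is split by a weighted inequality between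
arithmetic and geometric mean, with the weights that are exact for \<open>e = 0\<close>, so that the bound
becomes linear in \<open>e\<close> and its expectation is easy to compute.\<close>

lemma bil_top_upper:
  assumes "t > 0" "m > 0" "n > 0"
  shows "bil m n x u y \<le> sqrt (top_upper t m n x) * L2_set u {..<m} * L2_set y {..<n}"
proof -
  define e where "e = t + excess m n x / t ^ 3"
  have e0: "e \<ge> 0" using assms by (auto simp: e_def excess_nonneg)
  define A B where "A = sqrt (real m + e)" and "B = sqrt (real n + e)"
  have AB: "A\<^sup>2 = real m + e" "B\<^sup>2 = real n + e" "A \<ge> 0" "B \<ge> 0" using e0 by (auto simp: A_def B_def)
  have "bil m n x u y \<le> (A + B) * L2_set u {..<m} * L2_set y {..<n}"
  proof (rule bil_upper)
    fix k assume "k < m + n"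
    from bidiag_sq_le_excess[OF this assms(1), of x] show "bidiag_sq k m n x \<le> (if even k then A\<^sup>2 else B\<^sup>2)"
      unfolding AB e_def by (cases "even k") simp_all
  qed (use AB in auto)
  moreover have "A + B \<le> sqrt (top_upper t m n x)"
  proof (rule real_le_rsqrt)
    define a b where "a = sqrt (real m)" and "b = sqrt (real n)"
    have ab: "a > 0" "b > 0" "a\<^sup>2 = real m" "b\<^sup>2 = real n" using assms by (auto simp: a_def b_def)
    have "0 \<le> (b * A - a * B)\<^sup>2 / (a * b)" using ab by auto
    also have "\<dots> = b / a * A\<^sup>2 + a / b * B\<^sup>2 - 2 * A * B"
      using ab by (simp add: power2_eq_square field_simps)
    finally have "(A + B)\<^sup>2 \<le> (1 + b / a) * A\<^sup>2 + (1 + a / b) * B\<^sup>2"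
      by (simp add: power2_sum algebra_simps)
    also have "\<dots> = (1 + b / a) * a\<^sup>2 + (1 + a / b) * b\<^sup>2 + (2 + b / a + a / b) * e"
      unfolding AB ab by (simp add: algebra_simps)
    also have "(1 + b / a) * a\<^sup>2 + (1 + a / b) * b\<^sup>2 = (a + b)\<^sup>2"
      using ab(1,2) by (simp add: power2_eq_square field_simps)
    finally show "(A + B)\<^sup>2 \<le> top_upper t m n x"
      by (simp add: top_upper_def a_def b_def e_def real_sqrt_divide)
  qed
  ultimately show ?thesis
    by (elim order_trans) (intro mult_right_mono, auto)
qed

lemma nn_integral_top_upper:
  assumes "t > 0"
  shows "(\<integral>\<^sup>+x. ennreal (top_upper t m n x) \<partial>gauss (idx m n)) \<le>
    ennreal ((sqrt (real m) + sqrt (real n))\<^sup>2 +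
     (2 + sqrt (real n / real m) + sqrt (real m / real n)) * (t + 140 * (real (m + n)) ^ 3 / t ^ 3))"
proof -
  define c where "c = 2 + sqrt (real n / real m) + sqrt (real m / real n)"
  have c: "c \<ge> 0" by (simp add: c_def)
  define a where "a = (sqrt (real m) + sqrt (real n))\<^sup>2 + c * t"
  have a: "a \<ge> 0" using assms c by (simp add: a_def)
  have "(\<integral>\<^sup>+x. ennreal (top_upper t m n x) \<partial>gauss (idx m n)) =
    (\<integral>\<^sup>+x. ennreal a + ennreal (c / t ^ 3) * ennreal (excess m n x) \<partial>gauss (idx m n))"
  proof (rule nn_integral_cong)
    fix x
    have "top_upper t m n x = a + c / t ^ 3 * excess m n x"
      by (simp add: top_upper_def a_def c_def algebra_simps add_divide_distrib)
    then show "ennreal (top_upper t m n x) = ennreal a + ennreal (c / t ^ 3) * ennreal (excess m n x)"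
      using a c assms excess_nonneg[of m n x] by (simp add: ennreal_plus ennreal_mult'[symmetric] del: times_divide_eq_left)
  qed
  also have "\<dots> = ennreal a + ennreal (c / t ^ 3) * (\<integral>\<^sup>+x. ennreal (excess m n x) \<partial>gauss (idx m n))"
    by (subst nn_integral_add) (auto simp: nn_integral_cmult)
  also have "\<dots> \<le> ennreal a + ennreal (c / t ^ 3) * ennreal (140 * (real (m + n)) ^ 3)"
    by (intro add_left_mono mult_left_mono nn_integral_excess) auto
  also have "\<dots> = ennreal (a + c / t ^ 3 * (140 * (real (m + n)) ^ 3))"
    using a c assms by (simp add: ennreal_plus ennreal_mult'[symmetric] del: times_divide_eq_left)
  also have "a + c / t ^ 3 * (140 * (real (m + n)) ^ 3) = (sqrt (real m) + sqrt (real n))\<^sup>2 + c * (t + 140 * (real (m + n)) ^ 3 / t ^ 3)"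
    by (simp add: a_def algebra_simps)
  finally show ?thesis by (simp add: c_def)
qed

definition top_lower :: "nat \<Rightarrow> nat \<Rightarrow> nat \<Rightarrow> (nat \<times> nat \<Rightarrow> real) \<Rightarrow> real" where
  "top_lower j m n x = (\<Sum>i<2 * j. sqrt (bidiag_sq i m n x)) / sqrt (real j * real (j + 1))"

lemma measurable_top_lower [measurable]: "top_lower j m n \<in> borel_measurable (arrays (idx m n))"
  unfolding top_lower_def by measurable

lemma bil_top_lower:
  assumes "2 * j < m" "2 * j < n" "j > 0"
  shows "\<exists>u y. L2_set u {..<m} > 0 \<and> L2_set y {..<n} > 0 \<and>
    bil m n x u y = top_lower j m n x * L2_set u {..<m} * L2_set y {..<n}"
proof -
  obtain u y where uy: "(L2_set u {..<m})\<^sup>2 = real ((2 * j + 1) div 2)" "(L2_set y {..<n})\<^sup>2 = real (2 * j div 2 + 1)"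
     "bil m n x u y = (\<Sum>i<2 * j. sqrt (bidiag_sq i m n x))"
    using bil_lower[OF assms(1,2), of x] by blast
  have "L2_set u {..<m} = sqrt (real j)" "L2_set y {..<n} = sqrt (real (j + 1))"
    using uy(1,2) by (auto simp: real_sqrt_unique L2_set_nonneg)
  then show ?thesis using uy(3) assms
    by (intro exI[of _ u] exI[of _ y]) (auto simp: top_lower_def real_sqrt_mult)
qed

lemma nn_integral_top_lower:
  assumes j: "2 * j < m" "2 * j < n" "j > 0"
  shows "ennreal (sqrt (real j / real (j + 1)) * (sqrt (real (m - 2 * j)) + sqrt (real (n - 2 * j)))) \<le>
    (\<integral>\<^sup>+x. ennreal (top_lower j m n x) \<partial>gauss (idx m n)) + 6 * ennreal (sqrt (real j / real (j + 1)))"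
proof -
  have 1: "ennreal (sqrt (real ((if even k then m else n) - 2 * j))) \<le>
     (\<integral>\<^sup>+x. ennreal (sqrt (bidiag_sq k m n x)) \<partial>gauss (idx m n)) + 3" if k: "k < 2 * j" for k
  proof -
    obtain r where r: "(if even k then m else n) - k \<le> r"
        "\<forall>\<phi>\<in>borel_measurable borel. (\<integral>\<^sup>+x. \<phi> (bidiag_sq k m n x) \<partial>gauss (idx m n)) =
        (\<integral>\<^sup>+x. (\<phi> (\<Sum>i<r. (x i)\<^sup>2) :: ennreal) \<partial>gauss {..<r})"
      using bidiag_sq_law[of k m n] j k by auto
    have "ennreal (sqrt (real ((if even k then m else n) - 2 * j))) \<le> ennreal (sqrt (real r))"
      using r(1) k by (intro ennreal_leI) auto
    also have "\<dots> \<le> (\<integral>\<^sup>+x. ennreal (sqrt (\<Sum>i<r. (x i)\<^sup>2)) \<partial>gauss {..<r}) + 3" by (rule chi_lower)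
    also have "(\<integral>\<^sup>+x. ennreal (sqrt (\<Sum>i<r. (x i)\<^sup>2)) \<partial>gauss {..<r}) = (\<integral>\<^sup>+x. ennreal (sqrt (bidiag_sq k m n x)) \<partial>gauss (idx m n))"
      by (rule bspec[OF r(2), symmetric, of "\<lambda>t. ennreal (sqrt t)"]) measurable
    finally show ?thesis .
  qed
  define a b where "a = sqrt (real (m - 2 * j))" and "b = sqrt (real (n - 2 * j))"
  have sum2: "(\<Sum>k<2 * J. if even k then a else b) = real J * (a + b)" for J
    by (induction J) (auto simp: algebra_simps)
  have "ennreal (real j * (a + b)) = ennreal (\<Sum>k<2 * j. if even k then a else b)" by (simp only: sum2)
  also have "\<dots> = (\<Sum>k<2 * j. ennreal (if even k then a else b))"
    by (intro sum_ennreal[symmetric]) (auto simp: a_def b_def)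
  also have "\<dots> \<le> (\<Sum>k<2 * j. (\<integral>\<^sup>+x. ennreal (sqrt (bidiag_sq k m n x)) \<partial>gauss (idx m n)) + 3)"
  proof (intro sum_mono)
    fix k assume "k \<in> {..<2 * j}"
    then show "ennreal (if even k then a else b) \<le> (\<integral>\<^sup>+x. ennreal (sqrt (bidiag_sq k m n x)) \<partial>gauss (idx m n)) + 3"
      using 1[of k] by (auto simp: a_def b_def split: if_splits)
  qed
  also have "\<dots> = (\<integral>\<^sup>+x. (\<Sum>k<2 * j. ennreal (sqrt (bidiag_sq k m n x))) \<partial>gauss (idx m n)) + 6 * ennreal (real j)"
    by (subst nn_integral_sum) (auto simp: sum.distrib ennreal_of_nat_eq_real_of_nat ennreal_mult mult.commute mult.left_commute)
  also have "\<dots> = (\<integral>\<^sup>+x. ennreal (\<Sum>k<2 * j. sqrt (bidiag_sq k m n x)) \<partial>gauss (idx m n)) + 6 * ennreal (real j)"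
    by (simp add: sum_ennreal bidiag_sq_nonneg)
  finally have 2: "ennreal (real j * (a + b)) \<le> (\<integral>\<^sup>+x. ennreal (\<Sum>k<2 * j. sqrt (bidiag_sq k m n x)) \<partial>gauss (idx m n)) + 6 * ennreal (real j)" .
  define c where "c = 1 / sqrt (real j * real (j + 1))"
  have c: "c \<ge> 0" by (simp add: c_def)
  have cj: "c * real j = sqrt (real j / real (j + 1))"
  proof -
    have "c * real j = (real j / sqrt (real j)) / sqrt (real (j + 1))" by (simp add: c_def real_sqrt_mult)
    also have "real j / sqrt (real j) = sqrt (real j)" by (rule real_div_sqrt) simp
    finally show ?thesis by (simp add: real_sqrt_divide)
  qed
  have "ennreal (c * real j * (a + b)) = ennreal c * ennreal (real j * (a + b))"
    using c by (simp add: ennreal_mult'[symmetric] mult.assoc)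
  also have "\<dots> \<le> ennreal c * ((\<integral>\<^sup>+x. ennreal (\<Sum>k<2 * j. sqrt (bidiag_sq k m n x)) \<partial>gauss (idx m n)) + 6 * ennreal (real j))"
    by (intro mult_left_mono 2) auto
  also have "\<dots> = (\<integral>\<^sup>+x. ennreal c * ennreal (\<Sum>k<2 * j. sqrt (bidiag_sq k m n x)) \<partial>gauss (idx m n)) + 6 * ennreal (c * real j)"
    using c by (subst nn_integral_cmult) (auto simp: distrib_left ennreal_mult mult.left_commute)
  also have "(\<lambda>x. ennreal c * ennreal (\<Sum>k<2 * j. sqrt (bidiag_sq k m n x))) = (\<lambda>x. ennreal (top_lower j m n x))"
    using c by (auto simp: ennreal_mult'[symmetric] top_lower_def c_def)
  finally show ?thesis unfolding cj a_def b_def .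
qed

section \<open>Haar measure on the orthogonal group\<close>

lemma orth_right:
  assumes "finite A" "finite B" "orth B V"
  shows "orth (A \<times> B) (\<lambda>p q. of_bool (fst p = fst q) * V (snd p) (snd q))"
  unfolding orth_def
proof (intro ballI)
  fix p q assume pq: "p \<in> A \<times> B" "q \<in> A \<times> B"
  have "(\<Sum>r\<in>A \<times> B. of_bool (fst r = fst p) * V (snd r) (snd p) * (of_bool (fst r = fst q) * V (snd r) (snd q)))
    = (\<Sum>a\<in>A. \<Sum>b\<in>B. if a = fst p then V b (snd p) * V b (snd q) * of_bool (fst p = fst q) else 0)"
    by (subst sum.cartesian_product) (auto intro!: sum.cong)
  also have "\<dots> = (\<Sum>b\<in>B. \<Sum>a\<in>A. if a = fst p then V b (snd p) * V b (snd q) * of_bool (fst p = fst q) else 0)"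
    by (rule sum.swap)
  also have "\<dots> = (\<Sum>b\<in>B. V b (snd p) * V b (snd q)) * of_bool (fst p = fst q)"
    using pq assms by (simp add: sum_distrib_right mem_Times_iff)
  also have "\<dots> = (if p = q then 1 else 0)"
    using assms(3) pq by (auto simp: orth_def prod_eq_iff)
  finally show "(\<Sum>r\<in>A \<times> B. of_bool (fst r = fst p) * V (snd r) (snd p) * (of_bool (fst r = fst q) * V (snd r) (snd q))) = (if p = q then 1 else 0)" .
qed

lemma lin_right:
  assumes "finite A" "finite B" "i \<in> A" "j \<in> B"
  shows "lin (A \<times> B) (\<lambda>p q. of_bool (fst p = fst q) * V (snd p) (snd q)) x (i, j) = (\<Sum>l\<in>B. V j l * x (i, l))"
proof -
  have "lin (A \<times> B) (\<lambda>p q. of_bool (fst p = fst q) * V (snd p) (snd q)) x (i, j)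
    = (\<Sum>k\<in>A. \<Sum>l\<in>B. if k = i then V j l * x (k, l) else 0)"
    using assms by (subst sum.cartesian_product) (auto intro!: sum.cong simp: lin_def)
  also have "\<dots> = (\<Sum>l\<in>B. \<Sum>k\<in>A. if k = i then V j l * x (k, l) else 0)" by (rule sum.swap)
  finally show ?thesis using assms by simp
qed

lemma orth_transpose:
  fixes n :: nat
  assumes "orth {..<n} T"
  shows "orth {..<n} (\<lambda>i j. T j i)"
proof -
  define A where "A = Matrix.mat n n (\<lambda>(i, j). T i j)"
  have A: "A \<in> carrier_mat n n" by (simp add: A_def)
  have "transpose_mat A * A = 1\<^sub>m n"
  proof (rule eq_matI)
    fix i j assume "i < dim_row (1\<^sub>m n :: real mat)" "j < dim_col (1\<^sub>m n :: real mat)"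
    then have ij: "i < n" "j < n" by auto
    then have "(transpose_mat A * A) $$ (i, j) = (\<Sum>r<n. T r i * T r j)"
      by (simp add: A_def scalar_prod_def atLeast0LessThan)
    also have "\<dots> = (1\<^sub>m n) $$ (i, j)" using assms ij by (auto simp: orth_def)
    finally show "(transpose_mat A * A) $$ (i, j) = (1\<^sub>m n) $$ (i, j)" .
  qed (auto simp: A_def)
  then have I: "A * transpose_mat A = 1\<^sub>m n"
    using A by (intro mat_mult_left_right_inverse[of "transpose_mat A" n A]) auto
  show ?thesis unfolding orth_def
  proof (intro ballI)
    fix i j assume ij: "i \<in> {..<n}" "j \<in> {..<n}"
    then have "(\<Sum>r<n. T i r * T j r) = (A * transpose_mat A) $$ (i, j)"
      by (simp add: A_def scalar_prod_def atLeast0LessThan)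
    then show "(\<Sum>r<n. T i r * T j r) = (if i = j then 1 else 0)" using ij I by simp
  qed
qed

definition dot :: "nat \<Rightarrow> (nat \<Rightarrow> real) \<Rightarrow> (nat \<Rightarrow> real) \<Rightarrow> real" where
  "dot n u v = (\<Sum>i<n. u i * v i)"

lemma dot_cong: "(\<And>i. i < n \<Longrightarrow> u i = u' i) \<Longrightarrow> (\<And>i. i < n \<Longrightarrow> v i = v' i) \<Longrightarrow> dot n u v = dot n u' v'"
  by (auto simp: dot_def intro!: sum.cong)

lemma dot_commute: "dot n u v = dot n v u"
  by (simp add: dot_def mult.commute)

declare sum.cong [fundef_cong]

text \<open>Gram-Schmidt orthonormalisation of the rows.  Applied to a Gaussian matrix it yields a Haar
distributed orthogonal matrix.\<close>

fun gram_schmidt :: "nat \<Rightarrow> (nat \<times> nat \<Rightarrow> real) \<Rightarrow> nat \<Rightarrow> nat \<Rightarrow> real" where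
  "gram_schmidt n g k = (let r = (\<lambda>j. g (k, j) - (\<Sum>l<k. dot n (\<lambda>i. g (k, i)) (gram_schmidt n g l) * gram_schmidt n g l j))
     in (\<lambda>j. r j / sqrt (dot n r r)))"

declare gram_schmidt.simps [simp del]

definition gs_residual :: "nat \<Rightarrow> (nat \<times> nat \<Rightarrow> real) \<Rightarrow> nat \<Rightarrow> nat \<Rightarrow> real" where
  "gs_residual n g k j = g (k, j) - (\<Sum>l<k. dot n (\<lambda>i. g (k, i)) (gram_schmidt n g l) * gram_schmidt n g l j)"

lemma gram_schmidt_eq: "gram_schmidt n g k j = gs_residual n g k j / sqrt (dot n (gs_residual n g k) (gs_residual n g k))"
  by (subst gram_schmidt.simps) (simp add: Let_def gs_residual_def[abs_def])

definition gs_nondegenerate :: "nat \<Rightarrow> (nat \<times> nat \<Rightarrow> real) \<Rightarrow> nat \<Rightarrow> bool" where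
  "gs_nondegenerate n g k \<longleftrightarrow> dot n (gs_residual n g k) (gs_residual n g k) \<noteq> 0"

lemma dot_self_nonneg: "dot n u u \<ge> 0"
  by (simp add: dot_def sum_nonneg)

lemma gram_schmidt_orthonormal:
  assumes "\<And>l. l < K \<Longrightarrow> gs_nondegenerate n g l" "k < K" "l < K"
  shows "dot n (gram_schmidt n g k) (gram_schmidt n g l) = (if k = l then 1 else 0)"
proof -
  have lower: "l < k \<Longrightarrow> dot n (gram_schmidt n g k) (gram_schmidt n g l) = 0" if "k < K" for k l
    using that
  proof (induction k arbitrary: l rule: less_induct)
    case (less k)
    have self: "dot n (gram_schmidt n g l) (gram_schmidt n g l) = 1" if "l < K" for l
    proof -
      define s where "s = dot n (gs_residual n g l) (gs_residual n g l)"
      have s: "s > 0" using assms(1)[OF that] dot_self_nonneg[of n "gs_residual n g l"] by (auto simp: gs_nondegenerate_def s_def)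
      have "dot n (gram_schmidt n g l) (gram_schmidt n g l) = (\<Sum>i<n. gs_residual n g l i * gs_residual n g l i / (sqrt s * sqrt s))"
        by (simp add: dot_def[of n "gram_schmidt n g l"] gram_schmidt_eq s_def)
      also have "\<dots> = s / (sqrt s * sqrt s)" by (simp add: sum_divide_distrib[symmetric] s_def dot_def)
      finally show ?thesis using s by simp
    qed
    have ih: "dot n (gram_schmidt n g l') (gram_schmidt n g l) = (if l' = l then 1 else 0)" if "l' < k" for l'
      using less.IH[of l' l] less.IH[of l l'] self[of l] that less.prems dot_commute[of n "gram_schmidt n g l'" "gram_schmidt n g l"]
      by (cases l' l rule: linorder_cases) auto
    have "dot n (gs_residual n g k) (gram_schmidt n g l) = dot n (\<lambda>i. g (k, i)) (gram_schmidt n g l) -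
        (\<Sum>l'<k. dot n (\<lambda>i. g (k, i)) (gram_schmidt n g l') * dot n (gram_schmidt n g l') (gram_schmidt n g l))"
      unfolding dot_def[of n "gs_residual n g k"] gs_residual_def
      apply (simp add: left_diff_distrib sum_subtractf sum_distrib_right)
      apply (subst sum.swap)
      apply (simp add: dot_def sum_distrib_left mult.assoc)
      done
    also have "(\<Sum>l'<k. dot n (\<lambda>i. g (k, i)) (gram_schmidt n g l') * dot n (gram_schmidt n g l') (gram_schmidt n g l)) =
        (\<Sum>l'<k. if l' = l then dot n (\<lambda>i. g (k, i)) (gram_schmidt n g l') else 0)"
      by (intro sum.cong) (auto simp: ih)
    finally have z: "dot n (gs_residual n g k) (gram_schmidt n g l) = 0" using less.prems by simp
    have "dot n (gram_schmidt n g k) (gram_schmidt n g l) = dot n (gs_residual n g k) (gram_schmidt n g l) / sqrt (dot n (gs_residual n g k) (gs_residual n g k))"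
      unfolding dot_def[of n "gram_schmidt n g k"] dot_def[of n "gs_residual n g k" "gram_schmidt n g l"]
      by (simp add: gram_schmidt_eq[of n g k] sum_divide_distrib)
    then show ?case using z by simp
  qed
  show ?thesis
  proof (cases k l rule: linorder_cases)
    case equal
    define s where "s = dot n (gs_residual n g l) (gs_residual n g l)"
    have s: "s > 0" using assms(1)[OF assms(3)] dot_self_nonneg[of n "gs_residual n g l"] by (auto simp: gs_nondegenerate_def s_def)
    have "dot n (gram_schmidt n g l) (gram_schmidt n g l) = (\<Sum>i<n. gs_residual n g l i * gs_residual n g l i / (sqrt s * sqrt s))"
      by (simp add: dot_def[of n "gram_schmidt n g l"] gram_schmidt_eq s_def)
    also have "\<dots> = s / (sqrt s * sqrt s)" by (simp add: sum_divide_distrib[symmetric] s_def dot_def)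
    finally show ?thesis using s equal by simp
  qed (use lower[of l k] lower[of k l] assms dot_commute[of n "gram_schmidt n g k" "gram_schmidt n g l"] in auto)
qed

text \<open>Gram-Schmidt uses inner products only, so it commutes with rotations applied to all rows.  This is
the source of the invariance of the Haar measure.\<close>

lemma gram_schmidt_rotate:
  assumes V: "orth {..<n} V" and g': "\<And>k j. k < n \<Longrightarrow> j < n \<Longrightarrow> g' (k, j) = (\<Sum>l<n. V j l * g (k, l))"
  shows "k < n \<Longrightarrow> j < n \<Longrightarrow> gram_schmidt n g' k j = (\<Sum>l<n. V j l * gram_schmidt n g k l)"
proof (induction k arbitrary: j rule: less_induct)
  case (less k)
  have ipV: "dot n (\<lambda>j. \<Sum>l<n. V j l * u l) (\<lambda>j. \<Sum>l<n. V j l * v l) = dot n u v" for u v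
    unfolding dot_def by (rule orth_inner) (use V in auto)
  have ip1: "dot n (\<lambda>i. g' (k, i)) (gram_schmidt n g' l) = dot n (\<lambda>i. g (k, i)) (gram_schmidt n g l)" if "l < k" for l
  proof -
    have "dot n (\<lambda>i. g' (k, i)) (gram_schmidt n g' l) = dot n (\<lambda>j. \<Sum>i<n. V j i * g (k, i)) (\<lambda>j. \<Sum>i<n. V j i * gram_schmidt n g l i)"
      using less that by (intro dot_cong g') auto
    then show ?thesis by (simp add: ipV)
  qed
  have res: "gs_residual n g' k j = (\<Sum>l<n. V j l * gs_residual n g k l)" if j: "j < n" for j
  proof -
    have "gs_residual n g' k j = (\<Sum>l<n. V j l * g (k, l)) - (\<Sum>l<k. dot n (\<lambda>i. g (k, i)) (gram_schmidt n g l) * (\<Sum>i<n. V j i * gram_schmidt n g l i))"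
      using less j by (simp add: gs_residual_def g' ip1)
    also have "(\<Sum>l<k. dot n (\<lambda>i. g (k, i)) (gram_schmidt n g l) * (\<Sum>i<n. V j i * gram_schmidt n g l i)) =
       (\<Sum>i<n. V j i * (\<Sum>l<k. dot n (\<lambda>i. g (k, i)) (gram_schmidt n g l) * gram_schmidt n g l i))"
      unfolding sum_distrib_left by (subst sum.swap) (simp add: mult_ac)
    finally show ?thesis by (simp add: gs_residual_def right_diff_distrib sum_subtractf)
  qed
  have "dot n (gs_residual n g' k) (gs_residual n g' k) = dot n (\<lambda>j. \<Sum>l<n. V j l * gs_residual n g k l) (\<lambda>j. \<Sum>l<n. V j l * gs_residual n g k l)"
    by (intro dot_cong res)
  then have "dot n (gs_residual n g' k) (gs_residual n g' k) = dot n (gs_residual n g k) (gs_residual n g k)" by (simp add: ipV)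
  then show ?case using less.prems by (simp add: gram_schmidt_eq res sum_divide_distrib)
qed

lemma measurable_gram_schmidt [measurable]: "(\<lambda>g. gram_schmidt n g k j) \<in> borel_measurable (arrays I)"
proof (induction k arbitrary: j rule: less_induct)
  case (less k)
  have [measurable]: "(\<lambda>g. gram_schmidt n g l j) \<in> borel_measurable (arrays I)" if "l \<in> {..<k}" for l j
    using less that by auto
  have [measurable]: "(\<lambda>g. gs_residual n g k j) \<in> borel_measurable (arrays I)" for j
    unfolding gs_residual_def dot_def by measurable
  show ?case unfolding gram_schmidt_eq dot_def by measurable
qed

lemma measurable_gs_residual [measurable]: "(\<lambda>g. gs_residual n g k j) \<in> borel_measurable (arrays I)"
  unfolding gs_residual_def dot_def by measurable

lemma gram_schmidt_upd: "l < k \<Longrightarrow> gram_schmidt n (g((k, i) := t)) l = gram_schmidt n g l"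
proof (induction l rule: less_induct)
  case (less l)
  have e: "gram_schmidt n (g((k, i) := t)) l' = gram_schmidt n g l'" if "l' < l" for l'
    using less.IH[OF that] less.prems that by (simp del: fun_upd_apply)
  have "gs_residual n (g((k, i) := t)) l j = gs_residual n g l j" for j
    unfolding gs_residual_def using less.prems
    by (intro arg_cong2[where f="(-)"] sum.cong refl) (simp_all add: e)
  then have "gs_residual n (g((k, i) := t)) l = gs_residual n g l" by (rule ext)
  then show ?case by (intro ext) (simp only: gram_schmidt_eq)
qed

text \<open>The residual of row \<open>k\<close> in coordinate \<open>i\<close> is an affine function of the entry \<open>g (k, i)\<close> whose slope
is 1 minus the sum of the squares of the \<open>i\<close>-th coordinates of the previous \<open>k\<close> unit vectors.  These
slopes add up to \<open>n - k > 0\<close>, so one of them is nonzero, and the residual vanishes at most for one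
value of that entry.\<close>

lemma AE_gs_nondegenerate: "AE g in gauss (idx n n). \<forall>k<n. gs_nondegenerate n g k"
proof -
  have "AE g in gauss (idx n n). gs_residual n g k i \<noteq> 0 \<or> 1 - (\<Sum>l<k. (gram_schmidt n g l i)\<^sup>2) = 0" if ki: "k < n" "i < n" for k i
  proof (rule AE_gauss_coord[of _ "(k, i)"])
    fix x a b
    assume a: "\<not> (gs_residual n (x((k, i) := a)) k i \<noteq> 0 \<or> 1 - (\<Sum>l<k. (gram_schmidt n (x((k, i) := a)) l i)\<^sup>2) = 0)"
      and b: "\<not> (gs_residual n (x((k, i) := b)) k i \<noteq> 0 \<or> 1 - (\<Sum>l<k. (gram_schmidt n (x((k, i) := b)) l i)\<^sup>2) = 0)"
    define v where "v = 1 - (\<Sum>l<k. (gram_schmidt n x l i)\<^sup>2)"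
    define c where "c = (\<Sum>l<k. (dot n (\<lambda>j. (x((k, i) := 0)) (k, j)) (gram_schmidt n x l)) * gram_schmidt n x l i)"
    have "gs_residual n (x((k, i) := t)) k i = v * t - c" for t
    proof -
      have "dot n (\<lambda>j. (x((k, i) := t)) (k, j)) u = dot n (\<lambda>j. (x((k, i) := 0)) (k, j)) u + t * u i" for u
      proof -
        have "dot n (\<lambda>j. (x((k, i) := t)) (k, j)) u = (\<Sum>j<n. (x((k, i) := 0)) (k, j) * u j + (if j = i then t * u j else 0))"
          unfolding dot_def by (intro sum.cong) auto
        then show ?thesis using ki by (simp only: sum.distrib dot_def) simp
      qed
      then have "gs_residual n (x((k, i) := t)) k i = t - (\<Sum>l<k. (dot n (\<lambda>j. (x((k, i) := 0)) (k, j)) (gram_schmidt n x l) + t * gram_schmidt n x l i) * gram_schmidt n x l i)"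
        by (simp only: gs_residual_def) (simp add: gram_schmidt_upd)
      also have "\<dots> = t - (c + t * (\<Sum>l<k. (gram_schmidt n x l i)\<^sup>2))"
        by (simp add: c_def sum.distrib sum_distrib_left power2_eq_square algebra_simps)
      finally show ?thesis by (simp add: v_def algebra_simps)
    qed
    moreover have "v \<noteq> 0" using a by (simp add: gram_schmidt_upd v_def)
    ultimately have "v * a = v * b" "v \<noteq> 0" using a b by auto
    then show "a = b" by simp
  qed (use ki in auto)
  then have "AE g in gauss (idx n n). \<forall>k\<in>{..<n}. \<forall>i\<in>{..<n}. gs_residual n g k i \<noteq> 0 \<or> 1 - (\<Sum>l<k. (gram_schmidt n g l i)\<^sup>2) = 0"
    by (intro AE_finite_allI) auto
  then show ?thesis
  proof eventually_elim
    case (elim g)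
    have "gs_nondegenerate n g k" if "k < n" for k
      using that
    proof (induction k rule: less_induct)
      case (less k)
      have "(\<Sum>i<n. 1 - (\<Sum>l<k. (gram_schmidt n g l i)\<^sup>2)) = real n - (\<Sum>l<k. \<Sum>i<n. (gram_schmidt n g l i)\<^sup>2)"
        by (simp add: sum_subtractf) (rule sum.swap)
      also have "(\<Sum>l<k. \<Sum>i<n. (gram_schmidt n g l i)\<^sup>2) = (\<Sum>l<k. 1)"
        using gram_schmidt_orthonormal[of k n g] less by (intro sum.cong) (auto simp: dot_def power2_eq_square)
      finally have "(\<Sum>i<n. 1 - (\<Sum>l<k. (gram_schmidt n g l i)\<^sup>2)) \<noteq> 0" using less by simp
      then obtain i where i: "i < n" "1 - (\<Sum>l<k. (gram_schmidt n g l i)\<^sup>2) \<noteq> 0"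
        by (meson lessThan_iff sum.neutral)
      then have "gs_residual n g k i \<noteq> 0" using elim less.prems by auto
      then have "0 < gs_residual n g k i * gs_residual n g k i" by (metis not_real_square_gt_zero)
      also have "\<dots> \<le> dot n (gs_residual n g k) (gs_residual n g k)"
        unfolding dot_def using i by (intro member_le_sum[where f="\<lambda>i. gs_residual n g k i * gs_residual n g k i"]) auto
      finally show ?case by (simp add: gs_nondegenerate_def)
    qed
    then show ?case by blast
  qed
qed

definition gram_schmidt_array :: "nat \<Rightarrow> (nat \<times> nat \<Rightarrow> real) \<Rightarrow> nat \<times> nat \<Rightarrow> real" where
  "gram_schmidt_array n g = (\<lambda>p\<in>idx n n. gram_schmidt n g (fst p) (snd p))"

lemma measurable_gram_schmidt_array [measurable]:
  "gram_schmidt_array n \<in> measurable (arrays (idx n n)) (arrays (idx n n))"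
  unfolding gram_schmidt_array_def by measurable

definition haar :: "nat \<Rightarrow> (nat \<times> nat \<Rightarrow> real) measure" where
  "haar n = distr (gauss (idx n n)) (arrays (idx n n)) (gram_schmidt_array n)"

definition mul_transpose :: "nat \<Rightarrow> nat \<Rightarrow> (nat \<times> nat \<Rightarrow> real) \<Rightarrow> (nat \<times> nat \<Rightarrow> real) \<Rightarrow> nat \<times> nat \<Rightarrow> real" where
  "mul_transpose m n x y = (\<lambda>p\<in>idx m n. \<Sum>l<n. x (fst p, l) * y (snd p, l))"

definition transposed :: "nat \<Rightarrow> (nat \<times> nat \<Rightarrow> real) \<Rightarrow> nat \<times> nat \<Rightarrow> real" where
  "transposed n x = (\<lambda>p\<in>idx n n. x (snd p, fst p))"

definition orthogonal_rows :: "nat \<Rightarrow> (nat \<times> nat \<Rightarrow> real) \<Rightarrow> bool" where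
  "orthogonal_rows n x \<longleftrightarrow> (\<forall>i<n. \<forall>j<n. (\<Sum>l<n. x (i, l) * x (j, l)) = (if i = j then 1 else 0))"

lemma sets_haar [measurable_cong, simp]: "sets (haar n) = sets (arrays (idx n n))"
  by (simp add: haar_def)

lemma measurable_into_gauss: "f \<in> measurable (arrays I) N \<Longrightarrow> f \<in> measurable (gauss I) N"
  by (subst measurable_cong_sets[OF sets_gauss refl])

lemma prob_space_haar: "prob_space (haar n)"
  unfolding haar_def
  by (intro prob_space.prob_space_distr prob_space_gauss measurable_into_gauss measurable_gram_schmidt_array)

lemma nn_integral_haar:
  assumes "f \<in> borel_measurable (arrays (idx n n))"
  shows "(\<integral>\<^sup>+x. f x \<partial>haar n) = (\<integral>\<^sup>+g. f (gram_schmidt_array n g) \<partial>gauss (idx n n))"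
  unfolding haar_def
  by (rule nn_integral_distr) (use assms in \<open>auto intro: measurable_into_gauss\<close>)

lemma AE_haar:
  assumes [measurable]: "Measurable.pred (arrays (idx n n)) P"
    and "AE g in gauss (idx n n). P (gram_schmidt_array n g)"
  shows "AE x in haar n. P x"
  unfolding haar_def using assms(2)
  by (subst AE_distr_iff) (auto intro: measurable_into_gauss)

lemma measurable_orthogonal_rows [measurable]:
  "Measurable.pred (arrays I) (orthogonal_rows n)"
  unfolding orthogonal_rows_def by measurable

lemma AE_haar_orthogonal: "AE x in haar n. orthogonal_rows n x"
proof (rule AE_haar)
  show "AE g in gauss (idx n n). orthogonal_rows n (gram_schmidt_array n g)"
    using AE_gs_nondegenerate
  proof eventually_elim
    case (elim g)
    then show ?case using gram_schmidt_orthonormal[of n n g]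
      by (simp add: orthogonal_rows_def gram_schmidt_array_def dot_def)
  qed
qed measurable

lemma measurable_mul_transpose [measurable]:
  assumes [measurable]: "f \<in> measurable N (arrays (idx m n))" "h \<in> measurable N (arrays (idx n n))"
  shows "(\<lambda>w. mul_transpose m n (f w) (h w)) \<in> measurable N (arrays (idx m n))"
  unfolding mul_transpose_def
  by (intro measurable_restrict borel_measurable_sum borel_measurable_times
    measurable_compose[OF assms(1) measurable_coord] measurable_compose[OF assms(2) measurable_coord])

lemma measurable_transposed [measurable]:
  "transposed n \<in> measurable (arrays (idx n n)) (arrays (idx n n))"
  unfolding transposed_def by measurable

lemma orthogonal_rows_iff_orth:
  "orthogonal_rows n y \<longleftrightarrow> orth {..<n} (\<lambda>j l. y (j, l))"
proof -
  have "orthogonal_rows n y \<longleftrightarrow> orth {..<n} (\<lambda>j l. y (l, j))"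
    by (auto simp: orthogonal_rows_def orth_def)
  also have "\<dots> \<longleftrightarrow> orth {..<n} (\<lambda>j l. y (j, l))"
    using orth_transpose[of n "\<lambda>j l. y (l, j)"] orth_transpose[of n "\<lambda>j l. y (j, l)"] by blast
  finally show ?thesis .
qed

lemma nn_integral_gauss_mul_transpose:
  assumes "orthogonal_rows n y" "f \<in> borel_measurable (arrays (idx m n))"
  shows "(\<integral>\<^sup>+x. f (mul_transpose m n x y) \<partial>gauss (idx m n)) = (\<integral>\<^sup>+x. f x \<partial>gauss (idx m n))"
proof -
  define T where "T = (\<lambda>p q :: nat \<times> nat. of_bool (fst p = fst q) * y (snd p, snd q))"
  have "lin (idx m n) T x = mul_transpose m n x y" for x
  proof
    fix p show "lin (idx m n) T x p = mul_transpose m n x y p"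
    proof (cases "p \<in> idx m n")
      case True
      then obtain i j where p: "p = (i, j)" "i < m" "j < n" by auto
      have "lin (idx m n) T x (i, j) = (\<Sum>l<n. y (j, l) * x (i, l))"
        unfolding T_def using p by (intro lin_right[where V="\<lambda>j l. y (j, l)"]) auto
      then show ?thesis using True p by (simp add: mul_transpose_def mult.commute)
    qed (simp add: lin_def mul_transpose_def)
  qed
  moreover have "orth (idx m n) T" unfolding T_def
    by (rule orth_right[where V="\<lambda>j l. y (j, l)"]) (use assms(1) in \<open>auto simp: orthogonal_rows_iff_orth\<close>)
  ultimately show ?thesis using nn_integral_gauss_orth[of "idx m n" T f] assms(2) by simp
qed

lemma nn_integral_haar_mul_transpose:
  assumes y: "orthogonal_rows n y" and f[measurable]: "f \<in> borel_measurable (arrays (idx n n))"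
  shows "(\<integral>\<^sup>+x. f (mul_transpose n n x y) \<partial>haar n) = (\<integral>\<^sup>+x. f x \<partial>haar n)"
proof -
  have y': "orth {..<n} (\<lambda>j l. y (j, l))" using y by (simp add: orthogonal_rows_iff_orth)
  have m: "(\<lambda>x. f (mul_transpose n n x y)) \<in> borel_measurable (arrays (idx n n))"
  proof -
    have "(\<lambda>x. mul_transpose n n x y) \<in> measurable (arrays (idx n n)) (arrays (idx n n))"
      unfolding mul_transpose_def by measurable
    from measurable_compose[OF this f] show ?thesis .
  qed
  have e: "mul_transpose n n (gram_schmidt_array n g) y = gram_schmidt_array n (mul_transpose n n g y)" for g
  proof
    fix p show "mul_transpose n n (gram_schmidt_array n g) y p = gram_schmidt_array n (mul_transpose n n g y) p"
    proof (cases "p \<in> idx n n")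
      case True
      then obtain i j where p: "p = (i, j)" "i < n" "j < n" by auto
      have "gram_schmidt n (mul_transpose n n g y) i j = (\<Sum>l<n. y (j, l) * gram_schmidt n g i l)"
        by (rule gram_schmidt_rotate[OF y']) (use p in \<open>auto simp: mul_transpose_def mult.commute\<close>)
      then show ?thesis using True p by (simp add: mul_transpose_def gram_schmidt_array_def mult.commute)
    qed (simp add: mul_transpose_def gram_schmidt_array_def)
  qed
  have "(\<integral>\<^sup>+x. f (mul_transpose n n x y) \<partial>haar n) = (\<integral>\<^sup>+g. f (gram_schmidt_array n (mul_transpose n n g y)) \<partial>gauss (idx n n))"
    by (simp add: nn_integral_haar[OF m] e)
  also have "\<dots> = (\<integral>\<^sup>+g. f (gram_schmidt_array n g) \<partial>gauss (idx n n))"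
    by (rule nn_integral_gauss_mul_transpose[OF y, of "\<lambda>g. f (gram_schmidt_array n g)"]) measurable
  also have "\<dots> = (\<integral>\<^sup>+x. f x \<partial>haar n)" by (rule nn_integral_haar[OF f, symmetric])
  finally show ?thesis .
qed

text \<open>Invariance under right multiplication, used for two independent copies \<open>x\<close> and \<open>y\<close>: the product of
\<open>x\<close> with the transpose of \<open>y\<close> is distributed as \<open>x\<close> when \<open>y\<close> is held fixed, and as the transpose of
\<open>y\<close> when \<open>x\<close> is held fixed.\<close>

lemma nn_integral_haar_transposed:
  assumes f[measurable]: "f \<in> borel_measurable (arrays (idx n n))"
  shows "(\<integral>\<^sup>+x. f (transposed n x) \<partial>haar n) = (\<integral>\<^sup>+x. f x \<partial>haar n)"
proof -
  interpret prob_space "haar n" by (rule prob_space_haar)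
  interpret P: pair_sigma_finite "haar n" "haar n"
    by (simp add: pair_sigma_finite_def prob_space_haar prob_space_imp_sigma_finite)
  have t: "transposed n (mul_transpose n n y x) = mul_transpose n n x y" for x y
    by (auto simp: transposed_def mul_transpose_def fun_eq_iff mult.commute)
  have "(\<integral>\<^sup>+x. f x \<partial>haar n) = (\<integral>\<^sup>+y. \<integral>\<^sup>+x. f x \<partial>haar n \<partial>haar n)" by (simp add: emeasure_space_1)
  also have "\<dots> = (\<integral>\<^sup>+y. \<integral>\<^sup>+x. f (mul_transpose n n x y) \<partial>haar n \<partial>haar n)"
  proof (rule nn_integral_cong_AE)
    show "AE y in haar n. (\<integral>\<^sup>+x. f x \<partial>haar n) = (\<integral>\<^sup>+x. f (mul_transpose n n x y) \<partial>haar n)"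
      using AE_haar_orthogonal by eventually_elim (simp add: nn_integral_haar_mul_transpose)
  qed
  also have "\<dots> = (\<integral>\<^sup>+x. \<integral>\<^sup>+y. f (mul_transpose n n x y) \<partial>haar n \<partial>haar n)"
    by (rule P.Fubini') measurable
  also have "\<dots> = (\<integral>\<^sup>+x. \<integral>\<^sup>+y. f (transposed n (mul_transpose n n y x)) \<partial>haar n \<partial>haar n)" by (simp add: t)
  also have "\<dots> = (\<integral>\<^sup>+x. \<integral>\<^sup>+y. f (transposed n y) \<partial>haar n \<partial>haar n)"
  proof (rule nn_integral_cong_AE)
    show "AE x in haar n. (\<integral>\<^sup>+y. f (transposed n (mul_transpose n n y x)) \<partial>haar n) = (\<integral>\<^sup>+y. f (transposed n y) \<partial>haar n)"
      using AE_haar_orthogonal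
      by eventually_elim (rule nn_integral_haar_mul_transpose[where f="\<lambda>y. f (transposed n y)"], measurable)
  qed
  also have "\<dots> = (\<integral>\<^sup>+x. f (transposed n x) \<partial>haar n)" by (simp add: emeasure_space_1)
  finally show ?thesis by simp
qed

text \<open>By invariance under transposition the first column may be replaced by the first row, which
Gram-Schmidt merely normalises.\<close>

lemma nn_integral_haar_column:
  assumes n: "n > 0" and \<phi>[measurable]: "\<phi> \<in> borel_measurable (arrays {..<n})"
  shows "(\<integral>\<^sup>+x. \<phi> (\<lambda>i\<in>{..<n}. x (i, 0)) \<partial>haar n) =
    (\<integral>\<^sup>+g. \<phi> (\<lambda>i\<in>{..<n}. g i / sqrt (\<Sum>j<n. (g j)\<^sup>2)) \<partial>gauss {..<n})"
proof -
  define \<psi> where "\<psi> = (\<lambda>g :: nat \<Rightarrow> real. \<phi> (\<lambda>i\<in>{..<n}. g i / sqrt (\<Sum>j<n. (g j)\<^sup>2)))"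
  have "(\<lambda>g. \<lambda>i\<in>{..<n}. g i / sqrt (\<Sum>j<n. (g j)\<^sup>2)) \<in> measurable (arrays {..<n}) (arrays {..<n})"
    by measurable
  from measurable_compose[OF this \<phi>] have \<psi>: "\<psi> \<in> borel_measurable (arrays {..<n})" unfolding \<psi>_def .
  have "(\<lambda>x. \<lambda>i\<in>{..<n}. x (i, 0)) \<in> measurable (arrays (idx n n)) (arrays {..<n})"
    by measurable
  from measurable_compose[OF this \<phi>] have m: "(\<lambda>x. \<phi> (\<lambda>i\<in>{..<n}. x (i, 0))) \<in> borel_measurable (arrays (idx n n))" .
  have "(\<lambda>x. \<lambda>i\<in>{..<n}. x (0, i)) \<in> measurable (arrays (idx n n)) (arrays {..<n})"
    by measurable
  from measurable_compose[OF this \<phi>] have m': "(\<lambda>x. \<phi> (\<lambda>i\<in>{..<n}. x (0, i))) \<in> borel_measurable (arrays (idx n n))" .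
  have tr: "(\<lambda>i\<in>{..<n}. transposed n x (i, 0)) = (\<lambda>i\<in>{..<n}. x (0, i))" for x
    using n by (auto simp: transposed_def fun_eq_iff)
  have g0: "(\<lambda>i\<in>{..<n}. gram_schmidt_array n g (0, i)) = (\<lambda>i\<in>{..<n}. (\<lambda>i\<in>{..<n}. g (0, i)) i / sqrt (\<Sum>j<n. ((\<lambda>i\<in>{..<n}. g (0, i)) j)\<^sup>2))" for g
  proof -
    have "gs_residual n g 0 = (\<lambda>j. g (0, j))" by (simp add: gs_residual_def fun_eq_iff)
    then have 1: "gram_schmidt n g 0 i = g (0, i) / sqrt (\<Sum>j<n. (g (0, j))\<^sup>2)" for i
      by (simp add: gram_schmidt_eq dot_def power2_eq_square)
    have 2: "(\<Sum>j<n. ((\<lambda>i\<in>{..<n}. g (0, i)) j)\<^sup>2) = (\<Sum>j<n. (g (0, j))\<^sup>2)" by (intro sum.cong) auto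
    show ?thesis unfolding 2 using n by (intro restrict_ext) (simp add: gram_schmidt_array_def 1)
  qed
  have "(\<integral>\<^sup>+x. \<phi> (\<lambda>i\<in>{..<n}. x (i, 0)) \<partial>haar n) = (\<integral>\<^sup>+x. \<phi> (\<lambda>i\<in>{..<n}. transposed n x (i, 0)) \<partial>haar n)"
    by (rule nn_integral_haar_transposed[OF m, symmetric])
  also have "\<dots> = (\<integral>\<^sup>+x. \<phi> (\<lambda>i\<in>{..<n}. x (0, i)) \<partial>haar n)" unfolding tr ..
  also have "\<dots> = (\<integral>\<^sup>+g. \<phi> (\<lambda>i\<in>{..<n}. gram_schmidt_array n g (0, i)) \<partial>gauss (idx n n))"
    by (rule nn_integral_haar[OF m'])
  also have "\<dots> = (\<integral>\<^sup>+g. \<psi> (\<lambda>i\<in>{..<n}. g (0, i)) \<partial>gauss (idx n n))"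
    unfolding g0 \<psi>_def ..
  also have "\<dots> = (\<integral>\<^sup>+g. \<psi> g \<partial>gauss {..<n})"
    using n by (intro nn_integral_gauss_reindex[where h="\<lambda>i. (0, i)"] \<psi>) (auto simp: inj_on_def)
  finally show ?thesis unfolding \<psi>_def .
qed

lemma AE_haar_column_nonzero: "AE x in haar n. \<forall>i<n. x (i, 0) \<noteq> 0"
proof (cases "n = 0")
  case False
  define \<phi> :: "(nat \<Rightarrow> real) \<Rightarrow> ennreal" where "\<phi> = (\<lambda>u. if \<forall>i<n. u i \<noteq> 0 then 0 else 1)"
  have [measurable]: "\<phi> \<in> borel_measurable (arrays {..<n})" unfolding \<phi>_def by measurable
  have "AE g in gauss {..<n}. g i \<noteq> 0" if "i < n" for i
    by (rule AE_gauss_coord[of _ i]) (use that in auto)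
  then have "AE g in gauss {..<n}. \<forall>i\<in>{..<n}. g i \<noteq> 0" by (intro AE_finite_allI) auto
  then have ae: "AE g in gauss {..<n}. \<phi> (\<lambda>i\<in>{..<n}. g i / sqrt (\<Sum>j<n. (g j)\<^sup>2)) = 0"
  proof eventually_elim
    case (elim g)
    have "(\<Sum>j<n. (g j)\<^sup>2) > 0" using False elim by (intro sum_pos) auto
    then show ?case using elim by (simp add: \<phi>_def)
  qed
  have "(\<integral>\<^sup>+x. \<phi> (\<lambda>i\<in>{..<n}. x (i, 0)) \<partial>haar n) =
    (\<integral>\<^sup>+g. \<phi> (\<lambda>i\<in>{..<n}. g i / sqrt (\<Sum>j<n. (g j)\<^sup>2)) \<partial>gauss {..<n})"
    using False by (intro nn_integral_haar_column) auto
  also have "\<dots> = (\<integral>\<^sup>+g. 0 \<partial>gauss {..<n})" by (rule nn_integral_cong_AE[OF ae])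
  finally have z: "(\<integral>\<^sup>+x. (if \<forall>i<n. x (i, 0) \<noteq> 0 then 0 else 1) \<partial>haar n) = 0"
    by (simp add: \<phi>_def cong: if_cong)
  have "AE x in haar n. (if \<forall>i<n. x (i, 0) \<noteq> 0 then 0 else 1 :: ennreal) = 0"
    using z by (subst (asm) nn_integral_0_iff_AE) measurable
  then show ?thesis by eventually_elim (metis zero_neq_one)
qed simp

section \<open>Concentration of the l1 norm of a random unit vector\<close>

text \<open>For a Gaussian vector \<open>g\<close> with \<open>T\<close> the sum of the \<open>\<bar>g i\<bar>\<close> and \<open>R\<close> the sum of their squares, the
quantity is \<open>T\<^sup>2 / (n R)\<close>.  Both \<open>T / n\<close> and \<open>R / n\<close> have standard deviations of order \<open>1 / sqrt n\<close>
around \<open>sqrt (2 / \<pi>)\<close> and 1.\<close>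

lemma haar_column_concentration:
  assumes n: "n > 0"
  shows "(\<integral>\<^sup>+x. ennreal \<bar>(\<Sum>i<n. \<bar>x (i, 0)\<bar>)\<^sup>2 / real n - 2 / pi\<bar> \<partial>haar n) \<le> ennreal (5 / sqrt (real n))"
proof -
  interpret N: prob_space std_normal_distribution by (rule prob_space_std_normal)
  define \<kappa> where "\<kappa> = sqrt (2 / pi)"
  have \<kappa>: "0 < \<kappa>" "\<kappa> \<le> 1" "\<kappa>\<^sup>2 = 2 / pi" using pi_gt3 by (auto simp: \<kappa>_def)
  define T R where "T = (\<lambda>g :: nat \<Rightarrow> real. \<Sum>i<n. \<bar>g i\<bar>)" and "R = (\<lambda>g :: nat \<Rightarrow> real. \<Sum>i<n. (g i)\<^sup>2)"
  have [measurable]: "T \<in> borel_measurable (arrays {..<n})" "R \<in> borel_measurable (arrays {..<n})"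
    unfolding T_def R_def by measurable
  define s where "s = sqrt (real n)"
  have s: "s \<ge> 1" "s\<^sup>2 = real n" using n by (auto simp: s_def)
  have pw: "\<bar>(T (\<lambda>i\<in>{..<n}. g i / sqrt (R g)))\<^sup>2 / real n - 2 / pi\<bar> \<le>
     (3 / 2) / s + (1 / (2 * s ^ 3)) * (R g - real n)\<^sup>2 + (2 / s ^ 3) * (T g - real n * \<kappa>)\<^sup>2" for g
  proof -
    have R0: "R g \<ge> 0" "T g \<ge> 0" by (auto simp: R_def T_def sum_nonneg)
    have cs: "(T g)\<^sup>2 \<le> real n * R g"
      using sum_squared_le_sum_of_squares[of "\<lambda>i. \<bar>g i\<bar>" "{..<n}"] by (simp add: T_def R_def mult.commute)
    define Z where "Z = (T (\<lambda>i\<in>{..<n}. g i / sqrt (R g)))\<^sup>2 / real n"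
    have "T (\<lambda>i\<in>{..<n}. g i / sqrt (R g)) = T g / sqrt (R g)"
      by (simp add: T_def sum_divide_distrib R0)
    then have Z: "Z = (T g)\<^sup>2 / R g / real n" using R0 by (simp add: Z_def power_divide)
    define a b where "a = R g / s\<^sup>2 - 1" and "b = T g / s\<^sup>2 - \<kappa>"
    have ZT: "\<bar>Z - (T g / s\<^sup>2)\<^sup>2\<bar> \<le> \<bar>a\<bar>"
    proof (cases "R g = 0")
      case True
      then have "T g = 0" using cs by simp
      then show ?thesis using Z by simp
    next
      case False
      then have Z1: "0 \<le> Z" "Z \<le> 1" using cs R0 n by (auto simp: Z field_simps)
      have "Z - (T g / s\<^sup>2)\<^sup>2 = - Z * a"
        using False s n by (simp add: Z a_def power2_eq_square[of "T g / s\<^sup>2"]) (simp add: field_simps power2_eq_square)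
      then have "\<bar>Z - (T g / s\<^sup>2)\<^sup>2\<bar> = Z * \<bar>a\<bar>" using Z1 by (simp add: abs_mult)
      also have "\<dots> \<le> 1 * \<bar>a\<bar>" by (rule mult_right_mono[OF Z1(2)]) simp
      finally show ?thesis by simp
    qed
    have am: "\<bar>z\<bar> \<le> (s * z\<^sup>2 + 1 / s) / 2" for z
    proof -
      have "0 \<le> (s * \<bar>z\<bar> - 1)\<^sup>2 / s" using s by simp
      also have "\<dots> = s * z\<^sup>2 + 1 / s - 2 * \<bar>z\<bar>" using s by (simp add: power2_eq_square field_simps)
      finally show ?thesis by simp
    qed
    have "(T g / s\<^sup>2)\<^sup>2 - \<kappa>\<^sup>2 = b\<^sup>2 + 2 * \<kappa> * b" by (simp add: b_def power2_eq_square algebra_simps)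
    then have "\<bar>(T g / s\<^sup>2)\<^sup>2 - \<kappa>\<^sup>2\<bar> \<le> b\<^sup>2 + 2 * \<kappa> * \<bar>b\<bar>"
      using \<kappa> abs_triangle_ineq[of "b\<^sup>2" "2 * \<kappa> * b"] by (simp add: abs_mult)
    also have "\<dots> \<le> s * b\<^sup>2 + 2 * 1 * \<bar>b\<bar>"
      using \<kappa> s mult_right_mono[of 1 s "b\<^sup>2"] by (intro add_mono mult_right_mono) auto
    also have "\<dots> \<le> 2 * s * b\<^sup>2 + 1 / s" using am[of b] by simp
    finally have "\<bar>Z - \<kappa>\<^sup>2\<bar> \<le> (s * a\<^sup>2 + 1 / s) / 2 + (2 * s * b\<^sup>2 + 1 / s)"
      using ZT am[of a] by linarith
    also have "s * a\<^sup>2 = (1 / s ^ 3) * (R g - real n)\<^sup>2"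
      using s by (simp add: a_def flip: s(2)) (simp add: field_simps eval_nat_numeral)
    also have "2 * s * b\<^sup>2 = (2 / s ^ 3) * (T g - real n * \<kappa>)\<^sup>2"
      using s by (simp add: b_def flip: s(2)) (simp add: field_simps eval_nat_numeral)
    finally show ?thesis using \<kappa>(3) by (simp add: Z_def add_divide_distrib)
  qed
  have abs1: "(LINT t|std_normal_distribution. \<bar>t\<bar>) = \<kappa>"
    using std_normal_distribution_odd_moments_abs[of 0] by (simp add: \<kappa>_def)
  have ia: "integrable std_normal_distribution (\<lambda>t::real. \<bar>t\<bar>)"
    using integrable_std_normal_distribution_moment[of 1] by (simp add: integrable_abs)
  have i2: "integrable std_normal_distribution (\<lambda>t::real. t\<^sup>2)"
    using integrable_std_normal_distribution_moment[of 2] .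
  have eT: "(\<bar>t\<bar> - \<kappa>)\<^sup>2 = t\<^sup>2 - 2 * \<kappa> * \<bar>t\<bar> + \<kappa>\<^sup>2" for t by (simp add: power2_diff)
  have "(\<integral>\<^sup>+g. ennreal ((\<Sum>i<n. \<bar>g i\<bar> - \<kappa>)\<^sup>2) \<partial>gauss {..<n}) = ennreal (real n * (1 - \<kappa>\<^sup>2))"
  proof (rule nn_integral_sum_square[where f="\<lambda>t. \<bar>t\<bar> - \<kappa>"])
    show "integrable std_normal_distribution (\<lambda>t. \<bar>t\<bar> - \<kappa>)" using ia by simp
    show "integrable std_normal_distribution (\<lambda>t. (\<bar>t\<bar> - \<kappa>)\<^sup>2)" unfolding eT using ia i2 by simp
    show "(LINT t|std_normal_distribution. \<bar>t\<bar> - \<kappa>) = 0" using ia abs1 N.prob_space by simp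
    show "(LINT t|std_normal_distribution. (\<bar>t\<bar> - \<kappa>)\<^sup>2) = 1 - \<kappa>\<^sup>2"
      unfolding eT using ia i2 abs1 N.prob_space std_normal_moments(1) by (simp add: power2_eq_square)
  qed
  then have ET: "(\<integral>\<^sup>+g. ennreal ((T g - real n * \<kappa>)\<^sup>2) \<partial>gauss {..<n}) \<le> ennreal (real n)"
    using \<kappa> by (auto simp: T_def sum_subtractf intro!: ennreal_leI mult_left_le)
  have ER: "(\<integral>\<^sup>+g. ennreal ((R g - real n)\<^sup>2) \<partial>gauss {..<n}) = ennreal (2 * real n)"
    unfolding R_def by (rule chi2_second_moment)
  have "(\<integral>\<^sup>+x. ennreal \<bar>(\<Sum>i<n. \<bar>x (i, 0)\<bar>)\<^sup>2 / real n - 2 / pi\<bar> \<partial>haar n) =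
     (\<integral>\<^sup>+x. ennreal \<bar>(T (\<lambda>i\<in>{..<n}. x (i, 0)))\<^sup>2 / real n - 2 / pi\<bar> \<partial>haar n)"
    by (simp add: T_def)
  also have "\<dots> = (\<integral>\<^sup>+g. ennreal \<bar>(T (\<lambda>i\<in>{..<n}. g i / sqrt (R g)))\<^sup>2 / real n - 2 / pi\<bar> \<partial>gauss {..<n})"
    unfolding R_def using n by (intro nn_integral_haar_column[where \<phi>="\<lambda>u. ennreal \<bar>(T u)\<^sup>2 / real n - 2 / pi\<bar>"]) auto
  also have "\<dots> \<le> (\<integral>\<^sup>+g. ennreal ((3 / 2) / s) + (ennreal (1 / (2 * s ^ 3)) * ennreal ((R g - real n)\<^sup>2) + ennreal (2 / s ^ 3) * ennreal ((T g - real n * \<kappa>)\<^sup>2)) \<partial>gauss {..<n})"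
  proof (rule nn_integral_mono)
    fix g
    have "ennreal \<bar>(T (\<lambda>i\<in>{..<n}. g i / sqrt (R g)))\<^sup>2 / real n - 2 / pi\<bar> \<le>
      ennreal ((3 / 2) / s + (1 / (2 * s ^ 3) * (R g - real n)\<^sup>2 + 2 / s ^ 3 * (T g - real n * \<kappa>)\<^sup>2))"
      using pw[of g] by (intro ennreal_leI) (simp add: add.assoc)
    also have "\<dots> = ennreal ((3 / 2) / s) + (ennreal (1 / (2 * s ^ 3)) * ennreal ((R g - real n)\<^sup>2) + ennreal (2 / s ^ 3) * ennreal ((T g - real n * \<kappa>)\<^sup>2))"
      using s by (simp add: ennreal_plus ennreal_mult'[symmetric] del: times_divide_eq_left)
    finally show "ennreal \<bar>(T (\<lambda>i\<in>{..<n}. g i / sqrt (R g)))\<^sup>2 / real n - 2 / pi\<bar> \<le> \<dots>" .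
  qed
  also have "\<dots> = ennreal ((3 / 2) / s) + (ennreal (1 / (2 * s ^ 3)) * (\<integral>\<^sup>+g. ennreal ((R g - real n)\<^sup>2) \<partial>gauss {..<n})
      + ennreal (2 / s ^ 3) * (\<integral>\<^sup>+g. ennreal ((T g - real n * \<kappa>)\<^sup>2) \<partial>gauss {..<n}))"
    by (simp add: nn_integral_add nn_integral_cmult)
  also have "\<dots> \<le> ennreal ((3 / 2) / s) + (ennreal (1 / (2 * s ^ 3)) * ennreal (2 * real n) + ennreal (2 / s ^ 3) * ennreal (real n))"
    unfolding ER by (intro add_mono mult_left_mono ET) auto
  also have "\<dots> = ennreal ((3 / 2) / s + (1 / (2 * s ^ 3) * (2 * real n) + 2 / s ^ 3 * real n))"
    using s by (simp add: ennreal_plus ennreal_mult'[symmetric] del: times_divide_eq_left)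
  also have "\<dots> \<le> ennreal (5 / s)"
    using s by (intro ennreal_leI) (simp add: field_simps eval_nat_numeral flip: s(2))
  finally show ?thesis by (simp add: s_def)
qed

section \<open>Spectral decomposition of a Gram matrix\<close>

definition gram :: "nat \<Rightarrow> (nat \<times> nat \<Rightarrow> real) \<Rightarrow> nat \<Rightarrow> nat \<Rightarrow> real" where
  "gram m x i j = (\<Sum>a<m. x (a, i) * x (a, j))"

primrec gram_power :: "nat \<Rightarrow> nat \<Rightarrow> (nat \<times> nat \<Rightarrow> real) \<Rightarrow> nat \<Rightarrow> nat \<Rightarrow> nat \<Rightarrow> real" where
  "gram_power m n x 0 i j = of_bool (i = j)"
| "gram_power m n x (Suc k) i j = (\<Sum>r<n. gram_power m n x k i r * gram m x r j)"

text \<open>If the largest eigenvalue is simple, the powers of the Gram matrix divided by their trace converge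
to the projection onto its eigenspace.  This makes the projection a measurable function of the
matrix, which is what allows its law to be transported.\<close>

definition top_proj :: "nat \<Rightarrow> nat \<Rightarrow> (nat \<times> nat \<Rightarrow> real) \<Rightarrow> nat \<Rightarrow> nat \<Rightarrow> real" where
  "top_proj m n x i j = lim (\<lambda>k. gram_power m n x k i j / (\<Sum>r<n. gram_power m n x k r r))"

lemma measurable_gram [measurable]: "(\<lambda>x. gram m x i j) \<in> borel_measurable (arrays I)"
  unfolding gram_def by measurable

lemma measurable_gram_power [measurable]: "(\<lambda>x. gram_power m n x k i j) \<in> borel_measurable (arrays I)"
  by (induction k arbitrary: i j) simp_all

lemma measurable_top_proj [measurable]: "(\<lambda>x. top_proj m n x i j) \<in> borel_measurable (arrays I)"
  unfolding top_proj_def by (rule borel_measurable_lim_metric) measurable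

lemma orth_rows: "orth {..<n} q \<Longrightarrow> i < n \<Longrightarrow> j < n \<Longrightarrow> (\<Sum>k<n. q i k * q j k) = (if i = j then 1 else 0)" for n :: nat
  using orth_transpose[of n q] by (simp add: orth_def)

lemma orth_cols: "orth {..<n} q \<Longrightarrow> i < n \<Longrightarrow> j < n \<Longrightarrow> (\<Sum>k<n. q k i * q k j) = (if i = j then 1 else 0)" for n :: nat
  by (simp add: orth_def)

lemma bil_swap: "bil m n x u y = (\<Sum>a<m. u a * (\<Sum>j<n. x (a, j) * y j))"
  unfolding bil_def by (simp add: sum_distrib_right sum_distrib_left mult_ac) (rule sum.swap)

text \<open>Column \<open>k\<close> of \<open>q\<close> is the eigenvector of the Gram matrix for \<open>l k\<close>, and \<open>l 0\<close> is the largest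
eigenvalue.\<close>

locale gram_spectrum =
  fixes m n :: nat and x :: "nat \<times> nat \<Rightarrow> real" and q :: "nat \<Rightarrow> nat \<Rightarrow> real" and l :: "nat \<Rightarrow> real"
  assumes m: "m > 0" and n: "n > 0"
    and q: "orth {..<n} q"
    and gram: "\<And>i j. i < n \<Longrightarrow> j < n \<Longrightarrow> gram m x i j = (\<Sum>k<n. l k * (q i k * q j k))"
    and l: "\<And>i j. i \<le> j \<Longrightarrow> j < n \<Longrightarrow> l j \<le> l i"
begin

lemma gram_quadratic: "(\<Sum>a<m. (\<Sum>j<n. x (a, j) * y j) * (\<Sum>j<n. x (a, j) * z j)) =
   (\<Sum>k<n. l k * ((\<Sum>i<n. q i k * y i) * (\<Sum>i<n. q i k * z i)))"
proof -
  have "(\<Sum>a<m. (\<Sum>j<n. x (a, j) * y j) * (\<Sum>j<n. x (a, j) * z j)) =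
    (\<Sum>a<m. \<Sum>i<n. \<Sum>j<n. x (a, i) * x (a, j) * (y i * z j))"
    by (simp add: sum_product mult_ac)
  also have "\<dots> = (\<Sum>i<n. \<Sum>a<m. \<Sum>j<n. x (a, i) * x (a, j) * (y i * z j))" by (rule sum.swap)
  also have "\<dots> = (\<Sum>i<n. \<Sum>j<n. \<Sum>a<m. x (a, i) * x (a, j) * (y i * z j))"
    by (intro sum.cong refl sum.swap)
  also have "\<dots> = (\<Sum>i<n. \<Sum>j<n. gram m x i j * (y i * z j))"
    by (simp add: gram_def sum_distrib_right)
  also have "\<dots> = (\<Sum>i<n. \<Sum>j<n. \<Sum>k<n. l k * ((q i k * y i) * (q j k * z j)))"
    by (intro sum.cong refl) (simp add: gram sum_distrib_left sum_distrib_right mult_ac)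
  also have "\<dots> = (\<Sum>i<n. \<Sum>k<n. \<Sum>j<n. l k * ((q i k * y i) * (q j k * z j)))"
    by (intro sum.cong refl sum.swap)
  also have "\<dots> = (\<Sum>k<n. \<Sum>i<n. \<Sum>j<n. l k * ((q i k * y i) * (q j k * z j)))" by (rule sum.swap)
  also have "\<dots> = (\<Sum>k<n. l k * ((\<Sum>i<n. q i k * y i) * (\<Sum>i<n. q i k * z i)))"
    by (simp only: sum_product) (simp only: sum_distrib_left)
  finally show ?thesis .
qed

lemma eigenvector: "k < n \<Longrightarrow> i < n \<Longrightarrow> (\<Sum>j<n. gram m x i j * q j k) = l k * q i k"
proof -
  assume k: "k < n" "i < n"
  have "(\<Sum>j<n. gram m x i j * q j k) = (\<Sum>j<n. \<Sum>r<n. l r * q i r * (q j r * q j k))"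
    using k by (intro sum.cong refl) (simp add: gram sum_distrib_right sum_distrib_left mult_ac)
  also have "\<dots> = (\<Sum>r<n. l r * q i r * (\<Sum>j<n. q j r * q j k))"
    by (subst sum.swap) (simp add: sum_distrib_left)
  also have "\<dots> = (\<Sum>r<n. if r = k then l r * q i r else 0)"
    using k by (intro sum.cong refl) (simp add: orth_cols[OF q])
  finally show ?thesis using k by simp
qed

lemma eigenvalue_norm: "k < n \<Longrightarrow> l k = (\<Sum>a<m. (\<Sum>j<n. x (a, j) * q j k)\<^sup>2)"
proof -
  assume k: "k < n"
  have "(\<Sum>a<m. (\<Sum>j<n. x (a, j) * q j k)\<^sup>2) = (\<Sum>r<n. l r * ((\<Sum>i<n. q i r * q i k) * (\<Sum>i<n. q i r * q i k)))"
    using gram_quadratic[of "\<lambda>j. q j k" "\<lambda>j. q j k"] by (simp add: power2_eq_square)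
  also have "\<dots> = (\<Sum>r<n. if r = k then l r else 0)"
    using k by (intro sum.cong refl) (simp add: orth_cols[OF q])
  finally show ?thesis using k by simp
qed

lemma l_nonneg: "k < n \<Longrightarrow> l k \<ge> 0"
  by (simp add: eigenvalue_norm sum_nonneg)

lemma sum_l: "(\<Sum>k<n. l k) = (\<Sum>i<n. gram m x i i)"
proof -
  have "(\<Sum>i<n. gram m x i i) = (\<Sum>i<n. \<Sum>k<n. l k * (q i k * q i k))" by (simp add: gram)
  also have "\<dots> = (\<Sum>k<n. l k * (\<Sum>i<n. q i k * q i k))" by (subst sum.swap) (simp add: sum_distrib_left)
  finally show ?thesis by (simp add: orth_cols[OF q])
qed

lemma rayleigh: "(\<Sum>a<m. (\<Sum>j<n. x (a, j) * y j)\<^sup>2) \<le> l 0 * (L2_set y {..<n})\<^sup>2"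
proof -
  have "(\<Sum>a<m. (\<Sum>j<n. x (a, j) * y j)\<^sup>2) = (\<Sum>k<n. l k * ((\<Sum>i<n. q i k * y i) * (\<Sum>i<n. q i k * y i)))"
    using gram_quadratic[of y y] by (simp add: power2_eq_square)
  also have "\<dots> \<le> (\<Sum>k<n. l 0 * ((\<Sum>i<n. q i k * y i) * (\<Sum>i<n. q i k * y i)))"
    by (intro sum_mono mult_right_mono l) auto
  also have "\<dots> = l 0 * (\<Sum>i<n. y i * y i)"
    by (simp only: orth_inner[OF finite_lessThan orth_transpose[OF q]] flip: sum_distrib_left)
  also have "(\<Sum>i<n. y i * y i) = (L2_set y {..<n})\<^sup>2" by (simp add: L2_set_def sum_nonneg power2_eq_square)
  finally show ?thesis .
qed

lemma bil_le_top: "bil m n x u y \<le> sqrt (l 0) * L2_set u {..<m} * L2_set y {..<n}"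
proof -
  define v where "v = (\<lambda>a. \<Sum>j<n. x (a, j) * y j)"
  have "bil m n x u y = (\<Sum>a<m. u a * v a)"
    unfolding bil_swap v_def ..
  also have "\<dots> \<le> (\<Sum>a<m. \<bar>u a\<bar> * \<bar>v a\<bar>)" by (intro sum_mono) (metis abs_ge_self abs_mult)
  also have "\<dots> \<le> L2_set u {..<m} * L2_set v {..<m}" by (rule L2_set_mult_ineq)
  also have "\<dots> \<le> L2_set u {..<m} * (sqrt (l 0) * L2_set y {..<n})"
  proof (rule mult_left_mono)
    show "L2_set v {..<m} \<le> sqrt (l 0) * L2_set y {..<n}"
      using real_sqrt_le_mono[OF rayleigh[of y]]
      by (simp add: L2_set_def v_def real_sqrt_mult sum_nonneg)
  qed (rule L2_set_nonneg)
  finally show ?thesis by (simp only: mult_ac)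
qed

lemma top_eigenvalue_le:
  assumes "t > 0"
  shows "l 0 \<le> top_upper t m n x"
proof -
  define u where "u = (\<lambda>a. \<Sum>j<n. x (a, j) * q j 0)"
  have "bil m n x u (\<lambda>j. q j 0) = (\<Sum>a<m. u a * u a)"
    unfolding bil_swap u_def ..
  also have "\<dots> = l 0" using eigenvalue_norm[of 0] n by (simp add: u_def power2_eq_square)
  finally have 1: "bil m n x u (\<lambda>j. q j 0) = l 0" .
  have 2: "L2_set u {..<m} = sqrt (l 0)" using eigenvalue_norm[of 0] n by (simp add: u_def L2_set_def)
  have 3: "L2_set (\<lambda>j. q j 0) {..<n} = 1" using orth_cols[OF q, of 0 0] n by (simp add: L2_set_def power2_eq_square)
  have "l 0 \<le> sqrt (top_upper t m n x) * sqrt (l 0)"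
    using bil_top_upper[OF assms m n, of x u "\<lambda>j. q j 0"] unfolding 1 2 3 by simp
  then have "sqrt (l 0) * sqrt (l 0) \<le> sqrt (top_upper t m n x) * sqrt (l 0)"
    using l_nonneg[of 0] n by simp
  moreover have "top_upper t m n x \<ge> 0"
    using assms excess_nonneg[of m n x] unfolding top_upper_def by (intro add_nonneg_nonneg mult_nonneg_nonneg) auto
  ultimately show ?thesis
  proof (cases "l 0 = 0")
    case False
    then have "sqrt (l 0) > 0" using l_nonneg[of 0] n by simp
    then have "sqrt (l 0) \<le> sqrt (top_upper t m n x)"
      using mult_right_le_imp_le[OF \<open>sqrt (l 0) * sqrt (l 0) \<le> _\<close>] by simp
    then show ?thesis by simp
  qed simp
qed

lemma top_eigenvalue_ge:
  assumes "2 * j < m" "2 * j < n" "j > 0"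
  shows "top_lower j m n x \<le> sqrt (l 0)"
proof -
  obtain u y where uy: "L2_set u {..<m} > 0" "L2_set y {..<n} > 0"
     "bil m n x u y = top_lower j m n x * L2_set u {..<m} * L2_set y {..<n}"
    using bil_top_lower[OF assms, of x] by blast
  have "top_lower j m n x * (L2_set u {..<m} * L2_set y {..<n}) \<le> sqrt (l 0) * (L2_set u {..<m} * L2_set y {..<n})"
    using bil_le_top[of u y] uy(3) by (simp add: mult_ac)
  then show ?thesis using uy(1,2) by simp
qed

lemma spectral_sign_form:
  "(\<Sum>i<n. \<Sum>j<n. gram m x i j * (s i * s j)) = (\<Sum>k<n. l k * (\<Sum>i<n. q i k * s i)\<^sup>2)"
proof -
  have "(\<Sum>i<n. \<Sum>j<n. gram m x i j * (s i * s j)) = (\<Sum>i<n. \<Sum>j<n. \<Sum>k<n. l k * ((q i k * s i) * (q j k * s j)))"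
    by (intro sum.cong refl) (simp add: gram sum_distrib_left sum_distrib_right mult_ac)
  also have "\<dots> = (\<Sum>i<n. \<Sum>k<n. \<Sum>j<n. l k * ((q i k * s i) * (q j k * s j)))"
    by (intro sum.cong refl sum.swap)
  also have "\<dots> = (\<Sum>k<n. \<Sum>i<n. \<Sum>j<n. l k * ((q i k * s i) * (q j k * s j)))" by (rule sum.swap)
  also have "\<dots> = (\<Sum>k<n. l k * (\<Sum>i<n. q i k * s i)\<^sup>2)"
    by (simp only: power2_eq_square sum_product) (simp only: sum_distrib_left)
  finally show ?thesis .
qed

lemma nondeg_eigenvector:
  assumes nd: "nondeg (m + n) m n x" and w: "\<And>i. i < n \<Longrightarrow> (\<Sum>j<n. gram m x i j * w j) = \<tau> * w i"
    and "\<tau> \<noteq> 0" "w 0 = 0" "j < n"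
  shows "w j = 0"
proof (rule nondeg_singular_vector[OF nd order_refl, of w 1 "\<lambda>i. \<Sum>j<n. x (i, j) * w j" \<tau>])
  fix i assume "i < n"
  have "(\<Sum>a<m. (\<Sum>j<n. x (a, j) * w j) * x (a, i)) = (\<Sum>a<m. \<Sum>j<n. x (a, i) * x (a, j) * w j)"
    by (simp add: sum_distrib_left sum_distrib_right mult_ac)
  also have "\<dots> = (\<Sum>j<n. gram m x i j * w j)" by (subst sum.swap) (simp add: gram_def sum_distrib_right)
  finally show "(\<Sum>a<m. (\<Sum>j<n. x (a, j) * w j) * x (a, i)) = \<tau> * w i" using w[OF \<open>i < n\<close>] by simp
qed (use assms in auto)

text \<open>A second eigenvector for \<open>l 0\<close> could be combined with the first one into an eigenvector with first
coordinate zero.\<close>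

lemma top_eigenvalue_simple:
  assumes nd: "nondeg (m + n) m n x"
  shows "l 0 > 0" "0 < k \<Longrightarrow> k < n \<Longrightarrow> l k < l 0"
proof -
  obtain N where N: "m + n = Suc N" using m by (cases "m + n") auto
  have "gram m x 0 0 \<noteq> 0" using nd m n unfolding N by (simp add: gram_def colnorm2_def power2_eq_square)
  have "l 0 \<noteq> 0"
  proof
    assume "l 0 = 0"
    then have "l k = 0" if "k < n" for k using l[of 0 k] l_nonneg[of k] that by simp
    then have "gram m x 0 0 = 0" using n by (simp add: gram)
    then show False using \<open>gram m x 0 0 \<noteq> 0\<close> by simp
  qed
  then show pos: "l 0 > 0" using l_nonneg[of 0] n by simp
  assume k: "0 < k" "k < n"
  show "l k < l 0"
  proof (rule ccontr)
    assume "\<not> l k < l 0"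
    then have eq: "l k = l 0" using l[of 0 k] k by simp
    \<comment> \<open>the combination of the two eigenvectors whose first coordinate cancels\<close>
    define w where "w = (\<lambda>j. q 0 k * q j 0 - q 0 0 * q j k)"
    have "w j = 0" if "j < n" for j
    proof (rule nondeg_eigenvector[OF nd _ \<open>l 0 \<noteq> 0\<close> _ that])
      fix i assume i: "i < n"
      have "(\<Sum>j<n. gram m x i j * w j) = q 0 k * (\<Sum>j<n. gram m x i j * q j 0) - q 0 0 * (\<Sum>j<n. gram m x i j * q j k)"
        by (simp add: w_def right_diff_distrib sum_subtractf sum_distrib_left mult_ac)
      also have "\<dots> = q 0 k * (l 0 * q i 0) - q 0 0 * (l k * q i k)" using i n k by (simp add: eigenvector)
      finally show "(\<Sum>j<n. gram m x i j * w j) = l 0 * w i" by (simp add: eq w_def algebra_simps)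
    qed (simp add: w_def)
    then have "0 = (\<Sum>j<n. w j * q j k)" by simp
    also have "\<dots> = q 0 k * (\<Sum>j<n. q j 0 * q j k) - q 0 0 * (\<Sum>j<n. q j k * q j k)"
      by (simp add: w_def algebra_simps sum_subtractf sum_distrib_left)
    finally have "q 0 0 = 0" using k n by (simp add: orth_cols[OF q])
    then have z: "q j 0 = 0" if "j < n" for j
      using nondeg_eigenvector[OF nd _ \<open>l 0 \<noteq> 0\<close>, of "\<lambda>j. q j 0" j] eigenvector[of 0] n that by simp
    have "(\<Sum>j<n. q j 0 * q j 0) = 1" using n by (simp add: orth_cols[OF q])
    then show False using z by simp
  qed
qed

lemma gram_power: "i < n \<Longrightarrow> j < n \<Longrightarrow> gram_power m n x k i j = (\<Sum>r<n. l r ^ k * (q i r * q j r))"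
proof (induction k arbitrary: j)
  case 0
  then show ?case by (simp add: orth_rows[OF q])
next
  case (Suc k)
  have "gram_power m n x (Suc k) i j = (\<Sum>s<n. \<Sum>r<n. l r ^ k * q i r * (gram m x j s * q s r))"
    using Suc by (simp add: sum_distrib_right sum_distrib_left gram_def mult_ac)
  also have "\<dots> = (\<Sum>r<n. l r ^ k * q i r * (\<Sum>s<n. gram m x j s * q s r))"
    by (subst sum.swap) (simp add: sum_distrib_left)
  also have "\<dots> = (\<Sum>r<n. l r ^ Suc k * (q i r * q j r))"
    using Suc.prems by (intro sum.cong refl) (simp add: eigenvector)
  finally show ?case .
qed

lemma top_proj:
  assumes simple: "l 0 > 0" "\<And>k. 0 < k \<Longrightarrow> k < n \<Longrightarrow> l k < l 0" and ij: "i < n" "j < n"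
  shows "top_proj m n x i j = q i 0 * q j 0"
proof -
  have lim: "(\<lambda>k. \<Sum>r<n. (l r / l 0) ^ k * c r) \<longlonglongrightarrow> c 0" for c :: "nat \<Rightarrow> real"
  proof -
    have "(\<lambda>k. \<Sum>r<n. (l r / l 0) ^ k * c r) \<longlonglongrightarrow> (\<Sum>r<n. if r = 0 then c r else 0)"
    proof (rule tendsto_sum)
      fix r assume r: "r \<in> {..<n}"
      show "(\<lambda>k. (l r / l 0) ^ k * c r) \<longlonglongrightarrow> (if r = 0 then c r else 0)"
      proof (cases "r = 0")
        case True
        then show ?thesis using simple by simp
      next
        case False
        have "\<bar>l r / l 0\<bar> < 1" using simple(2)[of r] simple(1) l_nonneg[of r] False r by simp
        then have "(\<lambda>k. (l r / l 0) ^ k) \<longlonglongrightarrow> 0" by (intro LIMSEQ_power_zero) simp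
        then have "(\<lambda>k. (l r / l 0) ^ k * c r) \<longlonglongrightarrow> 0 * c r" by (intro tendsto_mult_right)
        then show ?thesis using False by simp
      qed
    qed
    then show ?thesis using n by simp
  qed
  have "gram_power m n x k i j / (\<Sum>r<n. gram_power m n x k r r) =
     (\<Sum>r<n. (l r / l 0) ^ k * (q i r * q j r)) / (\<Sum>r<n. (l r / l 0) ^ k * 1)" for k
  proof -
    have "(\<Sum>r<n. gram_power m n x k r r) = (\<Sum>r<n. \<Sum>s<n. l s ^ k * (q r s * q r s))" by (simp add: gram_power)
    also have "\<dots> = (\<Sum>s<n. l s ^ k * (\<Sum>r<n. q r s * q r s))" by (subst sum.swap) (simp add: sum_distrib_left)
    also have "\<dots> = (\<Sum>s<n. l s ^ k)" by (simp add: orth_cols[OF q])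
    finally have tr: "(\<Sum>r<n. gram_power m n x k r r) = (\<Sum>s<n. l s ^ k)" .
    have "(\<Sum>r<n. (l r / l 0) ^ k * (q i r * q j r)) = (\<Sum>r<n. l r ^ k * (q i r * q j r)) / l 0 ^ k"
      "(\<Sum>r<n. (l r / l 0) ^ k * 1) = (\<Sum>s<n. l s ^ k) / l 0 ^ k"
      by (simp_all add: power_divide sum_divide_distrib)
    then show ?thesis unfolding tr gram_power[OF ij] using simple(1) by simp
  qed
  moreover have "(\<lambda>k. (\<Sum>r<n. (l r / l 0) ^ k * (q i r * q j r)) / (\<Sum>r<n. (l r / l 0) ^ k * 1)) \<longlonglongrightarrow> (q i 0 * q j 0) / 1"
    by (intro tendsto_divide lim) simp
  ultimately show ?thesis unfolding top_proj_def by (intro limI) simp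
qed

lemma rotate:
  assumes y: "orthogonal_rows n y"
  shows "gram_spectrum m n (mul_transpose m n x y) (\<lambda>i k. \<Sum>r<n. y (i, r) * q r k) l"
proof
  have y': "orth {..<n} (\<lambda>j l. y (j, l))" using y by (simp add: orthogonal_rows_iff_orth)
  show "orth {..<n} (\<lambda>i k. \<Sum>r<n. y (i, r) * q r k)"
    unfolding orth_def using orth_inner[OF finite_lessThan y'] orth_cols[OF q] by simp
  fix i j assume ij: "i < n" "j < n"
  have "gram m (mul_transpose m n x y) i j = (\<Sum>a<m. (\<Sum>r<n. x (a, r) * y (i, r)) * (\<Sum>r<n. x (a, r) * y (j, r)))"
    using ij by (simp add: gram_def mul_transpose_def)
  also have "\<dots> = (\<Sum>k<n. l k * ((\<Sum>r<n. y (i, r) * q r k) * (\<Sum>r<n. y (j, r) * q r k)))"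
    unfolding gram_quadratic by (simp add: mult.commute)
  finally show "gram m (mul_transpose m n x y) i j = (\<Sum>k<n. l k * ((\<Sum>r<n. y (i, r) * q r k) * (\<Sum>r<n. y (j, r) * q r k)))" .
qed (use m n l in auto)

end

section \<open>Averaging over the orthogonal group\<close>

definition sign_corr :: "nat \<Rightarrow> nat \<Rightarrow> (nat \<times> nat \<Rightarrow> real) \<Rightarrow> real" where
  "sign_corr n k z = (\<Sum>i<n. z (i, k) * sign_pm (z (i, 0)))\<^sup>2"

text \<open>A sign-free description of the quantity of interest: \<open>sign_pm\<close> of an entry \<open>q i 0 * q j 0\<close> of the
projection is the product of the signs, whichever of the two unit eigenvectors was chosen.\<close>

definition score :: "nat \<Rightarrow> nat \<Rightarrow> (nat \<times> nat \<Rightarrow> real) \<Rightarrow> real" where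
  "score m n x = (\<Sum>i<n. \<Sum>j<n. gram m x i j * sign_pm (top_proj m n x i j))"

lemma measurable_sign_pm [measurable]: "sign_pm \<in> borel_measurable borel"
  unfolding sign_pm_def by measurable

lemma measurable_sign_corr [measurable]: "sign_corr n k \<in> borel_measurable (arrays I)"
  unfolding sign_corr_def by measurable

lemma measurable_score [measurable]: "score m n \<in> borel_measurable (arrays I)"
  unfolding score_def by measurable

lemma sign_pm_mult: "a \<noteq> 0 \<Longrightarrow> b \<noteq> 0 \<Longrightarrow> sign_pm (a * b) = sign_pm a * sign_pm b"
  by (auto simp: sign_pm_def zero_le_mult_iff)

lemma sign_pm_square: "sign_pm a * sign_pm a = 1"
  by (simp add: sign_pm_def)

lemma (in gram_spectrum) score_eq:
  assumes nd: "nondeg (m + n) m n x \<or> (l 0 > 0 \<and> (\<forall>k. 0 < k \<longrightarrow> k < n \<longrightarrow> l k < l 0))"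
    and nz: "\<And>i. i < n \<Longrightarrow> q i 0 \<noteq> 0"
  shows "score m n x = (\<Sum>k<n. l k * (\<Sum>i<n. q i k * sign_pm (q i 0))\<^sup>2)"
proof -
  have P: "top_proj m n x i j = q i 0 * q j 0" if "i < n" "j < n" for i j
    using nd top_eigenvalue_simple that by (intro top_proj) auto
  have "score m n x = (\<Sum>i<n. \<Sum>j<n. gram m x i j * (sign_pm (q i 0) * sign_pm (q j 0)))"
    unfolding score_def using nz by (intro sum.cong refl) (simp add: P sign_pm_mult)
  then show ?thesis by (simp add: spectral_sign_form)
qed

lemma sum_sign_corr:
  assumes "orthogonal_rows n z"
  shows "(\<Sum>k<n. sign_corr n k z) = real n"
proof -
  have "(\<Sum>k<n. sign_corr n k z) = (\<Sum>k<n. (\<Sum>i<n. z (i, k) * sign_pm (z (i, 0))) * (\<Sum>i<n. z (i, k) * sign_pm (z (i, 0))))"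
    by (simp add: sign_corr_def power2_eq_square)
  also have "\<dots> = (\<Sum>i<n. sign_pm (z (i, 0)) * sign_pm (z (i, 0)))"
    by (rule orth_inner) (use assms in \<open>auto simp: orthogonal_rows_def orth_def\<close>)
  finally show ?thesis by (simp add: sign_pm_square)
qed

lemma sign_corr_0: "sign_corr n 0 z = (\<Sum>i<n. \<bar>z (i, 0)\<bar>)\<^sup>2"
  by (simp add: sign_corr_def sign_pm_def abs_if if_distrib cong: if_cong)
     (rule arg_cong[where f="\<lambda>x. x\<^sup>2"], rule sum.cong, auto)

lemma AE_haar_mul_transpose:
  assumes y: "orthogonal_rows n y" and P[measurable]: "Measurable.pred (arrays (idx n n)) P"
    and "AE x in haar n. P x"
  shows "AE x in haar n. P (mul_transpose n n x y)"
proof -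
  have [measurable]: "(\<lambda>x. mul_transpose n n x y) \<in> measurable (arrays (idx n n)) (arrays (idx n n))"
    unfolding mul_transpose_def by measurable
  have "(\<integral>\<^sup>+x. (if P (mul_transpose n n x y) then 0 else 1) \<partial>haar n) = (\<integral>\<^sup>+x. (if P x then 0 else 1) \<partial>haar n)"
    by (rule nn_integral_haar_mul_transpose[OF y, of "\<lambda>x. if P x then 0 else 1"]) measurable
  also have "\<dots> = (\<integral>\<^sup>+x. 0 \<partial>haar n)" using assms(3) by (intro nn_integral_cong_AE) auto
  finally have z: "(\<integral>\<^sup>+x. (if P (mul_transpose n n x y) then 0 else 1) \<partial>haar n) = 0" by simp
  have "AE x in haar n. (if P (mul_transpose n n x y) then 0 else 1 :: ennreal) = 0"
    using z by (subst (asm) nn_integral_0_iff_AE) measurable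
  then show ?thesis by eventually_elim (metis zero_neq_one)
qed

definition haar_corr :: "nat \<Rightarrow> nat \<Rightarrow> ennreal" where
  "haar_corr n k = (\<integral>\<^sup>+z. ennreal (sign_corr n k z) \<partial>haar n)"

text \<open>Exchanging two columns other than the first one is a right multiplication by an orthogonal
matrix.\<close>

lemma haar_corr_eq:
  assumes k: "0 < k" "k < n" "1 < n"
  shows "haar_corr n k = haar_corr n 1"
proof -
  define \<pi> where "\<pi> = Transposition.transpose 1 k"
  have \<pi>: "\<pi> j < n" if "j < n" for j using that k by (auto simp: \<pi>_def Transposition.transpose_def)
  have \<pi>\<pi>: "\<pi> (\<pi> j) = j" for j by (simp add: \<pi>_def)
  \<comment> \<open>the permutation matrix of \<open>\<pi>\<close>\<close>
  define y where "y = (\<lambda>p :: nat \<times> nat. of_bool (snd p = \<pi> (fst p)) :: real)"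
  have y: "orthogonal_rows n y"
    unfolding orthogonal_rows_def
  proof (intro allI impI)
    fix i j assume ij: "i < n" "j < n"
    have "(\<Sum>l<n. y (i, l) * y (j, l)) = (\<Sum>l<n. if l = \<pi> i then of_bool (\<pi> i = \<pi> j) else 0)"
      by (intro sum.cong) (auto simp: y_def)
    also have "\<dots> = of_bool (\<pi> i = \<pi> j)" using \<pi>[OF ij(1)] by simp
    also have "\<dots> = (if i = j then 1 else 0)" using \<pi>\<pi>[of i] \<pi>\<pi>[of j] by auto
    finally show "(\<Sum>l<n. y (i, l) * y (j, l)) = (if i = j then 1 else 0)" .
  qed
  have mz: "mul_transpose n n z y (i, j) = z (i, \<pi> j)" if "i < n" "j < n" for z i j
  proof -
    have "mul_transpose n n z y (i, j) = (\<Sum>l<n. if l = \<pi> j then z (i, l) else 0)"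
      using that by (auto simp: mul_transpose_def y_def intro!: sum.cong)
    then show ?thesis using \<pi>[OF that(2)] by simp
  qed
  have "\<pi> 0 = 0" "\<pi> 1 = k" using k by (auto simp: \<pi>_def Transposition.transpose_def)
  then have "sign_corr n 1 (mul_transpose n n z y) = sign_corr n k z" for z
    using k by (simp add: sign_corr_def mz)
  then show ?thesis
    using nn_integral_haar_mul_transpose[OF y, of "\<lambda>z. ennreal (sign_corr n 1 z)"] by (simp add: haar_corr_def)
qed

lemma sum_haar_corr: "(\<Sum>k<n. haar_corr n k) = ennreal (real n)"
proof -
  have "(\<Sum>k<n. haar_corr n k) = (\<integral>\<^sup>+z. ennreal (\<Sum>k<n. sign_corr n k z) \<partial>haar n)"
    unfolding haar_corr_def by (subst nn_integral_sum[symmetric]) (auto simp: sign_corr_def)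
  also have "\<dots> = (\<integral>\<^sup>+z. ennreal (real n) \<partial>haar n)"
  proof (rule nn_integral_cong_AE)
    show "AE z in haar n. ennreal (\<Sum>k<n. sign_corr n k z) = ennreal (real n)"
      using AE_haar_orthogonal by eventually_elim (simp add: sum_sign_corr)
  qed
  finally show ?thesis by (simp add: prob_space.emeasure_space_1[OF prob_space_haar])
qed

definition haar_l1_moment :: "nat \<Rightarrow> real" where
  "haar_l1_moment n = enn2real (haar_corr n 0)"

text \<open>The \<open>n\<close> numbers \<open>haar_corr n k\<close> have sum \<open>n\<close>, and all but the first coincide.\<close>

lemma haar_corr_values:
  assumes n: "n \<ge> 2"
  shows "haar_corr n 0 = ennreal (haar_l1_moment n)" "0 \<le> haar_l1_moment n" "haar_l1_moment n \<le> real n"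
    and "\<And>k. 0 < k \<Longrightarrow> k < n \<Longrightarrow> haar_corr n k = ennreal ((real n - haar_l1_moment n) / (real n - 1))"
proof -
  obtain n' where n': "n = Suc n'" using n by (cases n) auto
  have "(\<Sum>k<n. haar_corr n k) = haar_corr n 0 + (\<Sum>k<n'. haar_corr n (Suc k))"
    unfolding n' by (rule sum.lessThan_Suc_shift)
  also have "(\<Sum>k<n'. haar_corr n (Suc k)) = (\<Sum>k<n'. haar_corr n 1)"
    using n n' by (intro sum.cong refl haar_corr_eq) auto
  finally have eq: "haar_corr n 0 + of_nat n' * haar_corr n 1 = ennreal (real n)" by (simp add: sum_haar_corr)
  have le: "haar_corr n 0 \<le> ennreal (real n)" unfolding eq[symmetric] by simp
  then show h0: "haar_corr n 0 = ennreal (haar_l1_moment n)" unfolding haar_l1_moment_def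
    by (metis ennreal_enn2real ennreal_less_top order_le_less_trans)
  show c: "0 \<le> haar_l1_moment n" by (simp add: haar_l1_moment_def)
  show c': "haar_l1_moment n \<le> real n" using le unfolding h0 by (simp add: ennreal_le_iff)
  have "of_nat n' * haar_corr n 1 \<noteq> Orderings.top" using eq by (metis ennreal_add_eq_top ennreal_neq_top)
  then have nt: "haar_corr n 1 \<noteq> Orderings.top" using n n' by (auto simp: ennreal_mult_eq_top_iff)
  then obtain c where c1: "haar_corr n 1 = ennreal c" "c \<ge> 0" by (metis ennreal_cases)
  have "ennreal (haar_l1_moment n + real n' * c) = ennreal (real n)"
    using eq c c1 by (simp add: h0 ennreal_of_nat_eq_real_of_nat ennreal_plus ennreal_mult)
  then have "haar_l1_moment n + real n' * c = real n" using c c1 by (subst (asm) ennreal_inj) auto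
  then have "c = (real n - haar_l1_moment n) / (real n - 1)" using n n' by (simp add: field_simps)
  then show "haar_corr n k = ennreal ((real n - haar_l1_moment n) / (real n - 1))" if "0 < k" "k < n" for k
    using haar_corr_eq[OF that] n c1 by simp
qed

lemma haar_l1_moment_limit: "n \<ge> 2 \<Longrightarrow> \<bar>haar_l1_moment n / real n - 2 / pi\<bar> \<le> 5 / sqrt (real n)"
proof -
  assume n: "n \<ge> 2"
  interpret prob_space "haar n" by (rule prob_space_haar)
  define f where "f = sign_corr n 0"
  have fm: "f \<in> borel_measurable (haar n)" unfolding f_def by measurable
  have f0: "f z \<ge> 0" for z by (simp add: f_def sign_corr_def)
  have nf: "(\<integral>\<^sup>+z. ennreal (f z) \<partial>haar n) = ennreal (haar_l1_moment n)"
    using haar_corr_values(1)[OF n] by (simp add: haar_corr_def f_def)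
  have fi: "integrable (haar n) f"
    by (rule integrableI_nonneg[OF fm]) (auto simp: f0 nf)
  have If: "expectation f = haar_l1_moment n"
    using nn_integral_eq_integral[OF fi] f0 nf haar_corr_values(2)[OF n]
    by (auto simp: integral_nonneg_AE)
  have gi: "integrable (haar n) (\<lambda>z. f z / real n - 2 / pi)" using fi by simp
  have "haar_l1_moment n / real n - 2 / pi = expectation (\<lambda>z. f z / real n - 2 / pi)" using fi If prob_space by simp
  then have "\<bar>haar_l1_moment n / real n - 2 / pi\<bar> \<le> expectation (\<lambda>z. \<bar>f z / real n - 2 / pi\<bar>)" by simp
  moreover have "ennreal (expectation (\<lambda>z. \<bar>f z / real n - 2 / pi\<bar>)) \<le> ennreal (5 / sqrt (real n))"
    using haar_column_concentration[of n] n nn_integral_eq_integral[OF integrable_abs[OF gi]]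
    by (simp add: f_def sign_corr_0)
  ultimately show ?thesis by (subst (asm) ennreal_le_iff) auto
qed

section \<open>The spectral statistics of a Gaussian matrix\<close>

locale gaussian_spectrum = prob_space M for M :: "'a measure" +
  fixes m n :: nat and X :: "'a \<Rightarrow> nat \<times> nat \<Rightarrow> real" and q :: "'a \<Rightarrow> nat \<Rightarrow> nat \<Rightarrow> real" and l :: "'a \<Rightarrow> nat \<Rightarrow> real"
  assumes m: "m \<ge> 1" and n: "n \<ge> 2"
    and X [measurable]: "X \<in> measurable M (arrays (idx m n))"
    and law: "distr M (arrays (idx m n)) X = gauss (idx m n)"
    and q [measurable]: "\<And>i k. i < n \<Longrightarrow> k < n \<Longrightarrow> (\<lambda>\<omega>. q \<omega> i k) \<in> borel_measurable M"
    and spectrum: "\<And>\<omega>. \<omega> \<in> space M \<Longrightarrow> gram_spectrum m n (X \<omega>) (q \<omega>) (l \<omega>)"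
begin

lemma nn_integral_law:
  assumes "f \<in> borel_measurable (arrays (idx m n))"
  shows "(\<integral>\<^sup>+\<omega>. f (X \<omega>) \<partial>M) = (\<integral>\<^sup>+x. f x \<partial>gauss (idx m n))"
  unfolding law[symmetric] by (rule nn_integral_distr[symmetric]) (use assms in auto)

lemma AE_law:
  assumes P: "Measurable.pred (arrays (idx m n)) P" and "AE x in gauss (idx m n). P x"
  shows "AE \<omega> in M. P (X \<omega>)"
  using assms(2) unfolding law[symmetric] by (subst (asm) AE_distr_iff) (use P in auto)

definition regular :: "'a \<Rightarrow> bool" where
  "regular \<omega> \<longleftrightarrow> \<omega> \<in> space M \<and> nondeg (m + n) m n (X \<omega>)"

lemma AE_regular: "AE \<omega> in M. regular \<omega>"
  using AE_law[OF measurable_nondeg AE_nondeg] AE_space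
  by eventually_elim (simp add: regular_def)

text \<open>Averaging over an independent Haar matrix costs nothing, since for every fixed orthogonal matrix the
law of the product is that of \<open>X\<close>.\<close>

lemma nn_integral_average:
  assumes f[measurable]: "f \<in> borel_measurable (arrays (idx m n))"
  shows "(\<integral>\<^sup>+\<omega>. f (X \<omega>) \<partial>M) = (\<integral>\<^sup>+\<omega>. \<integral>\<^sup>+y. f (mul_transpose m n (X \<omega>) y) \<partial>haar n \<partial>M)"
proof -
  interpret H: prob_space "haar n" by (rule prob_space_haar)
  interpret P: pair_sigma_finite "haar n" M
    by (simp add: pair_sigma_finite_def prob_space_haar prob_space_imp_sigma_finite prob_space_axioms)
  have "(\<integral>\<^sup>+\<omega>. f (X \<omega>) \<partial>M) = (\<integral>\<^sup>+y. \<integral>\<^sup>+\<omega>. f (X \<omega>) \<partial>M \<partial>haar n)" by (simp add: H.emeasure_space_1)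
  also have "\<dots> = (\<integral>\<^sup>+y. \<integral>\<^sup>+\<omega>. f (mul_transpose m n (X \<omega>) y) \<partial>M \<partial>haar n)"
  proof (rule nn_integral_cong_AE)
    show "AE y in haar n. (\<integral>\<^sup>+\<omega>. f (X \<omega>) \<partial>M) = (\<integral>\<^sup>+\<omega>. f (mul_transpose m n (X \<omega>) y) \<partial>M)"
      using AE_haar_orthogonal
    proof eventually_elim
      case (elim y)
      have mm: "(\<lambda>x. mul_transpose m n x y) \<in> measurable (arrays (idx m n)) (arrays (idx m n))"
        unfolding mul_transpose_def by measurable
      show ?case
        using nn_integral_law[OF measurable_compose[OF mm f]] nn_integral_gauss_mul_transpose[OF elim f] nn_integral_law[OF f]
        by simp
    qed
  qed
  also have "\<dots> = (\<integral>\<^sup>+\<omega>. \<integral>\<^sup>+y. f (mul_transpose m n (X \<omega>) y) \<partial>haar n \<partial>M)"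
    by (rule P.Fubini'[symmetric]) measurable
  finally show ?thesis .
qed

definition qT :: "'a \<Rightarrow> nat \<times> nat \<Rightarrow> real" where
  "qT \<omega> = (\<lambda>p. q \<omega> (snd p) (fst p))"

lemma orthogonal_qT: "\<omega> \<in> space M \<Longrightarrow> orthogonal_rows n (qT \<omega>)"
  using gram_spectrum.q[OF spectrum] by (simp add: orthogonal_rows_def qT_def orth_def)

lemma rotated:
  assumes "regular \<omega>" "orthogonal_rows n y"
  shows "i < n \<Longrightarrow> j < n \<Longrightarrow> top_proj m n (mul_transpose m n (X \<omega>) y) i j = mul_transpose n n y (qT \<omega>) (i, 0) * mul_transpose n n y (qT \<omega>) (j, 0)"
    and "(\<And>i. i < n \<Longrightarrow> mul_transpose n n y (qT \<omega>) (i, 0) \<noteq> 0) \<Longrightarrow>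
      score m n (mul_transpose m n (X \<omega>) y) = (\<Sum>k<n. l \<omega> k * sign_corr n k (mul_transpose n n y (qT \<omega>)))"
proof -
  interpret G: gram_spectrum m n "X \<omega>" "q \<omega>" "l \<omega>" using assms by (auto simp: regular_def intro: spectrum)
  interpret R: gram_spectrum m n "mul_transpose m n (X \<omega>) y" "\<lambda>i k. \<Sum>r<n. y (i, r) * q \<omega> r k" "l \<omega>"
    by (rule G.rotate[OF assms(2)])
  have simple: "l \<omega> 0 > 0 \<and> (\<forall>k. 0 < k \<longrightarrow> k < n \<longrightarrow> l \<omega> k < l \<omega> 0)"
    using G.top_eigenvalue_simple assms(1) by (auto simp: regular_def)
  have e: "(\<Sum>r<n. y (i, r) * q \<omega> r k) = mul_transpose n n y (qT \<omega>) (i, k)" if "i < n" "k < n" for i k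
    using that by (simp add: mul_transpose_def qT_def)
  show "i < n \<Longrightarrow> j < n \<Longrightarrow> top_proj m n (mul_transpose m n (X \<omega>) y) i j = mul_transpose n n y (qT \<omega>) (i, 0) * mul_transpose n n y (qT \<omega>) (j, 0)"
    using R.top_proj[of i j] simple by (simp add: e)
  assume nz: "\<And>i. i < n \<Longrightarrow> mul_transpose n n y (qT \<omega>) (i, 0) \<noteq> 0"
  have "score m n (mul_transpose m n (X \<omega>) y) = (\<Sum>k<n. l \<omega> k * (\<Sum>i<n. (\<Sum>r<n. y (i, r) * q \<omega> r k) * sign_pm (\<Sum>r<n. y (i, r) * q \<omega> r 0))\<^sup>2)"
    by (rule R.score_eq) (use simple nz e n in auto)
  then show "score m n (mul_transpose m n (X \<omega>) y) = (\<Sum>k<n. l \<omega> k * sign_corr n k (mul_transpose n n y (qT \<omega>)))"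
    by (simp add: e sign_corr_def)
qed

lemma top_proj_eq:
  "regular \<omega> \<Longrightarrow> i < n \<Longrightarrow> j < n \<Longrightarrow> top_proj m n (X \<omega>) i j = q \<omega> i 0 * q \<omega> j 0"
proof -
  assume r: "regular \<omega>" and ij: "i < n" "j < n"
  interpret G: gram_spectrum m n "X \<omega>" "q \<omega>" "l \<omega>" using r by (auto simp: regular_def intro: spectrum)
  show ?thesis using G.top_proj G.top_eigenvalue_simple r ij by (auto simp: regular_def)
qed

text \<open>The chosen eigenvector need not be a nice function of the matrix, but whether one of its coordinates
vanishes can be seen on the diagonal of the projection, to which averaging applies.\<close>

lemma AE_top_nonzero: "AE \<omega> in M. \<forall>i<n. q \<omega> i 0 \<noteq> 0"
proof -
  define f :: "(nat \<times> nat \<Rightarrow> real) \<Rightarrow> ennreal" where "f = (\<lambda>x. if \<forall>i<n. top_proj m n x i i \<noteq> 0 then 0 else 1)"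
  have [measurable]: "f \<in> borel_measurable (arrays (idx m n))" unfolding f_def by measurable
  have "(\<integral>\<^sup>+\<omega>. f (X \<omega>) \<partial>M) = (\<integral>\<^sup>+\<omega>. \<integral>\<^sup>+y. f (mul_transpose m n (X \<omega>) y) \<partial>haar n \<partial>M)"
    by (rule nn_integral_average) measurable
  also have "\<dots> = (\<integral>\<^sup>+\<omega>. 0 \<partial>M)"
  proof (rule nn_integral_cong_AE)
    show "AE \<omega> in M. (\<integral>\<^sup>+y. f (mul_transpose m n (X \<omega>) y) \<partial>haar n) = 0"
      using AE_regular
    proof eventually_elim
      case (elim \<omega>)
      then have o: "orthogonal_rows n (qT \<omega>)" by (auto simp: regular_def intro: orthogonal_qT)
      have "AE y in haar n. \<forall>i<n. mul_transpose n n y (qT \<omega>) (i, 0) \<noteq> 0"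
        by (rule AE_haar_mul_transpose[OF o _ AE_haar_column_nonzero]) measurable
      with AE_haar_orthogonal have "AE y in haar n. f (mul_transpose m n (X \<omega>) y) = 0"
        by eventually_elim (simp add: f_def rotated(1)[OF elim])
      then have "(\<integral>\<^sup>+y. f (mul_transpose m n (X \<omega>) y) \<partial>haar n) = (\<integral>\<^sup>+y. 0 \<partial>haar n)" by (rule nn_integral_cong_AE)
      then show ?case by simp
    qed
  qed
  finally have "(\<integral>\<^sup>+\<omega>. f (X \<omega>) \<partial>M) = 0" by simp
  then have "AE \<omega> in M. f (X \<omega>) = 0" by (subst (asm) nn_integral_0_iff_AE) auto
  with AE_regular show ?thesis
    by eventually_elim (auto simp: f_def top_proj_eq split: if_splits)
qed

lemma l1_concentration:
  "(\<integral>\<^sup>+\<omega>. ennreal \<bar>(\<Sum>i<n. \<bar>q \<omega> i 0\<bar>)\<^sup>2 / real n - 2 / pi\<bar> \<partial>M) \<le> ennreal (5 / sqrt (real n))"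
proof -
  define f where "f = (\<lambda>x. ennreal \<bar>(\<Sum>i<n. \<Sum>j<n. \<bar>top_proj m n x i j\<bar>) / real n - 2 / pi\<bar>)"
  have [measurable]: "f \<in> borel_measurable (arrays (idx m n))" unfolding f_def by measurable
  have sq: "(\<Sum>i<n. \<Sum>j<n. \<bar>u i * u j\<bar>) = (\<Sum>i<n. \<bar>u i\<bar>)\<^sup>2" for u :: "nat \<Rightarrow> real"
    by (simp add: power2_eq_square sum_product abs_mult)
  have "(\<integral>\<^sup>+\<omega>. ennreal \<bar>(\<Sum>i<n. \<bar>q \<omega> i 0\<bar>)\<^sup>2 / real n - 2 / pi\<bar> \<partial>M) = (\<integral>\<^sup>+\<omega>. f (X \<omega>) \<partial>M)"
  proof (rule nn_integral_cong_AE)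
    show "AE \<omega> in M. ennreal \<bar>(\<Sum>i<n. \<bar>q \<omega> i 0\<bar>)\<^sup>2 / real n - 2 / pi\<bar> = f (X \<omega>)"
      using AE_regular by eventually_elim (simp add: f_def top_proj_eq sq)
  qed
  also have "\<dots> = (\<integral>\<^sup>+\<omega>. \<integral>\<^sup>+y. f (mul_transpose m n (X \<omega>) y) \<partial>haar n \<partial>M)"
    by (rule nn_integral_average) measurable
  also have "\<dots> \<le> (\<integral>\<^sup>+\<omega>. ennreal (5 / sqrt (real n)) \<partial>M)"
  proof (rule nn_integral_mono_AE)
    show "AE \<omega> in M. (\<integral>\<^sup>+y. f (mul_transpose m n (X \<omega>) y) \<partial>haar n) \<le> ennreal (5 / sqrt (real n))"
      using AE_regular
    proof eventually_elim
      case (elim \<omega>)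
      then have o: "orthogonal_rows n (qT \<omega>)" by (auto simp: regular_def intro: orthogonal_qT)
      define g where "g = (\<lambda>z :: nat \<times> nat \<Rightarrow> real. ennreal \<bar>(\<Sum>i<n. \<bar>z (i, 0)\<bar>)\<^sup>2 / real n - 2 / pi\<bar>)"
      have [measurable]: "g \<in> borel_measurable (arrays (idx n n))" unfolding g_def by measurable
      have "(\<integral>\<^sup>+y. f (mul_transpose m n (X \<omega>) y) \<partial>haar n) = (\<integral>\<^sup>+y. g (mul_transpose n n y (qT \<omega>)) \<partial>haar n)"
      proof (rule nn_integral_cong_AE)
        show "AE y in haar n. f (mul_transpose m n (X \<omega>) y) = g (mul_transpose n n y (qT \<omega>))"
          using AE_haar_orthogonal by eventually_elim (simp add: f_def g_def rotated(1)[OF elim] sq)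
      qed
      also have "\<dots> = (\<integral>\<^sup>+z. g z \<partial>haar n)" by (rule nn_integral_haar_mul_transpose[OF o]) measurable
      also have "\<dots> \<le> ennreal (5 / sqrt (real n))"
        unfolding g_def by (rule haar_column_concentration) (use n in auto)
      finally show ?case .
    qed
  qed
  finally show ?thesis by (simp add: emeasure_space_1)
qed

definition trace :: "'a \<Rightarrow> real" where
  "trace \<omega> = (\<Sum>i<n. gram m (X \<omega>) i i)"

text \<open>The objective \<open>r_eig\<close> in spectral form.\<close>

definition r :: "'a \<Rightarrow> real" where
  "r \<omega> = (\<Sum>k<n. l \<omega> k * (\<Sum>i<n. q \<omega> i k * sign_pm (q \<omega> i 0))\<^sup>2)"

lemma top_eq: "\<omega> \<in> space M \<Longrightarrow> l \<omega> 0 = (\<Sum>a<m. (\<Sum>j<n. X \<omega> (a, j) * q \<omega> j 0)\<^sup>2)"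
  using gram_spectrum.eigenvalue_norm[OF spectrum, of \<omega> 0] n by simp

lemma measurable_X [measurable]: "(\<lambda>\<omega>. X \<omega> p) \<in> borel_measurable M"
  using measurable_compose[OF X measurable_coord] .

lemma measurable_top [measurable]: "(\<lambda>\<omega>. l \<omega> 0) \<in> borel_measurable M"
proof -
  have "(\<lambda>\<omega>. l \<omega> 0) \<in> borel_measurable M \<longleftrightarrow>
    (\<lambda>\<omega>. \<Sum>a<m. (\<Sum>j<n. X \<omega> (a, j) * q \<omega> j 0)\<^sup>2) \<in> borel_measurable M"
    by (rule measurable_cong) (rule top_eq)
  moreover have "(\<lambda>\<omega>. \<Sum>a<m. (\<Sum>j<n. X \<omega> (a, j) * q \<omega> j 0)\<^sup>2) \<in> borel_measurable M"
    using n by (intro borel_measurable_sum borel_measurable_power borel_measurable_times measurable_X q) auto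
  ultimately show ?thesis by simp
qed

lemma top_le_trace: "\<omega> \<in> space M \<Longrightarrow> 0 \<le> l \<omega> 0 \<and> l \<omega> 0 \<le> trace \<omega>"
proof -
  assume w: "\<omega> \<in> space M"
  interpret G: gram_spectrum m n "X \<omega>" "q \<omega>" "l \<omega>" by (rule spectrum[OF w])
  have "l \<omega> 0 \<le> (\<Sum>k<n. l \<omega> k)" using n G.l_nonneg by (intro member_le_sum) auto
  then show ?thesis using G.sum_l G.l_nonneg[of 0] n by (simp add: trace_def)
qed

lemma nn_integral_trace: "(\<integral>\<^sup>+\<omega>. ennreal (trace \<omega>) \<partial>M) = ennreal (real m * real n)"
proof -
  have "(\<integral>\<^sup>+\<omega>. ennreal (trace \<omega>) \<partial>M) = (\<integral>\<^sup>+\<omega>. ennreal (\<Sum>i<n. \<Sum>a<m. (X \<omega> (a, i))\<^sup>2) \<partial>M)"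
    by (simp add: trace_def gram_def power2_eq_square)
  also have "\<dots> = (\<integral>\<^sup>+\<omega>. (\<Sum>i<n. \<Sum>a<m. ennreal ((X \<omega> (a, i))\<^sup>2)) \<partial>M)" by (simp add: sum_nonneg)
  also have "\<dots> = (\<Sum>i<n. \<Sum>a<m. \<integral>\<^sup>+\<omega>. ennreal ((X \<omega> (a, i))\<^sup>2) \<partial>M)"
    by (subst nn_integral_sum, simp)+ simp
  also have "\<dots> = (\<Sum>i<n. \<Sum>a<m. 1)"
  proof (intro sum.cong refl)
    fix i a assume ia: "i \<in> {..<n}" "a \<in> {..<m}"
    have "(\<integral>\<^sup>+\<omega>. ennreal ((X \<omega> (a, i))\<^sup>2) \<partial>M) = (\<integral>\<^sup>+x. ennreal ((x (a, i))\<^sup>2) \<partial>gauss (idx m n))"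
      by (rule nn_integral_law) measurable
    also have "\<dots> = (\<integral>\<^sup>+x. (\<lambda>x. ennreal ((\<Sum>j<1. x j)\<^sup>2)) (\<lambda>j\<in>{..<1::nat}. x ((\<lambda>_. (a, i)) j)) \<partial>gauss (idx m n))" by simp
    also have "\<dots> = (\<integral>\<^sup>+x. ennreal ((\<Sum>j<1. x j)\<^sup>2) \<partial>gauss {..<1::nat})"
      using ia by (intro nn_integral_gauss_reindex) (auto simp: inj_on_def)
    also have "\<dots> = ennreal (real 1 * 1)"
      using integrable_std_normal_distribution_moment[of 1] integrable_std_normal_distribution_moment[of 2]
        integral_std_normal_distribution_moment_odd[of 1] std_normal_moments(1)
      by (intro nn_integral_sum_square[where f="\<lambda>t. t"]) auto
    finally show "(\<integral>\<^sup>+\<omega>. ennreal ((X \<omega> (a, i))\<^sup>2) \<partial>M) = 1" by simp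
  qed
  finally show ?thesis by (simp add: ennreal_of_nat_eq_real_of_nat ennreal_mult mult.commute)
qed

lemma measurable_trace [measurable]: "trace \<in> borel_measurable M"
  unfolding trace_def gram_def by measurable

lemma trace_nonneg: "trace \<omega> \<ge> 0"
  by (auto simp: trace_def gram_def intro!: sum_nonneg)

lemma integrable_trace: "integrable M trace"
  by (rule integrableI_nonneg) (auto simp: nn_integral_trace trace_nonneg)

lemma expectation_trace: "expectation trace = real m * real n"
  using nn_integral_eq_integral[OF integrable_trace] trace_nonneg nn_integral_trace
  by (simp add: integral_nonneg_AE)

lemma integrable_top: "integrable M (\<lambda>\<omega>. l \<omega> 0)"
proof (rule Bochner_Integration.integrable_bound[OF integrable_trace])
  show "AE \<omega> in M. norm (l \<omega> 0) \<le> norm (trace \<omega>)"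
    using AE_space by eventually_elim (use top_le_trace trace_nonneg in auto)
qed measurable

text \<open>Given \<open>X \<omega>\<close>, the averaged eigenvectors are the columns of a Haar matrix \<open>z\<close>, because the
eigenvector matrix is absorbed by the invariance.  Hence the inner integral replaces the squared
inner products by the numbers \<open>haar_corr n k\<close>, independently of \<open>X \<omega>\<close>.\<close>

theorem nn_integral_r:
  "(\<integral>\<^sup>+\<omega>. ennreal (r \<omega>) \<partial>M) =
    ennreal (haar_l1_moment n * expectation (\<lambda>\<omega>. l \<omega> 0) + (real n - haar_l1_moment n) / (real n - 1) * (real m * real n - expectation (\<lambda>\<omega>. l \<omega> 0)))"
proof -
  define c1 where "c1 = (real n - haar_l1_moment n) / (real n - 1)"
  note hc = haar_corr_values[OF n, folded c1_def]
  have c1: "c1 \<ge> 0" using hc(3) n by (simp add: c1_def)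
  have "(\<integral>\<^sup>+\<omega>. ennreal (r \<omega>) \<partial>M) = (\<integral>\<^sup>+\<omega>. ennreal (score m n (X \<omega>)) \<partial>M)"
  proof (rule nn_integral_cong_AE)
    show "AE \<omega> in M. ennreal (r \<omega>) = ennreal (score m n (X \<omega>))"
      using AE_regular AE_top_nonzero
    proof eventually_elim
      case (elim \<omega>)
      then interpret G: gram_spectrum m n "X \<omega>" "q \<omega>" "l \<omega>" by (auto simp: regular_def intro: spectrum)
      show ?case using G.score_eq elim by (simp add: r_def regular_def)
    qed
  qed
  also have "\<dots> = (\<integral>\<^sup>+\<omega>. \<integral>\<^sup>+y. ennreal (score m n (mul_transpose m n (X \<omega>) y)) \<partial>haar n \<partial>M)"
    by (rule nn_integral_average) measurable
  also have "\<dots> = (\<integral>\<^sup>+\<omega>. ennreal (haar_l1_moment n * l \<omega> 0 + c1 * (trace \<omega> - l \<omega> 0)) \<partial>M)"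
  proof (rule nn_integral_cong_AE)
    show "AE \<omega> in M. (\<integral>\<^sup>+y. ennreal (score m n (mul_transpose m n (X \<omega>) y)) \<partial>haar n) = ennreal (haar_l1_moment n * l \<omega> 0 + c1 * (trace \<omega> - l \<omega> 0))"
      using AE_regular
    proof eventually_elim
      case (elim \<omega>)
      then interpret G: gram_spectrum m n "X \<omega>" "q \<omega>" "l \<omega>" by (auto simp: regular_def intro: spectrum)
      have o: "orthogonal_rows n (qT \<omega>)" using elim by (auto simp: regular_def intro: orthogonal_qT)
      define g where "g = (\<lambda>z. ennreal (\<Sum>k<n. l \<omega> k * sign_corr n k z))"
      have [measurable]: "g \<in> borel_measurable (arrays (idx n n))" unfolding g_def by measurable
      have "AE y in haar n. \<forall>i<n. mul_transpose n n y (qT \<omega>) (i, 0) \<noteq> 0"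
        by (rule AE_haar_mul_transpose[OF o _ AE_haar_column_nonzero]) measurable
      with AE_haar_orthogonal have ae: "AE y in haar n. ennreal (score m n (mul_transpose m n (X \<omega>) y)) = g (mul_transpose n n y (qT \<omega>))"
        by eventually_elim (simp add: g_def rotated(2)[OF elim])
      have "(\<integral>\<^sup>+y. ennreal (score m n (mul_transpose m n (X \<omega>) y)) \<partial>haar n) = (\<integral>\<^sup>+y. g (mul_transpose n n y (qT \<omega>)) \<partial>haar n)"
        by (rule nn_integral_cong_AE[OF ae])
      also have "\<dots> = (\<integral>\<^sup>+z. g z \<partial>haar n)" by (rule nn_integral_haar_mul_transpose[OF o]) measurable
      also have "\<dots> = (\<integral>\<^sup>+z. (\<Sum>k<n. ennreal (l \<omega> k) * ennreal (sign_corr n k z)) \<partial>haar n)"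
      proof (rule nn_integral_cong)
        fix z
        have "g z = (\<Sum>k<n. ennreal (l \<omega> k * sign_corr n k z))"
          unfolding g_def by (rule sum_ennreal[symmetric]) (simp add: G.l_nonneg sign_corr_def)
        then show "g z = (\<Sum>k<n. ennreal (l \<omega> k) * ennreal (sign_corr n k z))"
          by (simp add: ennreal_mult G.l_nonneg sign_corr_def)
      qed
      also have "\<dots> = (\<Sum>k<n. ennreal (l \<omega> k) * haar_corr n k)"
        by (subst nn_integral_sum) (auto simp: nn_integral_cmult haar_corr_def)
      also have "\<dots> = (\<Sum>k<n. ennreal (l \<omega> k * (if k = 0 then haar_l1_moment n else c1)))"
        using hc c1 by (intro sum.cong refl) (auto simp: ennreal_mult G.l_nonneg)
      also have "\<dots> = ennreal (\<Sum>k<n. l \<omega> k * (if k = 0 then haar_l1_moment n else c1))"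
        using hc c1 by (intro sum_ennreal) (auto simp: G.l_nonneg)
      also have "(\<Sum>k<n. l \<omega> k * (if k = 0 then haar_l1_moment n else c1)) = (\<Sum>k<n. c1 * l \<omega> k + (if k = 0 then (haar_l1_moment n - c1) * l \<omega> 0 else 0))"
        by (intro sum.cong) (auto simp: algebra_simps)
      also have "\<dots> = c1 * trace \<omega> + (haar_l1_moment n - c1) * l \<omega> 0"
        using n by (simp add: sum.distrib sum_distrib_left[symmetric] G.sum_l trace_def)
      also have "\<dots> = haar_l1_moment n * l \<omega> 0 + c1 * (trace \<omega> - l \<omega> 0)" by (simp add: algebra_simps)
      finally show ?case .
    qed
  qed
  also have "\<dots> = ennreal (expectation (\<lambda>\<omega>. haar_l1_moment n * l \<omega> 0 + c1 * (trace \<omega> - l \<omega> 0)))"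
  proof (rule nn_integral_eq_integral)
    show "integrable M (\<lambda>\<omega>. haar_l1_moment n * l \<omega> 0 + c1 * (trace \<omega> - l \<omega> 0))"
      using integrable_top integrable_trace by auto
    show "AE \<omega> in M. 0 \<le> haar_l1_moment n * l \<omega> 0 + c1 * (trace \<omega> - l \<omega> 0)"
      using AE_space by eventually_elim (use hc(2) c1 top_le_trace in auto)
  qed
  also have "expectation (\<lambda>\<omega>. haar_l1_moment n * l \<omega> 0 + c1 * (trace \<omega> - l \<omega> 0)) =
     haar_l1_moment n * expectation (\<lambda>\<omega>. l \<omega> 0) + c1 * (real m * real n - expectation (\<lambda>\<omega>. l \<omega> 0))"
    using integrable_top integrable_trace by (simp add: expectation_trace)
  finally show ?thesis by (simp add: c1_def)
qed

lemma expectation_top_upper: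
  assumes "t > 0"
  shows "expectation (\<lambda>\<omega>. l \<omega> 0) \<le> (sqrt (real m) + sqrt (real n))\<^sup>2 +
     (2 + sqrt (real n / real m) + sqrt (real m / real n)) * (t + 140 * (real (m + n)) ^ 3 / t ^ 3)"
proof -
  have "ennreal (expectation (\<lambda>\<omega>. l \<omega> 0)) = (\<integral>\<^sup>+\<omega>. ennreal (l \<omega> 0) \<partial>M)"
    using top_le_trace by (intro nn_integral_eq_integral[symmetric] integrable_top AE_I2) auto
  also have "\<dots> \<le> (\<integral>\<^sup>+\<omega>. ennreal (top_upper t m n (X \<omega>)) \<partial>M)"
    using gram_spectrum.top_eigenvalue_le[OF spectrum assms] by (intro nn_integral_mono ennreal_leI) auto
  also have "\<dots> = (\<integral>\<^sup>+x. ennreal (top_upper t m n x) \<partial>gauss (idx m n))"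
    by (rule nn_integral_law) measurable
  also note nn_integral_top_upper[OF assms]
  finally show ?thesis using assms by (subst (asm) ennreal_le_iff) auto
qed

lemma integrable_sqrt_top: "integrable M (\<lambda>\<omega>. sqrt (l \<omega> 0))"
proof (rule Bochner_Integration.integrable_bound)
  show "integrable M (\<lambda>\<omega>. 1 + l \<omega> 0)" using integrable_top by auto
  show "AE \<omega> in M. norm (sqrt (l \<omega> 0)) \<le> norm (1 + l \<omega> 0)"
    using AE_space
  proof eventually_elim
    case (elim \<omega>)
    have "sqrt (l \<omega> 0) \<le> 1 + l \<omega> 0"
      using top_le_trace[OF elim] by (intro real_le_lsqrt) (auto simp: power2_eq_square algebra_simps)
    then show ?case using top_le_trace[OF elim] by simp
  qed
qed measurable

lemma expectation_sqrt_top_lower: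
  assumes j: "2 * j < m" "2 * j < n" "j > 0"
  shows "sqrt (real j / real (j + 1)) * (sqrt (real (m - 2 * j)) + sqrt (real (n - 2 * j)) - 6) \<le> expectation (\<lambda>\<omega>. sqrt (l \<omega> 0))"
proof -
  define c where "c = sqrt (real j / real (j + 1))"
  have c: "c \<ge> 0" by (simp add: c_def)
  have e0: "expectation (\<lambda>\<omega>. sqrt (l \<omega> 0)) \<ge> 0" using top_le_trace by (intro integral_nonneg_AE AE_I2) auto
  have "(\<integral>\<^sup>+x. ennreal (top_lower j m n x) \<partial>gauss (idx m n)) = (\<integral>\<^sup>+\<omega>. ennreal (top_lower j m n (X \<omega>)) \<partial>M)"
    by (rule nn_integral_law[symmetric]) measurable
  also have "\<dots> \<le> (\<integral>\<^sup>+\<omega>. ennreal (sqrt (l \<omega> 0)) \<partial>M)"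
    using gram_spectrum.top_eigenvalue_ge[OF spectrum j] by (intro nn_integral_mono ennreal_leI) auto
  also have "\<dots> = ennreal (expectation (\<lambda>\<omega>. sqrt (l \<omega> 0)))"
    using top_le_trace by (intro nn_integral_eq_integral integrable_sqrt_top AE_I2) auto
  finally have le: "(\<integral>\<^sup>+x. ennreal (top_lower j m n x) \<partial>gauss (idx m n)) \<le> ennreal (expectation (\<lambda>\<omega>. sqrt (l \<omega> 0)))" .
  have "ennreal (c * (sqrt (real (m - 2 * j)) + sqrt (real (n - 2 * j)))) \<le> (\<integral>\<^sup>+x. ennreal (top_lower j m n x) \<partial>gauss (idx m n)) + 6 * ennreal c"
    unfolding c_def by (rule nn_integral_top_lower[OF j])
  also have "\<dots> \<le> ennreal (expectation (\<lambda>\<omega>. sqrt (l \<omega> 0))) + 6 * ennreal c" by (rule add_right_mono[OF le])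
  also have "\<dots> = ennreal (expectation (\<lambda>\<omega>. sqrt (l \<omega> 0)) + 6 * c)"
    using e0 c by (simp add: ennreal_plus ennreal_mult)
  finally have "c * (sqrt (real (m - 2 * j)) + sqrt (real (n - 2 * j))) \<le> expectation (\<lambda>\<omega>. sqrt (l \<omega> 0)) + 6 * c"
    using e0 c by (subst (asm) ennreal_le_iff) auto
  then show ?thesis unfolding c_def[symmetric] by (simp add: algebra_simps)
qed

text \<open>The squared l1 norm of the top eigenvector, relative to its largest possible value \<open>n\<close>.\<close>

definition l1_ratio :: "'a \<Rightarrow> real" where
  "l1_ratio \<omega> = (\<Sum>i<n. \<bar>q \<omega> i 0\<bar>)\<^sup>2 / real n"

lemma measurable_l1_ratio [measurable]: "l1_ratio \<in> borel_measurable M"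
  unfolding l1_ratio_def using n
  by (intro borel_measurable_divide borel_measurable_power borel_measurable_sum borel_measurable_abs q borel_measurable_const) auto

lemma l1_ratio_bounds: "\<omega> \<in> space M \<Longrightarrow> 0 \<le> l1_ratio \<omega> \<and> l1_ratio \<omega> \<le> 1"
proof -
  assume w: "\<omega> \<in> space M"
  interpret G: gram_spectrum m n "X \<omega>" "q \<omega>" "l \<omega>" by (rule spectrum[OF w])
  have "(\<Sum>i<n. \<bar>q \<omega> i 0\<bar>)\<^sup>2 \<le> (\<Sum>i<n. \<bar>q \<omega> i 0\<bar>\<^sup>2) * real n"
    using sum_squared_le_sum_of_squares[of "\<lambda>i. \<bar>q \<omega> i 0\<bar>" "{..<n}"] by simp
  also have "(\<Sum>i<n. \<bar>q \<omega> i 0\<bar>\<^sup>2) = 1" using orth_cols[OF G.q, of 0 0] n by (simp add: power2_eq_square)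
  finally show ?thesis using n by (simp add: l1_ratio_def)
qed

lemma expectation_l1_ratio: "integrable M (\<lambda>\<omega>. \<bar>l1_ratio \<omega> - 2 / pi\<bar>)" "expectation (\<lambda>\<omega>. \<bar>l1_ratio \<omega> - 2 / pi\<bar>) \<le> 5 / sqrt (real n)"
proof -
  have "integrable M l1_ratio"
    by (rule integrable_const_bound[of _ 1]) (use l1_ratio_bounds in auto)
  then show i: "integrable M (\<lambda>\<omega>. \<bar>l1_ratio \<omega> - 2 / pi\<bar>)" by auto
  have "ennreal (expectation (\<lambda>\<omega>. \<bar>l1_ratio \<omega> - 2 / pi\<bar>)) = (\<integral>\<^sup>+\<omega>. ennreal \<bar>l1_ratio \<omega> - 2 / pi\<bar> \<partial>M)"
    by (rule nn_integral_eq_integral[OF i, symmetric]) auto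
  also have "\<dots> \<le> ennreal (5 / sqrt (real n))" unfolding l1_ratio_def by (rule l1_concentration)
  finally show "expectation (\<lambda>\<omega>. \<bar>l1_ratio \<omega> - 2 / pi\<bar>) \<le> 5 / sqrt (real n)"
    by (subst (asm) ennreal_le_iff) auto
qed

text \<open>The mean of the square of \<open>sqrt (l 0 / n) - \<kappa>\<close>, expanded.\<close>

definition root_defect :: "real \<Rightarrow> real" where
  "root_defect \<kappa> = expectation (\<lambda>\<omega>. l \<omega> 0) / real n - 2 * \<kappa> * (expectation (\<lambda>\<omega>. sqrt (l \<omega> 0)) / sqrt (real n)) + \<kappa>\<^sup>2"

text \<open>With \<open>y = sqrt (l 0 / n)\<close> one has \<open>\<bar>y\<^sup>2 - \<kappa>\<^sup>2\<bar> \<le> (y - \<kappa>)\<^sup>2 + 2 * \<kappa> * \<bar>y - \<kappa>\<bar>\<close>; the parameter \<open>\<eta>\<close>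
weighs the linear term against the square.\<close>

lemma top_deviation:
  assumes \<kappa>: "\<kappa> \<ge> 0" and \<eta>: "\<eta> > 0"
  shows "0 \<le> root_defect \<kappa>"
    and "expectation (\<lambda>\<omega>. \<bar>l \<omega> 0 / real n - \<kappa>\<^sup>2\<bar>) \<le> root_defect \<kappa> * (1 + \<kappa> / \<eta>) + \<kappa> * \<eta>"
proof -
  define y where "y = (\<lambda>\<omega>. sqrt (l \<omega> 0) / sqrt (real n))"
  have y2: "(y \<omega>)\<^sup>2 = l \<omega> 0 / real n" if "\<omega> \<in> space M" for \<omega>
    using top_le_trace[OF that] by (simp add: y_def power_divide)
  have e: "(y \<omega> - \<kappa>)\<^sup>2 = l \<omega> 0 / real n - 2 * \<kappa> * (sqrt (l \<omega> 0) / sqrt (real n)) + \<kappa>\<^sup>2" if "\<omega> \<in> space M" for \<omega>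
    using y2[OF that] by (simp add: power2_diff y_def)
  have i: "integrable M (\<lambda>\<omega>. l \<omega> 0 / real n - 2 * \<kappa> * (sqrt (l \<omega> 0) / sqrt (real n)) + \<kappa>\<^sup>2)"
    using integrable_top integrable_sqrt_top by auto
  then have i': "integrable M (\<lambda>\<omega>. (y \<omega> - \<kappa>)\<^sup>2)"
    by (subst Bochner_Integration.integrable_cong[OF refl e]) auto
  have "expectation (\<lambda>\<omega>. (y \<omega> - \<kappa>)\<^sup>2) = expectation (\<lambda>\<omega>. l \<omega> 0 / real n - 2 * \<kappa> * (sqrt (l \<omega> 0) / sqrt (real n)) + \<kappa>\<^sup>2)"
    by (rule Bochner_Integration.integral_cong[OF refl e])
  also have "\<dots> = root_defect \<kappa>" using integrable_top integrable_sqrt_top prob_space by (simp add: root_defect_def)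
  finally have ED: "expectation (\<lambda>\<omega>. (y \<omega> - \<kappa>)\<^sup>2) = root_defect \<kappa>" .
  then show "0 \<le> root_defect \<kappa>" by (metis integral_nonneg_AE AE_I2 zero_le_power2)
  have pw: "\<bar>l \<omega> 0 / real n - \<kappa>\<^sup>2\<bar> \<le> (1 + \<kappa> / \<eta>) * (y \<omega> - \<kappa>)\<^sup>2 + \<kappa> * \<eta>" if "\<omega> \<in> space M" for \<omega>
  proof -
    define d where "d = \<bar>y \<omega> - \<kappa>\<bar>"
    have "l \<omega> 0 / real n - \<kappa>\<^sup>2 = (y \<omega> - \<kappa>)\<^sup>2 + 2 * \<kappa> * (y \<omega> - \<kappa>)"
      unfolding y2[OF that, symmetric] by (simp add: power2_eq_square algebra_simps)
    then have "\<bar>l \<omega> 0 / real n - \<kappa>\<^sup>2\<bar> \<le> d\<^sup>2 + 2 * \<kappa> * d"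
      using abs_triangle_ineq[of "(y \<omega> - \<kappa>)\<^sup>2" "2 * \<kappa> * (y \<omega> - \<kappa>)"] \<kappa> by (simp add: d_def abs_mult)
    moreover have "2 * d \<le> d\<^sup>2 / \<eta> + \<eta>"
    proof -
      have "0 \<le> (d - \<eta>)\<^sup>2 / \<eta>" using \<eta> by simp
      also have "\<dots> = d\<^sup>2 / \<eta> + \<eta> - 2 * d" using \<eta> by (simp add: power2_eq_square field_simps)
      finally show ?thesis by simp
    qed
    then have "\<kappa> * (2 * d) \<le> \<kappa> * (d\<^sup>2 / \<eta> + \<eta>)" using \<kappa> by (rule mult_left_mono)
    ultimately show ?thesis by (simp add: d_def algebra_simps)
  qed
  have "expectation (\<lambda>\<omega>. \<bar>l \<omega> 0 / real n - \<kappa>\<^sup>2\<bar>) \<le> expectation (\<lambda>\<omega>. (1 + \<kappa> / \<eta>) * (y \<omega> - \<kappa>)\<^sup>2 + \<kappa> * \<eta>)"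
    using integrable_top i' pw by (intro integral_mono) auto
  also have "\<dots> = root_defect \<kappa> * (1 + \<kappa> / \<eta>) + \<kappa> * \<eta>" using i' ED prob_space by (simp add: mult.commute)
  finally show "expectation (\<lambda>\<omega>. \<bar>l \<omega> 0 / real n - \<kappa>\<^sup>2\<bar>) \<le> root_defect \<kappa> * (1 + \<kappa> / \<eta>) + \<kappa> * \<eta>" .
qed

lemma product_deviation:
  assumes "\<epsilon> > 0"
  shows "prob {\<omega> \<in> space M. \<bar>l \<omega> 0 * (\<Sum>i<n. \<bar>q \<omega> i 0\<bar>)\<^sup>2 / (real n)\<^sup>2 - \<kappa>\<^sup>2 * (2 / pi)\<bar> > \<epsilon>}
    \<le> (expectation (\<lambda>\<omega>. \<bar>l \<omega> 0 / real n - \<kappa>\<^sup>2\<bar>) + \<kappa>\<^sup>2 * (5 / sqrt (real n))) / \<epsilon>"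
proof -
  define u where "u = (\<lambda>\<omega>. \<bar>l \<omega> 0 / real n - \<kappa>\<^sup>2\<bar> + \<kappa>\<^sup>2 * \<bar>l1_ratio \<omega> - 2 / pi\<bar>)"
  have it: "integrable M (\<lambda>\<omega>. \<bar>l \<omega> 0 / real n - \<kappa>\<^sup>2\<bar>)" using integrable_top by auto
  have iu: "integrable M u" unfolding u_def using it expectation_l1_ratio(1) by auto
  have [measurable]: "u \<in> borel_measurable M" using iu by auto
  have "{\<omega> \<in> space M. \<bar>l \<omega> 0 * (\<Sum>i<n. \<bar>q \<omega> i 0\<bar>)\<^sup>2 / (real n)\<^sup>2 - \<kappa>\<^sup>2 * (2 / pi)\<bar> > \<epsilon>} \<subseteq> {\<omega> \<in> space M. u \<omega> \<ge> \<epsilon>}"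
  proof safe
    fix \<omega> assume w: "\<omega> \<in> space M"
    assume "\<epsilon> < \<bar>l \<omega> 0 * (\<Sum>i<n. \<bar>q \<omega> i 0\<bar>)\<^sup>2 / (real n)\<^sup>2 - \<kappa>\<^sup>2 * (2 / pi)\<bar>"
    also have "l \<omega> 0 * (\<Sum>i<n. \<bar>q \<omega> i 0\<bar>)\<^sup>2 / (real n)\<^sup>2 - \<kappa>\<^sup>2 * (2 / pi) = (l \<omega> 0 / real n - \<kappa>\<^sup>2) * l1_ratio \<omega> + \<kappa>\<^sup>2 * (l1_ratio \<omega> - 2 / pi)"
      by (simp add: l1_ratio_def algebra_simps power2_eq_square diff_divide_distrib)
    also have "\<bar>\<dots>\<bar> \<le> \<bar>l \<omega> 0 / real n - \<kappa>\<^sup>2\<bar> * l1_ratio \<omega> + \<kappa>\<^sup>2 * \<bar>l1_ratio \<omega> - 2 / pi\<bar>"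
      using l1_ratio_bounds[OF w] abs_triangle_ineq[of "(l \<omega> 0 / real n - \<kappa>\<^sup>2) * l1_ratio \<omega>" "\<kappa>\<^sup>2 * (l1_ratio \<omega> - 2 / pi)"]
      by (simp add: abs_mult)
    also have "\<dots> \<le> u \<omega>"
      unfolding u_def using l1_ratio_bounds[OF w] mult_left_le[of "l1_ratio \<omega>" "\<bar>l \<omega> 0 / real n - \<kappa>\<^sup>2\<bar>"] by simp
    finally show "\<epsilon> \<le> u \<omega>" by simp
  qed
  then have "prob {\<omega> \<in> space M. \<bar>l \<omega> 0 * (\<Sum>i<n. \<bar>q \<omega> i 0\<bar>)\<^sup>2 / (real n)\<^sup>2 - \<kappa>\<^sup>2 * (2 / pi)\<bar> > \<epsilon>} \<le> prob {\<omega> \<in> space M. u \<omega> \<ge> \<epsilon>}"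
    by (intro finite_measure_mono) auto
  also have "\<dots> \<le> expectation u / \<epsilon>"
    by (rule integral_Markov_inequality_measure[OF iu sets.top]) (use assms in \<open>auto simp: u_def\<close>)
  also have "\<dots> \<le> (expectation (\<lambda>\<omega>. \<bar>l \<omega> 0 / real n - \<kappa>\<^sup>2\<bar>) + \<kappa>\<^sup>2 * (5 / sqrt (real n))) / \<epsilon>"
  proof (rule divide_right_mono)
    have "expectation u = expectation (\<lambda>\<omega>. \<bar>l \<omega> 0 / real n - \<kappa>\<^sup>2\<bar>) + \<kappa>\<^sup>2 * expectation (\<lambda>\<omega>. \<bar>l1_ratio \<omega> - 2 / pi\<bar>)"
      unfolding u_def using it expectation_l1_ratio(1) by simp
    also have "\<dots> \<le> expectation (\<lambda>\<omega>. \<bar>l \<omega> 0 / real n - \<kappa>\<^sup>2\<bar>) + \<kappa>\<^sup>2 * (5 / sqrt (real n))"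
      by (intro add_left_mono mult_left_mono expectation_l1_ratio(2)) auto
    finally show "expectation u \<le> expectation (\<lambda>\<omega>. \<bar>l \<omega> 0 / real n - \<kappa>\<^sup>2\<bar>) + \<kappa>\<^sup>2 * (5 / sqrt (real n))" .
  qed (use assms in auto)
  finally show ?thesis .
qed

lemma expectation_r:
  assumes "f \<in> borel_measurable M" "\<And>\<omega>. \<omega> \<in> space M \<Longrightarrow> f \<omega> = r \<omega>"
  shows "expectation f = haar_l1_moment n * expectation (\<lambda>\<omega>. l \<omega> 0) + (real n - haar_l1_moment n) / (real n - 1) * (real m * real n - expectation (\<lambda>\<omega>. l \<omega> 0))"
proof -
  have nn: "(\<integral>\<^sup>+\<omega>. ennreal (f \<omega>) \<partial>M) = (\<integral>\<^sup>+\<omega>. ennreal (r \<omega>) \<partial>M)"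
    by (rule nn_integral_cong) (simp add: assms(2))
  have f0: "AE \<omega> in M. 0 \<le> f \<omega>"
    using AE_space
  proof eventually_elim
    case (elim \<omega>)
    then interpret G: gram_spectrum m n "X \<omega>" "q \<omega>" "l \<omega>" by (rule spectrum)
    show ?case using elim G.l_nonneg by (auto simp: assms(2) r_def intro!: sum_nonneg)
  qed
  have "expectation (\<lambda>\<omega>. l \<omega> 0) \<le> expectation trace"
    using top_le_trace by (intro integral_mono integrable_top integrable_trace) auto
  then have "0 \<le> (real n - haar_l1_moment n) / (real n - 1) * (real m * real n - expectation (\<lambda>\<omega>. l \<omega> 0))"
    using haar_corr_values(3)[OF n] n by (simp add: expectation_trace)
  moreover have "0 \<le> haar_l1_moment n * expectation (\<lambda>\<omega>. l \<omega> 0)"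
    using top_le_trace haar_corr_values(2)[OF n] by (intro mult_nonneg_nonneg integral_nonneg_AE AE_I2) auto
  moreover define v where "v = haar_l1_moment n * expectation (\<lambda>\<omega>. l \<omega> 0) + (real n - haar_l1_moment n) / (real n - 1) * (real m * real n - expectation (\<lambda>\<omega>. l \<omega> 0))"
  ultimately have "v \<ge> 0" by linarith
  have "expectation f = enn2real (ennreal v)"
    using integral_eq_nn_integral[OF assms(1) f0] by (simp only: nn nn_integral_r v_def)
  then show ?thesis using \<open>v \<ge> 0\<close> by (simp add: v_def)
qed

end

section \<open>From matrices to arrays\<close>

lemma distr_iid_std_normal_matrix:
  assumes "prob_space M" "iid_std_normal_matrix M m n H" "m \<ge> 1" "n \<ge> 1"
  defines "X \<equiv> \<lambda>\<omega>. \<lambda>p\<in>idx m n. H \<omega> $$ p"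
  shows "X \<in> measurable M (arrays (idx m n))"
    and "distr M (arrays (idx m n)) X = gauss (idx m n)"
proof -
  interpret prob_space M by fact
  have rv: "(\<lambda>\<omega>. H \<omega> $$ p) \<in> borel_measurable M" if "p \<in> idx m n" for p
    using that assms(2) by (auto simp: iid_std_normal_matrix_def random_matrix_def)
  then show "X \<in> measurable M (arrays (idx m n))"
    unfolding X_def by (intro measurable_restrict) auto
  have d: "distr M borel (\<lambda>\<omega>. H \<omega> $$ p) = std_normal_distribution" if "p \<in> idx m n" for p
  proof -
    have "distributed M lborel (\<lambda>\<omega>. H \<omega> $$ p) std_normal_density"
      using that assms(2) by (auto simp: iid_std_normal_matrix_def)
    then have "distr M lborel (\<lambda>\<omega>. H \<omega> $$ p) = std_normal_distribution"
      by (simp add: distributed_def)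
    moreover have "distr M borel (\<lambda>\<omega>. H \<omega> $$ p) = distr M lborel (\<lambda>\<omega>. H \<omega> $$ p)"
      by (rule distr_cong) auto
    ultimately show ?thesis by simp
  qed
  have eq: "(\<lambda>(i, j) \<omega>. H \<omega> $$ (i, j)) = (\<lambda>p \<omega>. H \<omega> $$ p)" by (simp add: fun_eq_iff split_beta')
  have "indep_vars (\<lambda>_. borel) (\<lambda>p \<omega>. H \<omega> $$ p) (idx m n)"
    using assms(2) unfolding iid_std_normal_matrix_def eq by simp
  then have "distr M (arrays (idx m n)) X = PiM (idx m n) (\<lambda>p. distr M borel (\<lambda>\<omega>. H \<omega> $$ p))"
    unfolding X_def using assms(3,4) rv
    by (subst (asm) indep_vars_iff_distr_eq_PiM') (auto simp: lessThan_empty_iff)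
  also have "\<dots> = gauss (idx m n)" unfolding gauss_def by (rule PiM_cong) (auto simp: d)
  finally show "distr M (arrays (idx m n)) X = gauss (idx m n)" .
qed

lemma gram_spectrum_of_eigendecomposition:
  assumes H: "H \<in> carrier_mat m n" and dec: "sorted_eigendecomposition n (transpose_mat H * H) Q L" and mn: "m \<ge> 1" "n \<ge> 1"
  shows "gram_spectrum m n (\<lambda>p\<in>idx m n. H $$ p) (\<lambda>i k. Q $$ (i, k)) (\<lambda>k. L $$ (k, k))"
proof
  have Q: "Q \<in> carrier_mat n n" and L: "L \<in> carrier_mat n n" and QQ: "transpose_mat Q * Q = 1\<^sub>m n"
    and dL: "diagonal_mat L" and eq: "transpose_mat H * H = Q * L * transpose_mat Q"
    using dec by (auto simp: sorted_eigendecomposition_def)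
  show "orth {..<n} (\<lambda>i k. Q $$ (i, k))" unfolding orth_def
  proof (intro ballI)
    fix i j assume ij: "i \<in> {..<n}" "j \<in> {..<n}"
    then have "(\<Sum>r<n. Q $$ (r, i) * Q $$ (r, j)) = (transpose_mat Q * Q) $$ (i, j)"
      using Q by (simp add: scalar_prod_def atLeast0LessThan)
    then show "(\<Sum>r<n. Q $$ (r, i) * Q $$ (r, j)) = (if i = j then 1 else 0)" using QQ ij by simp
  qed
  fix i j assume ij: "i < n" "j < n"
  have "gram m (\<lambda>p\<in>idx m n. H $$ p) i j = (transpose_mat H * H) $$ (i, j)"
    using H ij by (simp add: gram_def scalar_prod_def atLeast0LessThan)
  also have "\<dots> = (\<Sum>k<n. (Q * L) $$ (i, k) * Q $$ (j, k))"
  proof -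
    have "(B * transpose_mat Q) $$ (i, j) = (\<Sum>k<n. B $$ (i, k) * Q $$ (j, k))" if "B \<in> carrier_mat n n" for B
      using that Q ij by (simp add: scalar_prod_def atLeast0LessThan)
    from this[of "Q * L"] show ?thesis unfolding eq using Q L by simp
  qed
  also have "\<dots> = (\<Sum>k<n. L $$ (k, k) * (Q $$ (i, k) * Q $$ (j, k)))"
  proof (intro sum.cong refl)
    fix k assume k: "k \<in> {..<n}"
    have "(Q * L) $$ (i, k) = (\<Sum>r<n. Q $$ (i, r) * L $$ (r, k))"
      using Q L ij k by (simp add: scalar_prod_def atLeast0LessThan)
    also have "\<dots> = (\<Sum>r<n. if r = k then Q $$ (i, r) * L $$ (r, k) else 0)"
      using dL L k by (intro sum.cong) (auto simp: diagonal_mat_def)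
    also have "\<dots> = Q $$ (i, k) * L $$ (k, k)" using k by simp
    finally show "(Q * L) $$ (i, k) * Q $$ (j, k) = L $$ (k, k) * (Q $$ (i, k) * Q $$ (j, k))" by simp
  qed
  finally show "gram m (\<lambda>p\<in>idx m n. H $$ p) i j = (\<Sum>k<n. L $$ (k, k) * (Q $$ (i, k) * Q $$ (j, k)))" .
next
  show "i \<le> j \<Longrightarrow> j < n \<Longrightarrow> L $$ (j, j) \<le> L $$ (i, i)" for i j
    using dec by (simp add: sorted_eigendecomposition_def)
qed (use mn in auto)

lemma r_eig_explicit:
  assumes "H \<in> carrier_mat m n" "Q \<in> carrier_mat n n" "n \<ge> 1"
  shows "r_eig H Q = (\<Sum>a<m. (\<Sum>j<n. H $$ (a, j) * sign_pm (Q $$ (j, 0)))\<^sup>2)"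
proof -
  have d: "dim_vec (H *\<^sub>v x_eig Q) = m" using assms by simp
  have "(H *\<^sub>v x_eig Q) $ a = (\<Sum>j<n. H $$ (a, j) * sign_pm (Q $$ (j, 0)))" if "a < m" for a
    using that assms by (simp add: x_eig_def sign_vec_def scalar_prod_def atLeast0LessThan)
  then have "(\<Sum>a<m. ((H *\<^sub>v x_eig Q) $ a)\<^sup>2) = (\<Sum>a<m. (\<Sum>j<n. H $$ (a, j) * sign_pm (Q $$ (j, 0)))\<^sup>2)"
    by (intro sum.cong) auto
  moreover have "r_eig H Q = (\<Sum>a<m. ((H *\<^sub>v x_eig Q) $ a)\<^sup>2)"
    unfolding r_eig_def l2_norm_vec_def L2_set_def d by (simp add: sum_nonneg)
  ultimately show ?thesis by simp
qed

lemma l1_norm_col: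
  assumes "Q \<in> carrier_mat n n" "n \<ge> 1"
  shows "l1_norm_vec (col Q 0) = (\<Sum>i<n. \<bar>Q $$ (i, 0)\<bar>)"
  using assms by (simp add: l1_norm_vec_def)

section \<open>The limits\<close>

theorem mainTheorem4:
  fixes \<alpha> :: real
    and m :: "nat \<Rightarrow> nat"
    and M :: "nat \<Rightarrow> 'a measure"
    and H Q L :: "nat \<Rightarrow> 'a \<Rightarrow> real Matrix.mat"
  assumes "\<alpha> > 0"
    and "\<And>n. \<bar>real (m n) - \<alpha> * real n\<bar> < 1"
    and "\<And>n. prob_space (M n)"
    and "\<And>n. iid_std_normal_matrix (M n) (m n) n (H n)"
    and "\<And>n. random_matrix (M n) n n (Q n)"
    and "\<And>n \<omega>. \<omega> \<in> space (M n) \<Longrightarrow>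
           sorted_eigendecomposition n (transpose_mat (H n \<omega>) * H n \<omega>) (Q n \<omega>) (L n \<omega>)"
  shows "\<exists>r\<^sub>l\<^sub>i\<^sub>m c.
           (\<lambda>n. prob_space.expectation (M n) (\<lambda>\<omega>. r_eig (H n \<omega>) (Q n \<omega>)) / (real n)\<^sup>2) \<longlonglongrightarrow> r\<^sub>l\<^sub>i\<^sub>m \<and>
           tendsto_in_probability M
             (\<lambda>n \<omega>. L n \<omega> $$ (0, 0) * (l1_norm_vec (col (Q n \<omega>) 0))\<^sup>2 / (real n)\<^sup>2) c \<and>
           r\<^sub>l\<^sub>i\<^sub>m \<ge> c \<and>
           c = (sqrt \<alpha> + 1)\<^sup>2 * (2 / pi)"
proof -
  define \<kappa> where "\<kappa> = sqrt \<alpha> + 1"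
  have \<kappa>: "\<kappa> > 0" using assms(1) by (simp add: \<kappa>_def add_pos_pos)
  define X where "X = (\<lambda>n \<omega>. \<lambda>p\<in>idx (m n) n. H n \<omega> $$ p)"
  define q where "q = (\<lambda>n \<omega> i k. Q n \<omega> $$ (i, k))"
  define l where "l = (\<lambda>n \<omega> k. L n \<omega> $$ (k, k))"
  define top where "top = (\<lambda>n. prob_space.expectation (M n) (\<lambda>\<omega>. l n \<omega> 0))"
  define root where "root = (\<lambda>n. prob_space.expectation (M n) (\<lambda>\<omega>. sqrt (l n \<omega> 0)))"
  define dev where "dev = (\<lambda>n. prob_space.expectation (M n) (\<lambda>\<omega>. \<bar>l n \<omega> 0 / real n - \<kappa>\<^sup>2\<bar>))"
  define a where "a = (\<lambda>n. real (m n) / real n)"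

  have carrier: "H n \<omega> \<in> carrier_mat (m n) n" "Q n \<omega> \<in> carrier_mat n n" if "\<omega> \<in> space (M n)" for n \<omega>
    using assms(4)[of n] assms(5)[of n] that by (auto simp: iid_std_normal_matrix_def random_matrix_def)
  have spec: "gaussian_spectrum (M n) (m n) n (X n) (q n) (l n)" if mn: "m n \<ge> 1" "n \<ge> 2" for n
  proof -
    interpret prob_space "M n" by fact
    show ?thesis
    proof (intro gaussian_spectrum.intro gaussian_spectrum_axioms.intro prob_space_axioms)
      show "X n \<in> measurable (M n) (arrays (idx (m n) n))"
        "distr (M n) (arrays (idx (m n) n)) (X n) = gauss (idx (m n) n)"
        unfolding X_def using mn distr_iid_std_normal_matrix[OF assms(3)[of n] assms(4)[of n]] by simp_all
      show "(\<lambda>\<omega>. q n \<omega> i k) \<in> borel_measurable (M n)" if "i < n" "k < n" for i k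
        using assms(5)[of n] that by (simp add: random_matrix_def q_def)
      show "gram_spectrum (m n) n (X n \<omega>) (q n \<omega>) (l n \<omega>)" if "\<omega> \<in> space (M n)" for \<omega>
        unfolding X_def q_def l_def
        using mn by (intro gram_spectrum_of_eigendecomposition carrier assms(6) that) auto
    qed (use mn in auto)
  qed

  have m_large: "eventually (\<lambda>n. m n \<ge> K) sequentially" for K
    using eventually_ge_at_top[of "nat \<lceil>(real K + 1) / \<alpha>\<rceil>"]
  proof eventually_elim
    case (elim n)
    then have "(real K + 1) / \<alpha> \<le> real n" by linarith
    then have "real K + 1 \<le> \<alpha> * real n" using assms(1) by (simp add: field_simps)
    then show ?case using assms(2)[of n] by linarith
  qed
  have regime: "eventually (\<lambda>n. m n \<ge> K \<and> n \<ge> K) sequentially" for K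
    using m_large[of K] eventually_ge_at_top[of K] by eventually_elim auto

  have inv_n: "(\<lambda>n. 1 / real n) \<longlonglongrightarrow> 0" by (rule lim_1_over_n)
  have inv_sqrt: "(\<lambda>n. 1 / sqrt (real n)) \<longlonglongrightarrow> 0"
    using tendsto_real_sqrt[OF inv_n] by (simp add: real_sqrt_divide)
  have a_lim: "a \<longlonglongrightarrow> \<alpha>"
  proof (rule real_tendsto_sandwich)
    have b: "eventually (\<lambda>n. \<bar>a n - \<alpha>\<bar> \<le> 1 / real n) sequentially"
      using eventually_gt_at_top[of 0]
    proof eventually_elim
      case (elim n)
      then have "a n - \<alpha> = (real (m n) - \<alpha> * real n) / real n" by (simp add: a_def field_simps)
      then show ?case using assms(2)[of n] elim by (simp add: abs_divide divide_right_mono)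
    qed
    show "eventually (\<lambda>n. \<alpha> - 1 / real n \<le> a n) sequentially" using b by eventually_elim linarith
    show "eventually (\<lambda>n. a n \<le> \<alpha> + 1 / real n) sequentially" using b by eventually_elim linarith
    show "(\<lambda>n. \<alpha> - 1 / real n) \<longlonglongrightarrow> \<alpha>" "(\<lambda>n. \<alpha> + 1 / real n) \<longlonglongrightarrow> \<alpha>"
      using tendsto_diff[OF tendsto_const[of \<alpha>] inv_n] tendsto_add[OF tendsto_const[of \<alpha>] inv_n] by simp_all
  qed

  \<comment> \<open>the bound of \<open>expectation_top_upper\<close> for \<open>t = \<delta> * n\<close>, divided by \<open>n\<close>\<close>
  define U where "U = (\<lambda>\<delta> n. (sqrt (a n) + 1)\<^sup>2 + (2 + sqrt (1 / a n) + sqrt (a n)) * (\<delta> + 140 * (a n + 1) ^ 3 / \<delta> ^ 3 * (1 / real n)))"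
  define C where "C = 2 + sqrt (1 / \<alpha>) + sqrt \<alpha>"
  have C: "C > 0" using assms(1) by (simp add: C_def add_pos_pos)
  have U_lim: "U \<delta> \<longlonglongrightarrow> \<kappa>\<^sup>2 + C * \<delta>" if "\<delta> > 0" for \<delta>
  proof -
    have "U \<delta> \<longlonglongrightarrow> (sqrt \<alpha> + 1)\<^sup>2 + (2 + sqrt (1 / \<alpha>) + sqrt \<alpha>) * (\<delta> + 140 * (\<alpha> + 1) ^ 3 / \<delta> ^ 3 * 0)"
      unfolding U_def using assms(1) that by (intro tendsto_intros a_lim inv_n) auto
    then show ?thesis by (simp add: \<kappa>_def C_def)
  qed
  have top_le: "eventually (\<lambda>n. top n / real n \<le> U \<delta> n) sequentially" if \<delta>: "\<delta> > 0" for \<delta>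
    using regime[of 2]
  proof eventually_elim
    case (elim n)
    interpret G: gaussian_spectrum "M n" "m n" n "X n" "q n" "l n" by (rule spec) (use elim in auto)
    have n: "real n > 0" "real (m n) > 0" using elim by auto
    have sa: "sqrt (real (m n)) = sqrt (a n) * sqrt (real n)" using n by (simp add: a_def flip: real_sqrt_mult)
    have 1: "(sqrt (real (m n)) + sqrt (real n))\<^sup>2 = (sqrt (a n) + 1)\<^sup>2 * real n"
    proof -
      have "sqrt (real (m n)) + sqrt (real n) = (sqrt (a n) + 1) * sqrt (real n)" by (simp add: sa algebra_simps)
      then show ?thesis by (simp add: power_mult_distrib)
    qed
    have 2: "\<delta> * real n + 140 * (real (m n + n)) ^ 3 / (\<delta> * real n) ^ 3 = (\<delta> + 140 * (a n + 1) ^ 3 / \<delta> ^ 3 * (1 / real n)) * real n"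
    proof -
      have "real (m n + n) = (a n + 1) * real n" using n by (simp add: a_def field_simps)
      then have "140 * (real (m n + n)) ^ 3 / (\<delta> * real n) ^ 3 = 140 * (a n + 1) ^ 3 / \<delta> ^ 3"
        using n by (simp add: power_mult_distrib)
      then show ?thesis using n by (simp add: algebra_simps)
    qed
    have "top n \<le> (sqrt (real (m n)) + sqrt (real n))\<^sup>2 + (2 + sqrt (real n / real (m n)) + sqrt (real (m n) / real n)) * (\<delta> * real n + 140 * (real (m n + n)) ^ 3 / (\<delta> * real n) ^ 3)"
      unfolding top_def by (rule G.expectation_top_upper) (use \<delta> n in auto)
    also have "\<dots> = U \<delta> n * real n"
    proof -
      have e: "real n / real (m n) = 1 / a n" "real (m n) / real n = a n" by (simp_all add: a_def)
      have "A * x + B * (C * x) = (A + B * C) * x" for A B C x :: real by (simp add: algebra_simps)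
      then show ?thesis unfolding 1 2 U_def e by simp
    qed
    finally show ?case using n by (simp add: field_simps)
  qed

  \<comment> \<open>the bound of \<open>expectation_sqrt_top_lower\<close>, divided by \<open>sqrt n\<close>\<close>
  define V where "V = (\<lambda>j n. sqrt (real j / real (j + 1)) * (sqrt (a n - 2 * real j * (1 / real n)) + sqrt (1 - 2 * real j * (1 / real n)) - 6 * (1 / sqrt (real n))))"
  have V_lim: "V j \<longlonglongrightarrow> sqrt (real j / real (j + 1)) * \<kappa>" for j
  proof -
    have "V j \<longlonglongrightarrow> sqrt (real j / real (j + 1)) * (sqrt (\<alpha> - 2 * real j * 0) + sqrt (1 - 2 * real j * 0) - 6 * 0)"
      unfolding V_def by (intro tendsto_intros a_lim inv_n inv_sqrt)
    then show ?thesis by (simp add: \<kappa>_def)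
  qed
  have root_ge: "eventually (\<lambda>n. V j n \<le> root n / sqrt (real n)) sequentially" if j: "j > 0" for j
    using regime[of "2 * j + 1"]
  proof eventually_elim
    case (elim n)
    interpret G: gaussian_spectrum "M n" "m n" n "X n" "q n" "l n" by (rule spec) (use elim j in auto)
    have n: "real n > 0" using elim by auto
    have 1: "sqrt (a n - 2 * real j * (1 / real n)) = sqrt (real (m n - 2 * j)) / sqrt (real n)"
      using elim n by (simp add: a_def real_sqrt_divide[symmetric] of_nat_diff diff_divide_distrib)
    have 2: "sqrt (1 - 2 * real j * (1 / real n)) = sqrt (real (n - 2 * j)) / sqrt (real n)"
      using elim n by (simp add: real_sqrt_divide[symmetric] of_nat_diff diff_divide_distrib)
    have "V j n = sqrt (real j / real (j + 1)) * (sqrt (real (m n - 2 * j)) + sqrt (real (n - 2 * j)) - 6) / sqrt (real n)"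
    proof -
      have "c * (x / s + y / s - 6 * (1 / s)) = c * (x + y - 6) / s" for c x y s :: real
        by (simp add: algebra_simps add_divide_distrib diff_divide_distrib)
      then show ?thesis unfolding V_def 1 2 .
    qed
    also have "\<dots> \<le> root n / sqrt (real n)"
      unfolding root_def using elim j by (intro divide_right_mono G.expectation_sqrt_top_lower) auto
    finally show ?case .
  qed

  define D where "D = (\<lambda>n. top n / real n - 2 * \<kappa> * (root n / sqrt (real n)) + \<kappa>\<^sup>2)"
  have D_eq: "D n = gaussian_spectrum.root_defect (M n) n (l n) \<kappa>" if "m n \<ge> 1" "n \<ge> 2" for n
    using gaussian_spectrum.root_defect_def[OF spec[OF that]] by (simp add: D_def top_def root_def)
  have D_lim: "D \<longlonglongrightarrow> 0"
  proof (rule tendstoI)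
    fix e :: real assume e: "e > 0"
    \<comment> \<open>The limit of the bound for \<open>D\<close> is \<open>2 * \<kappa>\<^sup>2 * (1 - sqrt (j / (j + 1))) + C * \<delta>\<close>; the size \<open>j\<close> of the
      corner and the slack \<open>\<delta>\<close> are chosen so that both summands stay below \<open>e / 4\<close>.\<close>
    define \<delta> where "\<delta> = e / (4 * C)"
    have \<delta>: "\<delta> > 0" using e C by (simp add: \<delta>_def)
    have "(\<lambda>j. 2 * \<kappa>\<^sup>2 * (1 - sqrt (real j / real (j + 1)))) \<longlonglongrightarrow> 2 * \<kappa>\<^sup>2 * (1 - sqrt 1)"
      using LIMSEQ_n_over_Suc_n[where ?'a = real] by (intro tendsto_intros) simp
    then have "eventually (\<lambda>j. 2 * \<kappa>\<^sup>2 * (1 - sqrt (real j / real (j + 1))) < e / 4) sequentially"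
      using e by (intro order_tendstoD(2)) auto
    with eventually_gt_at_top[of 0] have "eventually (\<lambda>j. j > 0 \<and> 2 * \<kappa>\<^sup>2 * (1 - sqrt (real j / real (j + 1))) < e / 4) sequentially"
      by eventually_elim auto
    from eventually_happens'[OF sequentially_bot this]
    obtain j :: nat where j: "j > 0" "2 * \<kappa>\<^sup>2 * (1 - sqrt (real j / real (j + 1))) < e / 4" by blast
    have "(\<lambda>n. U \<delta> n - 2 * \<kappa> * V j n + \<kappa>\<^sup>2) \<longlonglongrightarrow> (\<kappa>\<^sup>2 + C * \<delta>) - 2 * \<kappa> * (sqrt (real j / real (j + 1)) * \<kappa>) + \<kappa>\<^sup>2"
      by (intro tendsto_intros U_lim V_lim \<delta>)
    moreover have "(\<kappa>\<^sup>2 + C * \<delta>) - 2 * \<kappa> * (sqrt (real j / real (j + 1)) * \<kappa>) + \<kappa>\<^sup>2 < e"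
    proof -
      have "(\<kappa>\<^sup>2 + C * \<delta>) - 2 * \<kappa> * (sqrt (real j / real (j + 1)) * \<kappa>) + \<kappa>\<^sup>2 = 2 * \<kappa>\<^sup>2 * (1 - sqrt (real j / real (j + 1))) + C * \<delta>"
        by (simp add: power2_eq_square algebra_simps)
      moreover have "C * \<delta> = e / 4" using C by (simp add: \<delta>_def)
      ultimately show ?thesis using j e by linarith
    qed
    ultimately have "eventually (\<lambda>n. U \<delta> n - 2 * \<kappa> * V j n + \<kappa>\<^sup>2 < e) sequentially" by (rule order_tendstoD(2))
    then show "eventually (\<lambda>n. dist (D n) 0 < e) sequentially"
      using top_le[OF \<delta>] root_ge[OF j(1)] regime[of 2]
    proof eventually_elim
      case (elim n)
      have "2 * \<kappa> * V j n \<le> 2 * \<kappa> * (root n / sqrt (real n))" using elim(3) \<kappa> by (intro mult_left_mono) auto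
      then have "D n < e" using elim unfolding D_def by linarith
      moreover have "0 \<le> D n"
        using gaussian_spectrum.top_deviation(1)[OF spec, of n \<kappa> 1] D_eq[of n] elim \<kappa> by simp
      ultimately show ?case by simp
    qed
  qed

  have dev_nonneg: "dev n \<ge> 0" for n unfolding dev_def by (intro integral_nonneg_AE AE_I2) simp
  have dev_lim: "dev \<longlonglongrightarrow> 0"
  proof (rule tendstoI)
    fix e :: real assume e: "e > 0"
    define \<eta> where "\<eta> = e / (2 * \<kappa>)"
    have \<eta>: "\<eta> > 0" using e \<kappa> by (simp add: \<eta>_def)
    have "(\<lambda>n. D n * (1 + \<kappa> / \<eta>)) \<longlonglongrightarrow> 0 * (1 + \<kappa> / \<eta>)" by (intro tendsto_intros D_lim)
    then have "eventually (\<lambda>n. D n * (1 + \<kappa> / \<eta>) < e / 2) sequentially"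
      using e by (intro order_tendstoD(2)) auto
    then show "eventually (\<lambda>n. dist (dev n) 0 < e) sequentially"
      using regime[of 2]
    proof eventually_elim
      case (elim n)
      have "dev n \<le> D n * (1 + \<kappa> / \<eta>) + \<kappa> * \<eta>"
        using gaussian_spectrum.top_deviation(2)[OF spec, of n \<kappa> \<eta>] D_eq[of n] elim \<kappa> \<eta> by (simp add: dev_def)
      also have "\<kappa> * \<eta> = e / 2" using \<kappa> by (simp add: \<eta>_def)
      also have "D n * (1 + \<kappa> / \<eta>) + e / 2 < e / 2 + e / 2" using elim(1) by (rule add_strict_right_mono)
      finally show ?case using dev_nonneg[of n] by simp
    qed
  qed

  have top_lim: "(\<lambda>n. top n / real n) \<longlonglongrightarrow> \<kappa>\<^sup>2"
  proof (rule LIM_zero_cancel, rule Lim_null_comparison[OF _ dev_lim])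
    show "eventually (\<lambda>n. norm (top n / real n - \<kappa>\<^sup>2) \<le> dev n) sequentially"
      using regime[of 2]
    proof eventually_elim
      case (elim n)
      interpret G: gaussian_spectrum "M n" "m n" n "X n" "q n" "l n" by (rule spec) (use elim in auto)
      have "top n / real n - \<kappa>\<^sup>2 = G.expectation (\<lambda>\<omega>. l n \<omega> 0 / real n - \<kappa>\<^sup>2)"
        using G.integrable_top G.prob_space by (simp add: top_def)
      then show ?case unfolding dev_def by simp
    qed
  qed
  have l1_moment_lim: "(\<lambda>n. haar_l1_moment n / real n) \<longlonglongrightarrow> 2 / pi"
  proof (rule LIM_zero_cancel, rule Lim_null_comparison)
    show "eventually (\<lambda>n. norm (haar_l1_moment n / real n - 2 / pi) \<le> 5 * (1 / sqrt (real n))) sequentially"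
      using eventually_ge_at_top[of 2] by eventually_elim (use haar_l1_moment_limit in auto)
    show "(\<lambda>n. 5 * (1 / sqrt (real n))) \<longlonglongrightarrow> 0" using tendsto_mult[OF tendsto_const inv_sqrt] by simp
  qed

  define lim_r where "lim_r = 2 / pi * \<kappa>\<^sup>2 + (1 - 2 / pi) * (1 / (1 - 0)) * (\<alpha> - \<kappa>\<^sup>2 * 0)"
  have r_lim: "(\<lambda>n. prob_space.expectation (M n) (\<lambda>\<omega>. r_eig (H n \<omega>) (Q n \<omega>)) / (real n)\<^sup>2) \<longlonglongrightarrow> lim_r"
  proof (rule Lim_transform_eventually)
    show "(\<lambda>n. haar_l1_moment n / real n * (top n / real n) + (1 - haar_l1_moment n / real n) * (1 / (1 - 1 / real n)) * (a n - top n / real n * (1 / real n))) \<longlonglongrightarrow> lim_r"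
      unfolding lim_r_def by (intro tendsto_intros l1_moment_lim top_lim a_lim inv_n) auto
    show "eventually (\<lambda>n. haar_l1_moment n / real n * (top n / real n) + (1 - haar_l1_moment n / real n) * (1 / (1 - 1 / real n)) * (a n - top n / real n * (1 / real n))
       = prob_space.expectation (M n) (\<lambda>\<omega>. r_eig (H n \<omega>) (Q n \<omega>)) / (real n)\<^sup>2) sequentially"
      using regime[of 2]
    proof eventually_elim
      case (elim n)
      interpret G: gaussian_spectrum "M n" "m n" n "X n" "q n" "l n" by (rule spec) (use elim in auto)
      define f where "f = (\<lambda>\<omega>. r_eig (H n \<omega>) (Q n \<omega>))"
      have ex: "f \<omega> = (\<Sum>i<m n. (\<Sum>j<n. H n \<omega> $$ (i, j) * sign_pm (Q n \<omega> $$ (j, 0)))\<^sup>2)" if "\<omega> \<in> space (M n)" for \<omega>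
        unfolding f_def by (rule r_eig_explicit) (use carrier[OF that] elim in auto)
      have "f \<omega> = G.r \<omega>" if "\<omega> \<in> space (M n)" for \<omega>
      proof -
        interpret S: gram_spectrum "m n" n "X n \<omega>" "q n \<omega>" "l n \<omega>" by (rule G.spectrum[OF that])
        have "f \<omega> = (\<Sum>i<m n. (\<Sum>j<n. X n \<omega> (i, j) * sign_pm (q n \<omega> j 0)) * (\<Sum>j<n. X n \<omega> (i, j) * sign_pm (q n \<omega> j 0)))"
          by (simp add: ex[OF that] X_def q_def power2_eq_square)
        then show ?thesis unfolding S.gram_quadratic G.r_def by (simp add: power2_eq_square)
      qed
      moreover have "f \<in> borel_measurable (M n)"
      proof (subst measurable_cong[OF ex])
        have "(\<lambda>\<omega>. H n \<omega> $$ (i, j)) \<in> borel_measurable (M n)" if "i < m n" "j < n" for i j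
          using assms(4)[of n] that by (simp add: iid_std_normal_matrix_def random_matrix_def)
        moreover have "(\<lambda>\<omega>. Q n \<omega> $$ (j, 0)) \<in> borel_measurable (M n)" if "j < n" for j
          using assms(5)[of n] that by (simp add: random_matrix_def)
        ultimately show "(\<lambda>\<omega>. \<Sum>i<m n. (\<Sum>j<n. H n \<omega> $$ (i, j) * sign_pm (Q n \<omega> $$ (j, 0)))\<^sup>2) \<in> borel_measurable (M n)"
          by (intro borel_measurable_sum borel_measurable_power borel_measurable_times measurable_compose[OF _ measurable_sign_pm]) auto
      qed
      ultimately have er: "G.expectation f = haar_l1_moment n * top n + (real n - haar_l1_moment n) / (real n - 1) * (real (m n) * real n - top n)"
        unfolding top_def by (intro G.expectation_r) auto
      define x where "x = real n"
      have x: "x > 1" "real (m n) = a n * x" using elim by (auto simp: a_def x_def)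
      have "haar_l1_moment n / x * (top n / x) + (1 - haar_l1_moment n / x) * (1 / (1 - 1 / x)) * (a n - top n / x * (1 / x)) =
        (haar_l1_moment n * top n + (x - haar_l1_moment n) / (x - 1) * (a n * x * x - top n)) / x\<^sup>2"
      proof -
        have "(1 - haar_l1_moment n / x) * (1 / (1 - 1 / x)) = (x - haar_l1_moment n) / (x - 1)" using x(1) by (simp add: field_simps)
        moreover have "a n - top n / x * (1 / x) = (a n * x * x - top n) / x\<^sup>2" using x(1) by (simp add: field_simps power2_eq_square)
        ultimately show ?thesis by (simp add: add_divide_distrib power2_eq_square)
      qed
      then show ?case using er x(2) by (simp add: f_def x_def)
    qed
  qed

  have prob: "tendsto_in_probability M
      (\<lambda>n \<omega>. L n \<omega> $$ (0, 0) * (l1_norm_vec (col (Q n \<omega>) 0))\<^sup>2 / (real n)\<^sup>2) (\<kappa>\<^sup>2 * (2 / pi))"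
    unfolding tendsto_in_probability_def
  proof (intro allI impI)
    fix \<epsilon> :: real assume \<epsilon>: "\<epsilon> > 0"
    have "(\<lambda>n. (dev n + \<kappa>\<^sup>2 * 5 * (1 / sqrt (real n))) / \<epsilon>) \<longlonglongrightarrow> (0 + \<kappa>\<^sup>2 * 5 * 0) / \<epsilon>"
      using \<epsilon> by (intro tendsto_intros dev_lim inv_sqrt) auto
    then have lim: "(\<lambda>n. (dev n + \<kappa>\<^sup>2 * 5 * (1 / sqrt (real n))) / \<epsilon>) \<longlonglongrightarrow> 0" by simp
    show "(\<lambda>n. measure (M n) {\<omega> \<in> space (M n). \<epsilon> < \<bar>L n \<omega> $$ (0, 0) * (l1_norm_vec (col (Q n \<omega>) 0))\<^sup>2 / (real n)\<^sup>2 - \<kappa>\<^sup>2 * (2 / pi)\<bar>}) \<longlonglongrightarrow> 0"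
    proof (rule Lim_null_comparison[OF _ lim])
      show "eventually (\<lambda>n. norm (measure (M n) {\<omega> \<in> space (M n). \<epsilon> < \<bar>L n \<omega> $$ (0, 0) * (l1_norm_vec (col (Q n \<omega>) 0))\<^sup>2 / (real n)\<^sup>2 - \<kappa>\<^sup>2 * (2 / pi)\<bar>})
          \<le> (dev n + \<kappa>\<^sup>2 * 5 * (1 / sqrt (real n))) / \<epsilon>) sequentially"
        using regime[of 2]
      proof eventually_elim
        case (elim n)
        interpret G: gaussian_spectrum "M n" "m n" n "X n" "q n" "l n" by (rule spec) (use elim in auto)
        have "{\<omega> \<in> space (M n). \<epsilon> < \<bar>L n \<omega> $$ (0, 0) * (l1_norm_vec (col (Q n \<omega>) 0))\<^sup>2 / (real n)\<^sup>2 - \<kappa>\<^sup>2 * (2 / pi)\<bar>} =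
          {\<omega> \<in> space (M n). \<bar>l n \<omega> 0 * (\<Sum>i<n. \<bar>q n \<omega> i 0\<bar>)\<^sup>2 / (real n)\<^sup>2 - \<kappa>\<^sup>2 * (2 / pi)\<bar> > \<epsilon>}"
          using l1_norm_col[OF carrier(2), of _ n] elim by (auto simp: l_def q_def)
        then show ?case using G.product_deviation[OF \<epsilon>, of \<kappa>] by (simp add: dev_def)
      qed
    qed
  qed

  have "2 / pi \<le> 1" using pi_gt3 by simp
  then have "0 \<le> (1 - 2 / pi) * \<alpha>" using assms(1) by (intro mult_nonneg_nonneg) auto
  then have "lim_r \<ge> \<kappa>\<^sup>2 * (2 / pi)" by (simp add: lim_r_def mult.commute)
  then show ?thesis using r_lim prob unfolding \<kappa>_def by blast
qed

end
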